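(* Let $\mu$ be a global type of $T$ (viewed as a $\{0,1\}$-valued global Keisler measure) and let $M$ be a small model of $T$. Then the following are equivalent: (i) $\mu$ is $rgs$ over $M$; (ii) $\mu$ is $irgs$ over $M$; (iii) $\mu$ is generically stable over $M$.
   Context: **Classical setting.** $T$ is a complete first-order theory in a countable language $L$, $\mathcal U$ is its monster model, and small models $M$ satisfy $M\preceq\mathcal U$. Partitioned formulas $\varphi(x;y)$ have $|x|=1$ and $y$ a finite tuple. A global (Keisler) measure $\mu(x)$ is a finitely additive probability measure on $L(\mathcal U)$-formulas in $x$; global types are identified with $\{0,1\}$-valued measures. $\mu$ is definable over $M$ if it is $M$-invariant and for each $L$-formula $\varphi(x;y)$ the map $S_y(M)\to[0,1]$, $\mathrm{tp}(b/M)\mapsto\mu(\varphi(x;b))$, is continuous. **Randomization.** For an atomless probability space $(\Omega,\mathcal B,\mathcal P)$, $M_0^\Omega$ is the set of measurable functions $\Omega\to M$ with finite range, written $f=\sum_{i\le n}a_i^{A_i}$ ($f=a_i$ on $A_i$, $(A_i)$ a measurable partition of $\Omega$). For a classical formula $\varphi$, $\llbracket\varphi(f_1,\dots,f_n)\rrbracket=\{\omega: M\models\varphi(f_1(\omega),\dots,f_n(\omega))\}$ and $\mathbb P\llbracket\varphi(\bar f)\rrbracket=\mathcal P(\llbracket\varphi(\bar f)\rrbracket)$. The metric is $d(f,g)=\mathbb P\llbracket f\ne g\rrbracket$; $M^\Omega$ is the completion. $a\in M$ is identified with the constant function $a^\Omega$. $T^R$ is the (complete, continuous) theory of these structures (Ben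 Yaacov–Keisler randomization); it has quantifier elimination, so types are determined by the values of $\mathbb P\llbracket\varphi\rrbracket$, $\varphi$ a classical formula. $\mathcal C$ is the monster model of $T^R$, with $M^\Omega\preceq\mathcal U^\Omega\preceq\mathcal C$. A global random type is an element of $S_x(\mathcal C)$; for such $p$, $\mathbb P^{p}\llbracket\varphi(x;g)\rrbracket$ denotes the value that $p$ assigns to $\mathbb P\llbracket\varphi(x;g)\rrbracket$. **Generic stability.** (Continuous logic) A type $p\in S_x(\mathcal C)$ invariant over $N\preceq\mathcal C$ is generically stable over $N$ if there do not exist a formula $\varphi(x;y)$, a Morley sequence $(a_i)_{i<\omega}$ in $p$ over $N$ (i.e. $a_i\models p|_{Na_{<i}}$), a sequence $(b_i)_{i<\omega}$ in $\mathcal C^y$ and reals $r<s$ such that $\varphi(a_i;b_j)\le r$ if $i\le j$ and $\varphi(a_i;b_j)\ge s$ if $i>j$. (Discrete logic) The same definition for an $M$-invariant $p\in S_x(\mathcal U)$, with $\mathcal U$, $M$ in place of $\mathcal C$, $N$, and $\varphi(a_i;b_j)$ false if $i\le j$, true if $i>j$. **Canonical random extension $r_\mu$.** Let $\mu$ be a global measure definable over $M$. The type $r_\mu\in S_x(\mathcal C)$ is defined by $\mathbb P^{r_\mu}\llbracket\varphi(x;g)\rrbracket=\sum_{i=1}^k\mathcal P(A_i)\,\mu(\varphi(x;a_i))$ for $g=\sum_{i=1}^k a_i^{A_i}$ in $M_0^\Omega$, and for arbitrary $g$ in $\mathcal C$ by $\mathbb P^{r_\mu}\llbracket\varphi(x;g)\rrbracket=\lim_j\mathbb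 P^{r_\mu}\llbracket\varphi(x;g_j)\rrbracket$, where $(g_j)$ is any net in $M_0^\Omega$ with $\mathrm{tp}(g_j/M_0^\Omega)\to\mathrm{tp}(g/M_0^\Omega)$ (this is known to be well defined). **$rgs$ and $irgs$.** A global random type $p_\mu$ is a random extension of $\mu$ if $\mathbb P^{p_\mu}\llbracket\varphi(x;b^\Omega)\rrbracket=\mu(\varphi(x;b))$ for every $L$-formula $\varphi(x;y)$ and every $b\in\mathcal U^{|y|}$. A global measure $\mu$ is $rgs$ over $M$ if it is definable over $M$ and some random extension $p_\mu$ of $\mu$ is generically stable over $M^\Omega$ (for some atomless probability space $(\Omega,\mathcal P)$); it is $irgs$ over $M$ if it is definable over $M$ and $r_\mu$ is generically stable over $M^\Omega$ (for some atomless probability space $(\Omega,\mathcal P)$). *)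

theory Defs
  imports "HOL-Analysis.Analysis" "HOL-Probability.Probability_Measure"
begin

section \<open>Classical first-order logic\<close>

record ('f, 'r) lang =
  fsyms :: "'f set"
  farity :: "'f \<Rightarrow> nat"
  rsyms :: "'r set"
  rarity :: "'r \<Rightarrow> nat"

definition countable_lang :: "('f, 'r) lang \<Rightarrow> bool" where
  "countable_lang L \<longleftrightarrow> countable (fsyms L) \<and> countable (rsyms L)"

text \<open>Variables are de Bruijn indices, looked up in a list. A formula in the variables
  \<open>0, \<dots>, n - 1\<close> is evaluated at an \<open>n\<close>-tuple given as a list, and the partitioned
  formula \<open>\<phi>(x;y)\<close> with \<open>|x| = 1\<close>, \<open>|y| = n\<close> is a formula in \<open>n + 1\<close> variables where
  \<open>x\<close> is variable \<open>0\<close>; so \<open>\<phi>(a;b)\<close> is the value of \<open>\<phi>\<close> at the list \<open>a # b\<close>.\<close>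

datatype 'f tm = Var nat | Fn 'f "'f tm list"

datatype ('f, 'r) fm =
    Eq "'f tm" "'f tm"
  | Rel 'r "'f tm list"
  | Neg "('f, 'r) fm"
  | Conj "('f, 'r) fm" "('f, 'r) fm"
  | Exi "('f, 'r) fm"

primrec wf_tm :: "('f, 'r) lang \<Rightarrow> nat \<Rightarrow> 'f tm \<Rightarrow> bool" where
  "wf_tm L n (Var i) \<longleftrightarrow> i < n"
| "wf_tm L n (Fn f ts) \<longleftrightarrow>
     f \<in> fsyms L \<and> length ts = farity L f \<and> list_all (\<lambda>b. b) (map (wf_tm L n) ts)"

primrec wf_fm :: "('f, 'r) lang \<Rightarrow> nat \<Rightarrow> ('f, 'r) fm \<Rightarrow> bool" where
  "wf_fm L n (Eq s t) \<longleftrightarrow> wf_tm L n s \<and> wf_tm L n t"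
| "wf_fm L n (Rel r ts) \<longleftrightarrow>
     r \<in> rsyms L \<and> length ts = rarity L r \<and> list_all (wf_tm L n) ts"
| "wf_fm L n (Neg \<phi>) \<longleftrightarrow> wf_fm L n \<phi>"
| "wf_fm L n (Conj \<phi> \<psi>) \<longleftrightarrow> wf_fm L n \<phi> \<and> wf_fm L n \<psi>"
| "wf_fm L n (Exi \<phi>) \<longleftrightarrow> wf_fm L (Suc n) \<phi>"

record ('u, 'f, 'r) struct =
  carr :: "'u set"
  fint :: "'f \<Rightarrow> 'u list \<Rightarrow> 'u"
  rint :: "'r \<Rightarrow> 'u list \<Rightarrow> bool"

definition tuples :: "nat \<Rightarrow> 'a set \<Rightarrow> 'a list set" where
  "tuples n A = {xs. length xs = n \<and> set xs \<subseteq> A}"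

definition is_struct :: "('f, 'r) lang \<Rightarrow> ('u, 'f, 'r) struct \<Rightarrow> bool" where
  "is_struct L N \<longleftrightarrow> carr N \<noteq> {} \<and>
     (\<forall>f\<in>fsyms L. \<forall>xs\<in>tuples (farity L f) (carr N). fint N f xs \<in> carr N)"

primrec tval :: "('u, 'f, 'r) struct \<Rightarrow> 'u list \<Rightarrow> 'f tm \<Rightarrow> 'u" where
  "tval N e (Var i) = e ! i"
| "tval N e (Fn f ts) = fint N f (map (tval N e) ts)"

primrec sat :: "('u, 'f, 'r) struct \<Rightarrow> ('f, 'r) fm \<Rightarrow> 'u list \<Rightarrow> bool" where
  "sat N (Eq s t) e \<longleftrightarrow> tval N e s = tval N e t"
| "sat N (Rel r ts) e \<longleftrightarrow> rint N r (map (tval N e) ts)"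
| "sat N (Neg \<phi>) e \<longleftrightarrow> \<not> sat N \<phi> e"
| "sat N (Conj \<phi> \<psi>) e \<longleftrightarrow> sat N \<phi> e \<and> sat N \<psi> e"
| "sat N (Exi \<phi>) e \<longleftrightarrow> (\<exists>a\<in>carr N. sat N \<phi> (a # e))"

text \<open>Theories are deductively closed, so completeness is membership of each sentence or its
  negation. Consistency is expressed by the model.\<close>

definition complete_theory :: "('f, 'r) lang \<Rightarrow> ('f, 'r) fm set \<Rightarrow> bool" where
  "complete_theory L T \<longleftrightarrow> (\<forall>\<sigma>\<in>T. wf_fm L 0 \<sigma>) \<and>
     (\<forall>\<sigma>. wf_fm L 0 \<sigma> \<longrightarrow> \<sigma> \<in> T \<or> Neg \<sigma> \<in> T)"

definition models :: "('f, 'r) lang \<Rightarrow> ('f, 'r) fm set \<Rightarrow> ('u, 'f, 'r) struct \<Rightarrow> bool" where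
  "models L T N \<longleftrightarrow> is_struct L N \<and> (\<forall>\<sigma>\<in>T. sat N \<sigma> [])"

text \<open>Substructures are given by their universe.\<close>

abbreviation sub :: "('u, 'f, 'r) struct \<Rightarrow> 'u set \<Rightarrow> ('u, 'f, 'r) struct" where
  "sub U M \<equiv> U\<lparr>carr := M\<rparr>"

definition elem_sub :: "('f, 'r) lang \<Rightarrow> 'u set \<Rightarrow> ('u, 'f, 'r) struct \<Rightarrow> bool" where
  "elem_sub L M U \<longleftrightarrow> M \<subseteq> carr U \<and> is_struct L (sub U M) \<and>
     (\<forall>n \<phi>. wf_fm L n \<phi> \<longrightarrow> (\<forall>e\<in>tuples n M. sat (sub U M) \<phi> e \<longleftrightarrow> sat U \<phi> e))"


subsection \<open>Types\<close>

text \<open>\<open>params L n A\<close> is the set of \<open>L(A)\<close>-formulas \<open>\<phi>(x;c)\<close> with \<open>|x| = n\<close>, as pairs \<open>(\<phi>, c)\<close>.\<close>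

definition params :: "('f, 'r) lang \<Rightarrow> nat \<Rightarrow> 'u set \<Rightarrow> (('f, 'r) fm \<times> 'u list) set" where
  "params L n A = {(\<phi>, c). wf_fm L (n + length c) \<phi> \<and> set c \<subseteq> A}"

definition types ::
  "('f, 'r) lang \<Rightarrow> ('u, 'f, 'r) struct \<Rightarrow> nat \<Rightarrow> 'u set \<Rightarrow> (('f, 'r) fm \<times> 'u list) set set" where
  "types L U n A = {p. p \<subseteq> params L n A \<and>
     (\<forall>(\<phi>, c)\<in>params L n A. (\<phi>, c) \<in> p \<or> (Neg \<phi>, c) \<in> p) \<and>
     (\<forall>F. finite F \<and> F \<subseteq> p \<longrightarrow>
        (\<exists>b\<in>tuples n (carr U). \<forall>(\<phi>, c)\<in>F. sat U \<phi> (b @ c)))}"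

definition tp ::
  "('f, 'r) lang \<Rightarrow> ('u, 'f, 'r) struct \<Rightarrow> 'u list \<Rightarrow> 'u set \<Rightarrow> (('f, 'r) fm \<times> 'u list) set" where
  "tp L U b A = {(\<phi>, c)\<in>params L (length b) A. sat U \<phi> (b @ c)}"

definition type_space ::
  "('f, 'r) lang \<Rightarrow> ('u, 'f, 'r) struct \<Rightarrow> nat \<Rightarrow> 'u set \<Rightarrow>
     (('f, 'r) fm \<times> 'u list) set topology" where
  "type_space L U n A =
     topology_generated_by ((\<lambda>\<theta>. {p\<in>types L U n A. \<theta> \<in> p}) ` params L n A)"


subsection \<open>Monster models\<close>

text \<open>Convention: a monster model is \<open>\<kappa>\<close>-saturated and strongly \<open>\<kappa>\<close>-homogeneous for
  an uncountable cardinal \<open>\<kappa>\<close> (languages being countable), and small means of cardinality below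
  \<open>\<kappa>\<close>.\<close>

definition small :: "'k rel \<Rightarrow> 'a set \<Rightarrow> bool" where
  "small \<kappa> A \<longleftrightarrow> (card_of A, \<kappa>) \<in> ordLess"

definition uncountable_cardinal :: "'k rel \<Rightarrow> bool" where
  "uncountable_cardinal \<kappa> \<longleftrightarrow> Card_order \<kappa> \<and> (natLeq, \<kappa>) \<in> ordLess"

definition saturated :: "'k rel \<Rightarrow> ('f, 'r) lang \<Rightarrow> ('u, 'f, 'r) struct \<Rightarrow> bool" where
  "saturated \<kappa> L U \<longleftrightarrow> (\<forall>A p. A \<subseteq> carr U \<and> small \<kappa> A \<and> p \<in> types L U 1 A \<longrightarrow>
     (\<exists>a\<in>carr U. tp L U [a] A = p))"

definition automorphism :: "('f, 'r) lang \<Rightarrow> ('u, 'f, 'r) struct \<Rightarrow> ('u \<Rightarrow> 'u) \<Rightarrow> bool" where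
  "automorphism L U h \<longleftrightarrow> bij_betw h (carr U) (carr U) \<and>
     (\<forall>f\<in>fsyms L. \<forall>xs\<in>tuples (farity L f) (carr U). fint U f (map h xs) = h (fint U f xs)) \<and>
     (\<forall>r\<in>rsyms L. \<forall>xs\<in>tuples (rarity L r) (carr U). rint U r (map h xs) \<longleftrightarrow> rint U r xs)"

definition strongly_homogeneous :: "'k rel \<Rightarrow> ('f, 'r) lang \<Rightarrow> ('u, 'f, 'r) struct \<Rightarrow> bool" where
  "strongly_homogeneous \<kappa> L U \<longleftrightarrow> (\<forall>A h. A \<subseteq> carr U \<and> small \<kappa> A \<and> h ` A \<subseteq> carr U \<and>
     (\<forall>n \<phi>. wf_fm L n \<phi> \<longrightarrow> (\<forall>e\<in>tuples n A. sat U \<phi> (map h e) \<longleftrightarrow> sat U \<phi> e)) \<longrightarrow>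
     (\<exists>h'. automorphism L U h' \<and> (\<forall>a\<in>A. h' a = h a)))"

definition monster ::
  "'k rel \<Rightarrow> ('f, 'r) lang \<Rightarrow> ('f, 'r) fm set \<Rightarrow> ('u, 'f, 'r) struct \<Rightarrow> bool" where
  "monster \<kappa> L T U \<longleftrightarrow> uncountable_cardinal \<kappa> \<and> models L T U \<and>
     saturated \<kappa> L U \<and> strongly_homogeneous \<kappa> L U"


subsection \<open>Keisler measures and generic stability\<close>

text \<open>\<open>L(U)\<close>-formulas in \<open>x\<close> are taken up to equivalence, that is, a measure is a function on
  definable sets; \<open>\<mu> (defset U \<phi> b)\<close> is \<open>\<mu>(\<phi>(x;b))\<close>.\<close>

definition defset :: "('u, 'f, 'r) struct \<Rightarrow> ('f, 'r) fm \<Rightarrow> 'u list \<Rightarrow> 'u set" where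
  "defset U \<phi> b = {a\<in>carr U. sat U \<phi> (a # b)}"

definition defsets :: "('f, 'r) lang \<Rightarrow> ('u, 'f, 'r) struct \<Rightarrow> 'u set set" where
  "defsets L U = (\<lambda>(\<phi>, b). defset U \<phi> b) ` params L 1 (carr U)"

definition keisler_measure ::
  "('f, 'r) lang \<Rightarrow> ('u, 'f, 'r) struct \<Rightarrow> ('u set \<Rightarrow> real) \<Rightarrow> bool" where
  "keisler_measure L U \<mu> \<longleftrightarrow> (\<forall>D\<in>defsets L U. 0 \<le> \<mu> D) \<and> \<mu> (carr U) = 1 \<and>
     (\<forall>D\<in>defsets L U. \<forall>E\<in>defsets L U. D \<inter> E = {} \<longrightarrow> \<mu> (D \<union> E) = \<mu> D + \<mu> E)"

definition global_type ::
  "('f, 'r) lang \<Rightarrow> ('u, 'f, 'r) struct \<Rightarrow> ('u set \<Rightarrow> real) \<Rightarrow> bool" where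
  "global_type L U \<mu> \<longleftrightarrow> keisler_measure L U \<mu> \<and> (\<forall>D\<in>defsets L U. \<mu> D \<in> {0, 1})"

definition invariant ::
  "('f, 'r) lang \<Rightarrow> ('u, 'f, 'r) struct \<Rightarrow> 'u set \<Rightarrow> ('u set \<Rightarrow> real) \<Rightarrow> bool" where
  "invariant L U M \<mu> \<longleftrightarrow> (\<forall>n \<phi>. wf_fm L (Suc n) \<phi> \<longrightarrow>
     (\<forall>b\<in>tuples n (carr U). \<forall>b'\<in>tuples n (carr U).
        tp L U b M = tp L U b' M \<longrightarrow> \<mu> (defset U \<phi> b) = \<mu> (defset U \<phi> b')))"

text \<open>For small \<open>M\<close> every point of the type space is some \<open>tp(b/M)\<close> with \<open>b\<close> in \<open>U\<close>, so
  \<open>F\<close> below is the map \<open>tp(b/M) \<mapsto> \<mu>(\<phi>(x;b))\<close>.\<close>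

definition definable_over ::
  "('f, 'r) lang \<Rightarrow> ('u, 'f, 'r) struct \<Rightarrow> 'u set \<Rightarrow> ('u set \<Rightarrow> real) \<Rightarrow> bool" where
  "definable_over L U M \<mu> \<longleftrightarrow> invariant L U M \<mu> \<and>
     (\<forall>n \<phi>. wf_fm L (Suc n) \<phi> \<longrightarrow>
        (\<exists>F. continuous_map (type_space L U n M) (top_of_set {0..1}) F \<and>
             (\<forall>b\<in>tuples n (carr U). F (tp L U b M) = \<mu> (defset U \<phi> b))))"

text \<open>\<open>a \<Turnstile> \<mu>|\<^sub>A\<close>, for a \<open>{0,1}\<close>-valued \<open>\<mu>\<close>.\<close>

definition realizes_on ::
  "('f, 'r) lang \<Rightarrow> ('u, 'f, 'r) struct \<Rightarrow> 'u \<Rightarrow> ('u set \<Rightarrow> real) \<Rightarrow> 'u set \<Rightarrow> bool" where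
  "realizes_on L U a \<mu> A \<longleftrightarrow>
     (\<forall>(\<phi>, c)\<in>params L 1 A. sat U \<phi> (a # c) \<longleftrightarrow> \<mu> (defset U \<phi> c) = 1)"

definition generically_stable ::
  "('f, 'r) lang \<Rightarrow> ('u, 'f, 'r) struct \<Rightarrow> 'u set \<Rightarrow> ('u set \<Rightarrow> real) \<Rightarrow> bool" where
  "generically_stable L U M \<mu> \<longleftrightarrow> global_type L U \<mu> \<and> invariant L U M \<mu> \<and>
     \<not> (\<exists>n \<phi> (a :: nat \<Rightarrow> 'u) (b :: nat \<Rightarrow> 'u list).
          wf_fm L (Suc n) \<phi> \<and>
          (\<forall>i. a i \<in> carr U \<and> realizes_on L U (a i) \<mu> (M \<union> a ` {..<i})) \<and>
          (\<forall>j. b j \<in> tuples n (carr U)) \<and>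
          (\<forall>i j. (i \<le> j \<longrightarrow> \<not> sat U \<phi> (a i # b j)) \<and> (j < i \<longrightarrow> sat U \<phi> (a i # b j))))"


section \<open>Continuous logic\<close>

text \<open>Only relational signatures are needed. A signature is a set of pairs of a predicate symbol
  and its arity. In \<open>CConn u \<phi>s\<close> with \<open>k = length \<phi>s\<close>, the connective is
  the restriction of \<open>u\<close> to \<open>[0,1]\<^sup>k\<close>, a point of \<open>[0,1]\<^sup>k\<close> being padded with zeros
  to a sequence (see \<open>cube\<close>).\<close>

datatype 'p cfm =
    CDist nat nat
  | CPred 'p "nat list"
  | CConn "(nat \<Rightarrow> real) \<Rightarrow> real" "'p cfm list"
  | CSup "'p cfm"
  | CInf "'p cfm"

definition cube :: "nat \<Rightarrow> (nat \<Rightarrow> real) set" where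
  "cube k = {v. (\<forall>i<k. v i \<in> {0..1}) \<and> (\<forall>i\<ge>k. v i = 0)}"

primrec cwf :: "('p \<times> nat) set \<Rightarrow> 'p cfm \<Rightarrow> nat \<Rightarrow> bool" where
  "cwf S (CDist i j) n \<longleftrightarrow> i < n \<and> j < n"
| "cwf S (CPred P is) n \<longleftrightarrow> (P, length is) \<in> S \<and> set is \<subseteq> {..<n}"
| "cwf S (CConn u \<phi>s) n \<longleftrightarrow>
     continuous_on (cube (length \<phi>s)) u \<and> u ` cube (length \<phi>s) \<subseteq> {0..1} \<and>
     list_all (\<lambda>b. b) (map (\<lambda>\<phi>. cwf S \<phi> n) \<phi>s)"
| "cwf S (CSup \<phi>) n \<longleftrightarrow> cwf S \<phi> (Suc n)"
| "cwf S (CInf \<phi>) n \<longleftrightarrow> cwf S \<phi> (Suc n)"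

record ('c, 'p) mstruct =
  mcarr :: "'c set"
  mdist :: "'c \<Rightarrow> 'c \<Rightarrow> real"
  mpred :: "'p \<Rightarrow> 'c list \<Rightarrow> real"

primrec ceval :: "('c, 'p) mstruct \<Rightarrow> 'p cfm \<Rightarrow> 'c list \<Rightarrow> real" where
  "ceval C (CDist i j) e = mdist C (e ! i) (e ! j)"
| "ceval C (CPred P is) e = mpred C P (map (\<lambda>i. e ! i) is)"
| "ceval C (CConn u \<phi>s) e =
     u (\<lambda>i. if i < length \<phi>s then map (\<lambda>\<phi>. ceval C \<phi> e) \<phi>s ! i else 0)"
| "ceval C (CSup \<phi>) e = (SUP a\<in>mcarr C. ceval C \<phi> (a # e))"
| "ceval C (CInf \<phi>) e = (INF a\<in>mcarr C. ceval C \<phi> (a # e))"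

definition metric_structure :: "('p \<times> nat) set \<Rightarrow> ('c, 'p) mstruct \<Rightarrow> bool" where
  "metric_structure S C \<longleftrightarrow> mcarr C \<noteq> {} \<and>
     Metric_space (mcarr C) (mdist C) \<and> Metric_space.mcomplete (mcarr C) (mdist C) \<and>
     (\<forall>x\<in>mcarr C. \<forall>y\<in>mcarr C. mdist C x y \<le> 1) \<and>
     (\<forall>(P, n)\<in>S. (\<forall>xs\<in>tuples n (mcarr C). mpred C P xs \<in> {0..1}) \<and>
        (\<forall>\<epsilon>>0. \<exists>\<delta>>0. \<forall>xs\<in>tuples n (mcarr C). \<forall>ys\<in>tuples n (mcarr C).
           (\<forall>i<n. mdist C (xs ! i) (ys ! i) < \<delta>) \<longrightarrow> \<bar>mpred C P xs - mpred C P ys\<bar> \<le> \<epsilon>))"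

text \<open>The completion of a prestructure, on its Cauchy sequences. Sequences at distance zero are not
  identified; this affects neither values of formulas nor images in a metric structure.\<close>

definition completion :: "('c, 'p) mstruct \<Rightarrow> (nat \<Rightarrow> 'c, 'p) mstruct" where
  "completion C = \<lparr>
     mcarr = {F. range F \<subseteq> mcarr C \<and>
       (\<forall>\<epsilon>>0. \<exists>k. \<forall>m\<ge>k. \<forall>n\<ge>k. mdist C (F m) (F n) < \<epsilon>)},
     mdist = (\<lambda>F G. lim (\<lambda>n. mdist C (F n) (G n))),
     mpred = (\<lambda>P Fs. lim (\<lambda>n. mpred C P (map (\<lambda>F. F n) Fs)))\<rparr>"

definition celem_embedding ::
  "('p \<times> nat) set \<Rightarrow> ('b, 'p) mstruct \<Rightarrow> ('c, 'p) mstruct \<Rightarrow> ('b \<Rightarrow> 'c) \<Rightarrow> bool" where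
  "celem_embedding S B C \<iota> \<longleftrightarrow> \<iota> ` mcarr B \<subseteq> mcarr C \<and>
     (\<forall>n \<phi>. cwf S \<phi> n \<longrightarrow> (\<forall>e\<in>tuples n (mcarr B). ceval C \<phi> (map \<iota> e) = ceval B \<phi> e))"


subsection \<open>Types\<close>

definition cparams :: "('p \<times> nat) set \<Rightarrow> nat \<Rightarrow> 'c set \<Rightarrow> ('p cfm \<times> 'c list) set" where
  "cparams S n A = {(\<phi>, c). cwf S \<phi> (n + length c) \<and> set c \<subseteq> A}"

text \<open>A type in \<open>n\<close> variables over \<open>A\<close> is given by the values of all formulas over \<open>A\<close>;
  the requirement is that these values are approximately finitely satisfiable in \<open>C\<close>.\<close>

definition ctypes ::
  "('p \<times> nat) set \<Rightarrow> ('c, 'p) mstruct \<Rightarrow> nat \<Rightarrow> 'c set \<Rightarrow> ('p cfm \<times> 'c list \<Rightarrow> real) set" where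
  "ctypes S C n A = {p\<in>extensional (cparams S n A).
     \<forall>F \<epsilon>. finite F \<and> F \<subseteq> cparams S n A \<and> 0 < \<epsilon> \<longrightarrow>
       (\<exists>b\<in>tuples n (mcarr C). \<forall>(\<phi>, c)\<in>F. \<bar>ceval C \<phi> (b @ c) - p (\<phi>, c)\<bar> < \<epsilon>)}"

definition ctp ::
  "('p \<times> nat) set \<Rightarrow> ('c, 'p) mstruct \<Rightarrow> 'c list \<Rightarrow> 'c set \<Rightarrow> 'p cfm \<times> 'c list \<Rightarrow> real" where
  "ctp S C b A = restrict (\<lambda>(\<phi>, c). ceval C \<phi> (b @ c)) (cparams S (length b) A)"

definition ctype_space ::
  "('p \<times> nat) set \<Rightarrow> ('c, 'p) mstruct \<Rightarrow> nat \<Rightarrow> 'c set \<Rightarrow>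
     ('p cfm \<times> 'c list \<Rightarrow> real) topology" where
  "ctype_space S C n A =
     subtopology (product_topology (\<lambda>_. euclideanreal) (cparams S n A)) (ctypes S C n A)"


subsection \<open>Monster models\<close>

definition csaturated :: "'k rel \<Rightarrow> ('p \<times> nat) set \<Rightarrow> ('c, 'p) mstruct \<Rightarrow> bool" where
  "csaturated \<kappa> S C \<longleftrightarrow> (\<forall>A p. A \<subseteq> mcarr C \<and> small \<kappa> A \<and> p \<in> ctypes S C 1 A \<longrightarrow>
     (\<exists>a\<in>mcarr C. ctp S C [a] A = p))"

definition cautomorphism :: "('p \<times> nat) set \<Rightarrow> ('c, 'p) mstruct \<Rightarrow> ('c \<Rightarrow> 'c) \<Rightarrow> bool" where
  "cautomorphism S C h \<longleftrightarrow> bij_betw h (mcarr C) (mcarr C) \<and>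
     (\<forall>x\<in>mcarr C. \<forall>y\<in>mcarr C. mdist C (h x) (h y) = mdist C x y) \<and>
     (\<forall>(P, n)\<in>S. \<forall>xs\<in>tuples n (mcarr C). mpred C P (map h xs) = mpred C P xs)"

definition cstrongly_homogeneous :: "'k rel \<Rightarrow> ('p \<times> nat) set \<Rightarrow> ('c, 'p) mstruct \<Rightarrow> bool" where
  "cstrongly_homogeneous \<kappa> S C \<longleftrightarrow> (\<forall>A h. A \<subseteq> mcarr C \<and> small \<kappa> A \<and> h ` A \<subseteq> mcarr C \<and>
     (\<forall>n \<phi>. cwf S \<phi> n \<longrightarrow> (\<forall>e\<in>tuples n A. ceval C \<phi> (map h e) = ceval C \<phi> e)) \<longrightarrow>
     (\<exists>h'. cautomorphism S C h' \<and> (\<forall>a\<in>A. h' a = h a)))"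

definition cmonster :: "'k rel \<Rightarrow> ('p \<times> nat) set \<Rightarrow> ('c, 'p) mstruct \<Rightarrow> bool" where
  "cmonster \<kappa> S C \<longleftrightarrow> uncountable_cardinal \<kappa> \<and> metric_structure S C \<and>
     csaturated \<kappa> S C \<and> cstrongly_homogeneous \<kappa> S C"


subsection \<open>Generic stability\<close>

definition cinvariant ::
  "('p \<times> nat) set \<Rightarrow> ('c, 'p) mstruct \<Rightarrow> 'c set \<Rightarrow> ('p cfm \<times> 'c list \<Rightarrow> real) \<Rightarrow> bool" where
  "cinvariant S C N p \<longleftrightarrow> (\<forall>n \<phi>. cwf S \<phi> (Suc n) \<longrightarrow>
     (\<forall>b\<in>tuples n (mcarr C). \<forall>b'\<in>tuples n (mcarr C).
        ctp S C b N = ctp S C b' N \<longrightarrow> p (\<phi>, b) = p (\<phi>, b')))"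

definition cgenerically_stable ::
  "('p \<times> nat) set \<Rightarrow> ('c, 'p) mstruct \<Rightarrow> 'c set \<Rightarrow> ('p cfm \<times> 'c list \<Rightarrow> real) \<Rightarrow> bool" where
  "cgenerically_stable S C N p \<longleftrightarrow> p \<in> ctypes S C 1 (mcarr C) \<and> cinvariant S C N p \<and>
     \<not> (\<exists>n \<phi> (a :: nat \<Rightarrow> 'c) (b :: nat \<Rightarrow> 'c list) r s.
          cwf S \<phi> (Suc n) \<and>
          (\<forall>i. a i \<in> mcarr C \<and>
             ctp S C [a i] (N \<union> a ` {..<i}) = restrict p (cparams S 1 (N \<union> a ` {..<i}))) \<and>
          (\<forall>j. b j \<in> tuples n (mcarr C)) \<and> r < s \<and>
          (\<forall>i j. (i \<le> j \<longrightarrow> ceval C \<phi> (a i # b j) \<le> r) \<and>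
                 (j < i \<longrightarrow> s \<le> ceval C \<phi> (a i # b j))))"


section \<open>Randomizations\<close>

definition atomless_prob_space :: "'w measure \<Rightarrow> bool" where
  "atomless_prob_space \<Omega> \<longleftrightarrow> prob_space \<Omega> \<and>
     (\<forall>A\<in>sets \<Omega>. 0 < measure \<Omega> A \<longrightarrow>
        (\<exists>B\<in>sets \<Omega>. B \<subseteq> A \<and> 0 < measure \<Omega> B \<and> measure \<Omega> B < measure \<Omega> A))"

text \<open>The randomization language has an \<open>n\<close>-ary predicate symbol
  \<open>\<phi>\<close>, read \<open>\<bbbP>\<lbrakk>\<phi>\<rbrakk>\<close>, for every \<open>L\<close>-formula \<open>\<phi>\<close> in \<open>n\<close> variables.\<close>

definition LR :: "('f, 'r) lang \<Rightarrow> (('f, 'r) fm \<times> nat) set" where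
  "LR L = {(\<phi>, n). wf_fm L n \<phi>}"

definition rand0 ::
  "('u, 'f, 'r) struct \<Rightarrow> 'w measure \<Rightarrow> ('w \<Rightarrow> 'u, ('f, 'r) fm) mstruct" where
  "rand0 N \<Omega> = \<lparr>
     mcarr = {f. simple_function \<Omega> f \<and> f ` space \<Omega> \<subseteq> carr N},
     mdist = (\<lambda>f g. measure \<Omega> {\<omega>\<in>space \<Omega>. f \<omega> \<noteq> g \<omega>}),
     mpred = (\<lambda>\<phi> fs. measure \<Omega> {\<omega>\<in>space \<Omega>. sat N \<phi> (map (\<lambda>f. f \<omega>) fs)})\<rparr>"

definition randomization ::
  "('u, 'f, 'r) struct \<Rightarrow> 'w measure \<Rightarrow> (nat \<Rightarrow> 'w \<Rightarrow> 'u, ('f, 'r) fm) mstruct" where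
  "randomization N \<Omega> = completion (rand0 N \<Omega>)"

text \<open>The theory \<open>T\<^sup>R\<close> of these structures, as the set of closed conditions \<open>\<sigma> = r\<close> true in all
  of them.\<close>

definition TR ::
  "'u itself \<Rightarrow> 'w itself \<Rightarrow> ('f, 'r) lang \<Rightarrow> ('f, 'r) fm set \<Rightarrow> (('f, 'r) fm cfm \<times> real) set" where
  "TR _ _ L T = {(\<sigma>, r). cwf (LR L) \<sigma> 0 \<and>
     (\<forall>(N :: ('u, 'f, 'r) struct) (\<Omega> :: 'w measure).
        models L T N \<and> atomless_prob_space \<Omega> \<longrightarrow> ceval (randomization N \<Omega>) \<sigma> [] = r)}"

definition monster_TR ::
  "'u itself \<Rightarrow> 'w itself \<Rightarrow> 'k rel \<Rightarrow> ('f, 'r) lang \<Rightarrow> ('f, 'r) fm set \<Rightarrow>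
     ('c, ('f, 'r) fm) mstruct \<Rightarrow> bool" where
  "monster_TR tu tw \<kappa> L T C \<longleftrightarrow> cmonster \<kappa> (LR L) C \<and>
     (\<forall>(\<sigma>, r)\<in>TR tu tw L T. ceval C \<sigma> [] = r)"

text \<open>The inclusions \<open>M\<^sup>\<Omega> \<preceq> U\<^sup>\<Omega> \<preceq> C\<close>, the second one being given by an elementary embedding
  \<open>\<iota>\<close>, with \<open>M\<^sup>\<Omega>\<close> small in \<open>C\<close>.\<close>

definition rand_embedding ::
  "'k rel \<Rightarrow> ('f, 'r) lang \<Rightarrow> ('u, 'f, 'r) struct \<Rightarrow> 'u set \<Rightarrow> ('c, ('f, 'r) fm) mstruct \<Rightarrow>
     'w measure \<Rightarrow> ((nat \<Rightarrow> 'w \<Rightarrow> 'u) \<Rightarrow> 'c) \<Rightarrow> bool" where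
  "rand_embedding \<kappa> L U M C \<Omega> \<iota> \<longleftrightarrow>
     celem_embedding (LR L) (randomization (sub U M) \<Omega>) (randomization U \<Omega>) id \<and>
     celem_embedding (LR L) (randomization U \<Omega>) C \<iota> \<and>
     small \<kappa> (\<iota> ` mcarr (randomization (sub U M) \<Omega>))"

text \<open>The images in \<open>C\<close> of elements of \<open>U\<^sub>0\<^sup>\<Omega>\<close> and of constants \<open>a\<^sup>\<Omega>\<close>.\<close>

definition emb0 :: "((nat \<Rightarrow> 'w \<Rightarrow> 'u) \<Rightarrow> 'c) \<Rightarrow> ('w \<Rightarrow> 'u) \<Rightarrow> 'c" where
  "emb0 \<iota> f = \<iota> (\<lambda>_. f)"

definition embc :: "((nat \<Rightarrow> 'w \<Rightarrow> 'u) \<Rightarrow> 'c) \<Rightarrow> 'u \<Rightarrow> 'c" where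
  "embc \<iota> a = emb0 \<iota> (\<lambda>_. a)"

text \<open>\<open>Pval p \<phi> g\<close> is the value assigned by \<open>p\<close> to \<open>\<bbbP>\<lbrakk>\<phi>(x;g)\<rbrakk>\<close>.\<close>

definition Pval ::
  "(('f, 'r) fm cfm \<times> 'c list \<Rightarrow> real) \<Rightarrow> ('f, 'r) fm \<Rightarrow> 'c list \<Rightarrow> real" where
  "Pval p \<phi> g = p (CPred \<phi> [0..<Suc (length g)], g)"

definition random_extension ::
  "('f, 'r) lang \<Rightarrow> ('u, 'f, 'r) struct \<Rightarrow> ('c, ('f, 'r) fm) mstruct \<Rightarrow>
     ((nat \<Rightarrow> 'w \<Rightarrow> 'u) \<Rightarrow> 'c) \<Rightarrow> ('u set \<Rightarrow> real) \<Rightarrow> (('f, 'r) fm cfm \<times> 'c list \<Rightarrow> real) \<Rightarrow> bool"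
  where
  "random_extension L U C \<iota> \<mu> p \<longleftrightarrow> p \<in> ctypes (LR L) C 1 (mcarr C) \<and>
     (\<forall>n \<phi>. wf_fm L (Suc n) \<phi> \<longrightarrow>
        (\<forall>b\<in>tuples n (carr U). Pval p \<phi> (map (embc \<iota>) b) = \<mu> (defset U \<phi> b)))"

text \<open>\<open>\<Sum> \<P>(A\<^sub>i) \<mu>(\<phi>(x;a\<^sub>i))\<close> for the tuple \<open>g = \<Sum> a\<^sub>i\<^bsup>A\<^sub>i\<^esup>\<close> of simple functions, the \<open>a\<^sub>i\<close>
  being the distinct values of the tuple.\<close>

definition rmu0 ::
  "('u, 'f, 'r) struct \<Rightarrow> 'w measure \<Rightarrow> ('u set \<Rightarrow> real) \<Rightarrow> ('f, 'r) fm \<Rightarrow> ('w \<Rightarrow> 'u) list \<Rightarrow> real"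
  where
  "rmu0 U \<Omega> \<mu> \<phi> g = (\<Sum>a\<in>(\<lambda>\<omega>. map (\<lambda>f. f \<omega>) g) ` space \<Omega>.
     measure \<Omega> {\<omega>\<in>space \<Omega>. map (\<lambda>f. f \<omega>) g = a} * \<mu> (defset U \<phi> a))"

text \<open>\<open>p\<close> is the type \<open>r\<^sub>\<mu>\<close>. Nets \<open>(g\<^sub>j)\<close> in \<open>M\<^sub>0\<^sup>\<Omega>\<close> are rendered as proper filters on tuples
  from \<open>M\<^sub>0\<^sup>\<Omega>\<close>.\<close>

definition canonical_extension ::
  "('f, 'r) lang \<Rightarrow> ('u, 'f, 'r) struct \<Rightarrow> 'u set \<Rightarrow> ('c, ('f, 'r) fm) mstruct \<Rightarrow> 'w measure \<Rightarrow>
     ((nat \<Rightarrow> 'w \<Rightarrow> 'u) \<Rightarrow> 'c) \<Rightarrow> ('u set \<Rightarrow> real) \<Rightarrow> (('f, 'r) fm cfm \<times> 'c list \<Rightarrow> real) \<Rightarrow> bool"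
  where
  "canonical_extension L U M C \<Omega> \<iota> \<mu> p \<longleftrightarrow> p \<in> ctypes (LR L) C 1 (mcarr C) \<and>
     (let M0 = mcarr (rand0 (sub U M) \<Omega>) in
      \<forall>n \<phi>. wf_fm L (Suc n) \<phi> \<longrightarrow>
        (\<forall>g\<in>tuples n M0. Pval p \<phi> (map (emb0 \<iota>) g) = rmu0 U \<Omega> \<mu> \<phi> g) \<and>
        (\<forall>g\<in>tuples n (mcarr C). \<forall>\<F>.
           \<F> \<noteq> bot \<and> (\<forall>\<^sub>F h in \<F>. h \<in> tuples n M0) \<and>
           limitin (ctype_space (LR L) C n (emb0 \<iota> ` M0))
             (\<lambda>h. ctp (LR L) C (map (emb0 \<iota>) h) (emb0 \<iota> ` M0))
             (ctp (LR L) C g (emb0 \<iota> ` M0)) \<F> \<longrightarrow>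
           ((\<lambda>h. Pval p \<phi> (map (emb0 \<iota>) h)) \<longlongrightarrow> Pval p \<phi> g) \<F>))"

definition rgs ::
  "'w itself \<Rightarrow> 'k rel \<Rightarrow> ('f, 'r) lang \<Rightarrow> ('u, 'f, 'r) struct \<Rightarrow> ('c, ('f, 'r) fm) mstruct \<Rightarrow>
     'u set \<Rightarrow> ('u set \<Rightarrow> real) \<Rightarrow> bool" where
  "rgs _ \<kappa> L U C M \<mu> \<longleftrightarrow> definable_over L U M \<mu> \<and>
     (\<exists>(\<Omega> :: 'w measure) \<iota> p. atomless_prob_space \<Omega> \<and> rand_embedding \<kappa> L U M C \<Omega> \<iota> \<and>
        random_extension L U C \<iota> \<mu> p \<and>
        cgenerically_stable (LR L) C (\<iota> ` mcarr (randomization (sub U M) \<Omega>)) p)"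

definition irgs ::
  "'w itself \<Rightarrow> 'k rel \<Rightarrow> ('f, 'r) lang \<Rightarrow> ('u, 'f, 'r) struct \<Rightarrow> ('c, ('f, 'r) fm) mstruct \<Rightarrow>
     'u set \<Rightarrow> ('u set \<Rightarrow> real) \<Rightarrow> bool" where
  "irgs _ \<kappa> L U C M \<mu> \<longleftrightarrow> definable_over L U M \<mu> \<and>
     (\<exists>(\<Omega> :: 'w measure) \<iota> p. atomless_prob_space \<Omega> \<and> rand_embedding \<kappa> L U M C \<Omega> \<iota> \<and>
        canonical_extension L U M C \<Omega> \<iota> \<mu> p \<and>
        cgenerically_stable (LR L) C (\<iota> ` mcarr (randomization (sub U M) \<Omega>)) p)"

end

theory Submission
  imports Defs
begin

text \<open>Let \<open>P\<lbrakk>\<phi>(g)\<rbrakk>\<close> be the probability that \<open>\<phi>\<close> holds of the tuple \<open>g\<close> of random elements. Two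
  principles carry the proof.

  The first is quantifier elimination for randomizations (\<open>quantifier_elimination\<close>): up to any
  \<open>\<epsilon>\<close>, the value of a continuous formula is determined by finitely many probabilities
  \<open>P\<lbrakk>\<psi>\<rbrakk>\<close>. For random elements with finite range this is a back-and-forth argument. Given a tuple
  \<open>e\<close>, what matters about a further random element \<open>g\<close> is which classical pattern it
  realizes over \<open>e\<close>, and how often; over another tuple realizing each set of possible patterns
  with almost the same probability, an atomless probability space can be cut into pieces of the required
  measures, and one realizes the patterns piecewise (\<open>back_and_forth\<close>). The monster model of the
  randomized theory inherits the statement because finitely many conditions on a tuple of it can
  be met approximately by random elements with finite range (\<open>approximation\<close>). Hence a
  random type is determined by the probabilities that it gives to classical formulas
  (\<open>type_determined\<close>).

  The second is a uniform bound for a generically stable type \<open>\<mu>\<close>: for each formula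
  \<open>\<phi>(x;y)\<close> there is \<open>N\<close> such that no tuple \<open>b\<close> makes all of \<open>N\<close>
  members of a Morley sequence disagree with \<open>\<mu>\<close> about \<open>\<phi>(x;b)\<close>
  (\<open>generic_truth_value_attained\<close>). For if \<open>b\<close> makes \<open>\<phi>\<close> fail on \<open>j\<close> members although
  \<open>\<phi>(x;b)\<close> belongs to \<open>\<mu>\<close>, these members can be continued by realizations of \<open>\<mu>\<close>
  over \<open>b\<close>, where \<open>\<phi>\<close> holds; as all Morley sequences have the same type, every initial
  failure pattern is consistent with one fixed Morley sequence, and saturation produces the order
  property. It follows that \<open>\<mu>\<close> is decided by majority votes of Morley sequences, hence
  definable (\<open>gen_definable\<close>).

  \<^emph>\<open>rgs implies generically stable.\<close> The probabilities of a random extension of \<open>\<mu>\<close> over random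
  elements with finite range are forced, since \<open>\<mu>\<close> takes only the values 0 and 1
  (\<open>random_extension_R0\<close>). So the constants \<open>a\<^sub>i\<^sup>\<Omega>\<close> of a Morley sequence of \<open>\<mu>\<close> form
  a Morley sequence of the random extension, and an order pattern for \<open>\<mu>\<close> is one for the
  extension.

  \<^emph>\<open>generically stable implies irgs.\<close> Replacing \<open>\<phi>\<close> by its definition over \<open>M\<close>
  prescribes the probabilities of a random type over the whole monster model. Finitely many of these
  conditions are met by the constant of one realization of \<open>\<mu>\<close>, so compactness gives the
  type (\<open>ex_type\<close>), and it is canonical. Suppose that it had an order pattern. Along a random Morley
  sequence the first-order statement ``no \<open>y\<close> makes all these \<open>N\<close> elements disagree with
  the definition of \<open>\<phi>\<close>'' holds almost surely. Therefore, for each classical formula, the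
  total probability of disagreement along the sequence is at most \<open>N\<close>, whatever the parameters
  are (\<open>disagreement_sum\<close>). By quantifier elimination all but a bounded number of members
  of the sequence give almost the same value to a continuous formula, which rules out the pattern.

  \<^emph>\<open>irgs implies rgs.\<close> Let simple random elements \<open>h\<close> over \<open>M\<close> converge in type to
  the constant \<open>b\<^sup>\<Omega>\<close>. By continuity of \<open>\<mu>(\<phi>(x;y))\<close> at the type of \<open>b\<close> over \<open>M\<close>, most
  values of \<open>h\<close> are parameters about which \<open>\<mu>\<close> says the same as about \<open>b\<close>, so the
  canonical extension has the right value at \<open>b\<^sup>\<Omega>\<close> (\<open>canonical_extension_random\<close>).\<close>

section \<open>Compactness of product cubes\<close>

text \<open>The form in which compactness is used here: a cluster point \<open>p\<close> of the evaluations
  \<open>v x\<close> along the filter generated by the conditions \<open>P j\<close>. With \<open>v\<close> recording truth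
  values or values of formulas, \<open>p\<close> is a complete type extending a finitely satisfiable set of
  conditions.\<close>

lemma cluster_point_of_consistent_conditions:
  fixes v :: "'x \<Rightarrow> 'i \<Rightarrow> real"
  assumes v: "\<And>x i. v x i \<in> {0..1}"
    and fip: "\<And>J0. finite J0 \<Longrightarrow> J0 \<subseteq> J \<Longrightarrow> \<exists>x\<in>X. \<forall>j\<in>J0. P j x"
  obtains p where "\<And>i. p i \<in> {0..1}"
    and "\<And>I J0 e. finite I \<Longrightarrow> finite J0 \<Longrightarrow> J0 \<subseteq> J \<Longrightarrow> e > 0 \<Longrightarrow>
      \<exists>x\<in>X. (\<forall>j\<in>J0. P j x) \<and> (\<forall>i\<in>I. \<bar>v x i - p i\<bar> < e)"
proof -
  define S where "S J0 = {x\<in>X. \<forall>j\<in>J0. P j x}" for J0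
  define F where "F = (INF J0\<in>{J0. finite J0 \<and> J0 \<subseteq> J}. principal (S J0))"
  have F: "F \<noteq> bot"
    unfolding F_def
  proof (rule INF_filter_not_bot)
    fix \<J> assume \<J>: "\<J> \<subseteq> {J0. finite J0 \<and> J0 \<subseteq> J}" "finite \<J>"
    have fin: "finite (\<Union>\<J>)" using \<J> by auto
    have sub: "\<Union>\<J> \<subseteq> J" using \<J> by auto
    obtain x where "x \<in> X" "\<forall>j\<in>\<Union>\<J>. P j x"
      using fip[OF fin sub] by auto
    then have "x \<in> (\<Inter>J0\<in>\<J>. S J0)" by (auto simp: S_def)
    then show "(INF i\<in>\<J>. principal (S i)) \<noteq> bot"
      using \<J>(2) by (auto simp: INF_principal_finite principal_eq_bot_iff)
  qed
  have ev: "eventually (\<lambda>x. x \<in> S J0) F" if "finite J0" "J0 \<subseteq> J" for J0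
    unfolding F_def using that
    by (intro eventually_INF1[of J0]) (auto simp: eventually_principal)
  let ?K = "PiE UNIV (\<lambda>_. {0..1}) :: ('i \<Rightarrow> real) set"
  have "compactin (product_topology (\<lambda>_. euclideanreal) UNIV) ?K"
    by (subst compactin_PiE) (auto simp: compact_Icc)
  then have "compact ?K"
    by (simp add: euclidean_product_topology)
  moreover have "filtermap v F \<noteq> bot" using F by (simp add: filtermap_bot_iff)
  moreover have "eventually (\<lambda>q. q \<in> ?K) (filtermap v F)"
    using v by (auto simp: eventually_filtermap PiE_def)
  ultimately obtain p where p: "p \<in> ?K" "inf (nhds p) (filtermap v F) \<noteq> bot"
    unfolding compact_filter by blast
  show ?thesis
  proof
    show "p i \<in> {0..1}" for i using p(1) by (auto simp: PiE_def Pi_def)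
    fix I :: "'i set" and J0 and e :: real
    assume fin: "finite I" "finite J0" "J0 \<subseteq> J" and e: "e > 0"
    define W where "W = {q::'i\<Rightarrow>real. \<forall>i\<in>I. \<bar>q i - p i\<bar> < e}"
    have "W = (\<Inter>i\<in>I. {q. \<bar>q i - p i\<bar> < e})" by (auto simp: W_def)
    moreover have "open {q::'i\<Rightarrow>real. \<bar>q i - p i\<bar> < e}" for i
      by (intro open_Collect_less continuous_intros continuous_on_product_coordinates)
    ultimately have "open W" using fin(1) by auto
    moreover have "p \<in> W" using e by (simp add: W_def)
    ultimately have "eventually (\<lambda>q. q \<in> W) (nhds p)" by (rule eventually_nhds_in_open)
    show "\<exists>x\<in>X. (\<forall>j\<in>J0. P j x) \<and> (\<forall>i\<in>I. \<bar>v x i - p i\<bar> < e)"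
    proof (rule ccontr)
      assume "\<not> ?thesis"
      then have "eventually (\<lambda>x. v x \<notin> W) F"
        using ev[OF fin(2,3)] by (auto simp: W_def S_def elim!: eventually_mono)
      then have "eventually (\<lambda>q. q \<notin> W) (filtermap v F)"
        by (simp add: eventually_filtermap)
      with \<open>eventually (\<lambda>q. q \<in> W) (nhds p)\<close>
      have "eventually (\<lambda>q. False) (inf (nhds p) (filtermap v F))"
        by (auto simp: eventually_inf)
      then show False using p(2) by (simp add: trivial_limit_def)
    qed
  qed
qed

section \<open>Renaming of variables and definable relations\<close>

primrec ren_tm :: "(nat \<Rightarrow> nat) \<Rightarrow> 'f tm \<Rightarrow> 'f tm" where
  "ren_tm r (Var i) = Var (r i)"
| "ren_tm r (Fn f ts) = Fn f (map (ren_tm r) ts)"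

primrec ren_fm :: "(nat \<Rightarrow> nat) \<Rightarrow> ('f, 'r) fm \<Rightarrow> ('f, 'r) fm" where
  "ren_fm r (Eq s t) = Eq (ren_tm r s) (ren_tm r t)"
| "ren_fm r (Rel R ts) = Rel R (map (ren_tm r) ts)"
| "ren_fm r (Neg \<phi>) = Neg (ren_fm r \<phi>)"
| "ren_fm r (Conj \<phi> \<psi>) = Conj (ren_fm r \<phi>) (ren_fm r \<psi>)"
| "ren_fm r (Exi \<phi>) = Exi (ren_fm (case_nat 0 (\<lambda>i. Suc (r i))) \<phi>)"

lemma tval_ren_tm:
  "wf_tm L n t \<Longrightarrow> \<forall>i<n. e' ! i = e ! r i \<Longrightarrow> tval N e (ren_tm r t) = tval N e' t"
proof (induction t)
  case (Fn f ts)
  then show ?case by (auto simp: list_all_iff intro!: arg_cong[where f="fint N f"])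
qed auto

lemma sat_ren_fm:
  "wf_fm L n \<phi> \<Longrightarrow> \<forall>i<n. e' ! i = e ! r i \<Longrightarrow> sat N (ren_fm r \<phi>) e = sat N \<phi> e'"
proof (induction \<phi> arbitrary: n r e e')
  case (Rel R ts)
  then have "map (tval N e) (map (ren_tm r) ts) = map (tval N e') ts"
    by (auto simp: list_all_iff tval_ren_tm[of L n])
  then show ?case by (simp only: ren_fm.simps sat.simps)
next
  case (Exi \<phi>)
  have "sat N (ren_fm (case_nat 0 (\<lambda>i. Suc (r i))) \<phi>) (a # e) = sat N \<phi> (a # e')" for a
    using Exi.prems by (intro Exi.IH[of "Suc n"]) (auto split: nat.split simp: nth_Cons)
  then show ?case by simp
qed (auto simp: tval_ren_tm)

lemma wf_ren_tm: "wf_tm L n t \<Longrightarrow> \<forall>i<n. r i < m \<Longrightarrow> wf_tm L m (ren_tm r t)"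
  by (induction t) (auto simp: list_all_iff)

lemma wf_ren_fm: "wf_fm L n \<phi> \<Longrightarrow> \<forall>i<n. r i < m \<Longrightarrow> wf_fm L m (ren_fm r \<phi>)"
proof (induction \<phi> arbitrary: n m r)
  case (Exi \<phi>)
  then show ?case
    by (simp, intro Exi.IH[of "Suc n"]) (auto split: nat.split)
qed (auto simp: list_all_iff wf_ren_tm)

lemma tuplesI [intro]: "length e = n \<Longrightarrow> set e \<subseteq> A \<Longrightarrow> e \<in> tuples n A"
  by (simp add: tuples_def)

lemma tuplesD: "e \<in> tuples n A \<Longrightarrow> length e = n" "e \<in> tuples n A \<Longrightarrow> set e \<subseteq> A"
  by (simp_all add: tuples_def)

lemma tuples_append: "e \<in> tuples m A \<Longrightarrow> e' \<in> tuples n A \<Longrightarrow> e @ e' \<in> tuples (m + n) A"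
  by (auto simp: tuples_def)

lemma tuples_Cons [simp]: "x # e \<in> tuples (Suc n) A \<longleftrightarrow> x \<in> A \<and> e \<in> tuples n A"
  by (auto simp: tuples_def)

lemma tuples_0 [simp]: "tuples 0 A = {[]}"
  by (auto simp: tuples_def)

lemma tuples_take_drop: "z \<in> tuples (m + n) A \<Longrightarrow> take m z \<in> tuples m A \<and> drop m z \<in> tuples n A"
  by (auto simp: tuples_def dest: in_set_takeD in_set_dropD)

lemma tuples_SucE:
  assumes "e \<in> tuples (Suc n) A"
  obtains x e' where "e = x # e'" "x \<in> A" "e' \<in> tuples n A"
  using assms by (cases e) (auto simp: tuples_def)

lemma tuples_mono: "A \<subseteq> B \<Longrightarrow> tuples n A \<subseteq> tuples n B"
  by (auto simp: tuples_def)

text \<open>Definable relations are handled semantically, as predicates on tuples, so that formulas need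
  not be written down: the closure properties below build them. The parameters \<open>c\<close> are kept
  behind the variables, as in the types and measures.\<close>

definition definable :: "('f, 'r) lang \<Rightarrow> ('u, 'f, 'r) struct \<Rightarrow> 'u set \<Rightarrow> nat \<Rightarrow> ('u list \<Rightarrow> bool) \<Rightarrow> bool"
  where "definable L U A k D \<longleftrightarrow> (\<exists>\<phi> c. set c \<subseteq> A \<and> wf_fm L (k + length c) \<phi> \<and>
    (\<forall>e\<in>tuples k (carr U). D e \<longleftrightarrow> sat U \<phi> (e @ c)))"

lemma definable_sat_params: "set c \<subseteq> A \<Longrightarrow> wf_fm L (k + length c) \<phi> \<Longrightarrow> definable L U A k (\<lambda>e. sat U \<phi> (e @ c))"
  unfolding definable_def by blast

lemma definable_sat: "wf_fm L k \<phi> \<Longrightarrow> definable L U A k (sat U \<phi>)"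
  using definable_sat_params[of "[]" A L k \<phi> U] by simp

lemma definable_cong:
  "(\<And>e. e \<in> tuples k (carr U) \<Longrightarrow> D e = D' e) \<Longrightarrow> definable L U A k D = definable L U A k D'"
  unfolding definable_def by (metis (no_types, lifting))

lemma definable_mono: "definable L U A k D \<Longrightarrow> A \<subseteq> B \<Longrightarrow> definable L U B k D"
  unfolding definable_def by (meson order_trans)

lemma definable_emptyE:
  assumes "definable L U {} k D"
  obtains \<phi> where "wf_fm L k \<phi>" "\<And>e. e \<in> tuples k (carr U) \<Longrightarrow> D e \<longleftrightarrow> sat U \<phi> e"
  using assms unfolding definable_def by auto

lemma definable_neg: "definable L U A k D \<Longrightarrow> definable L U A k (\<lambda>e. \<not> D e)"
  unfolding definable_def by (metis sat.simps(3) wf_fm.simps(3))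

text \<open>The two formulas bring different parameters. These are concatenated, and the second
  formula is renamed to skip the parameters of the first.\<close>

lemma definable_conj:
  assumes "definable L U A k D" "definable L U A k E" shows "definable L U A k (\<lambda>e. D e \<and> E e)"
proof -
  obtain \<phi> c where 1: "set c \<subseteq> A" "wf_fm L (k + length c) \<phi>"
    "\<And>e. e\<in>tuples k (carr U) \<Longrightarrow> D e \<longleftrightarrow> sat U \<phi> (e @ c)" using assms(1) unfolding definable_def by auto
  obtain \<psi> d where 2: "set d \<subseteq> A" "wf_fm L (k + length d) \<psi>"
    "\<And>e. e\<in>tuples k (carr U) \<Longrightarrow> E e \<longleftrightarrow> sat U \<psi> (e @ d)" using assms(2) unfolding definable_def by auto
  let ?r = "\<lambda>i. if i < k then i else i + length c"
  let ?\<chi> = "Conj (ren_fm id \<phi>) (ren_fm ?r \<psi>)"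
  have "D e \<and> E e \<longleftrightarrow> sat U ?\<chi> (e @ c @ d)" if e: "e \<in> tuples k (carr U)" for e
  proof -
    have "length e = k" using e by (simp add: tuplesD)
    then have "sat U (ren_fm id \<phi>) (e @ c @ d) = sat U \<phi> (e @ c)"
      "sat U (ren_fm ?r \<psi>) (e @ c @ d) = sat U \<psi> (e @ d)"
      by (auto intro!: sat_ren_fm[OF 1(2)] sat_ren_fm[OF 2(2)] simp: nth_append)
    then show ?thesis using 1(3)[OF e] 2(3)[OF e] by simp
  qed
  moreover have "wf_fm L (k + length (c @ d)) ?\<chi>"
    by (auto intro!: wf_ren_fm[OF 1(2)] wf_ren_fm[OF 2(2)])
  ultimately show ?thesis
    unfolding definable_def using 1(1) 2(1)
    by (intro exI[of _ ?\<chi>] exI[of _ "c @ d"]) auto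
qed

lemma definable_const: "definable L U A k (\<lambda>_. b)"
proof -
  have "wf_fm L k (Exi (Neg (Eq (Var 0) (Var 0))))" by simp
  moreover have "sat U (Exi (Neg (Eq (Var 0) (Var 0)))) = (\<lambda>_. False)" by auto
  ultimately have "definable L U A k (\<lambda>_. False)" using definable_sat by metis
  then show ?thesis using definable_neg[of L U A k "\<lambda>_. False"] by (cases b) auto
qed

lemma definable_disj: "definable L U A k D \<Longrightarrow> definable L U A k E \<Longrightarrow> definable L U A k (\<lambda>e. D e \<or> E e)"
  using definable_neg[OF definable_conj[OF definable_neg[of L U A k D] definable_neg[of L U A k E]]] by simp

lemma definable_iff: "definable L U A k D \<Longrightarrow> definable L U A k E \<Longrightarrow> definable L U A k (\<lambda>e. D e \<longleftrightarrow> E e)"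
proof -
  assume "definable L U A k D" "definable L U A k E"
  then have "definable L U A k (\<lambda>e. (\<not> D e \<or> E e) \<and> (\<not> E e \<or> D e))"
    by (intro definable_conj definable_disj definable_neg)
  moreover have "(\<lambda>e. (\<not> D e \<or> E e) \<and> (\<not> E e \<or> D e)) = (\<lambda>e. D e \<longleftrightarrow> E e)" by auto
  ultimately show ?thesis by simp
qed

lemma definable_ball:
  assumes "finite I" "\<And>i. i \<in> I \<Longrightarrow> definable L U A k (D i)"
  shows "definable L U A k (\<lambda>e. \<forall>i\<in>I. D i e)"
  using assms by (induction I) (auto intro: definable_const definable_conj)

lemma definable_bex:
  assumes "finite I" "\<And>i. i \<in> I \<Longrightarrow> definable L U A k (D i)"
  shows "definable L U A k (\<lambda>e. \<exists>i\<in>I. D i e)"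
  using assms by (induction I) (auto intro: definable_const definable_disj)

lemma definable_ren:
  assumes D: "definable L U A n D" and js: "set js \<subseteq> {..<k}" "length js = n"
  shows "definable L U A k (\<lambda>e. D (map ((!) e) js))"
proof -
  obtain \<phi> c where 1: "set c \<subseteq> A" "wf_fm L (n + length c) \<phi>"
    "\<And>e. e\<in>tuples n (carr U) \<Longrightarrow> D e \<longleftrightarrow> sat U \<phi> (e @ c)" using D unfolding definable_def by auto
  let ?r = "\<lambda>i. if i < n then js ! i else i - n + k"
  have r: "i < n \<Longrightarrow> js ! i < k" for i using js by (metis lessThan_iff nth_mem subsetD)
  have "D (map ((!) e) js) \<longleftrightarrow> sat U (ren_fm ?r \<phi>) (e @ c)" if e: "e \<in> tuples k (carr U)" for e
  proof -
    have le: "length e = k" using e by (simp add: tuplesD)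
    then have "sat U (ren_fm ?r \<phi>) (e @ c) = sat U \<phi> (map ((!) e) js @ c)"
      using js r by (intro sat_ren_fm[OF 1(2)]) (auto simp: nth_append)
    moreover have "map ((!) e) js \<in> tuples n (carr U)"
      using js e le by (auto simp: tuples_def subset_iff)
    ultimately show ?thesis using 1(3) by simp
  qed
  moreover have "wf_fm L (k + length c) (ren_fm ?r \<phi>)"
    using r by (intro wf_ren_fm[OF 1(2)]) (auto simp: trans_less_add1)
  ultimately show ?thesis
    unfolding definable_def using 1(1) by blast
qed

lemma definable_inst:
  assumes D: "definable L U A (k + n) D" and c: "c \<in> tuples n B" and "A \<subseteq> B" "B \<subseteq> carr U"
  shows "definable L U B k (\<lambda>e. D (e @ c))"
proof -
  obtain \<phi> d where 1: "set d \<subseteq> A" "wf_fm L (k + n + length d) \<phi>"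
    "\<And>e. e\<in>tuples (k + n) (carr U) \<Longrightarrow> D e \<longleftrightarrow> sat U \<phi> (e @ d)" using D unfolding definable_def by auto
  have "D (e @ c) \<longleftrightarrow> sat U \<phi> (e @ (c @ d))" if "e \<in> tuples k (carr U)" for e
    using 1(3)[of "e @ c"] tuples_append[OF that, of c n] c assms(4) by (auto simp: tuples_def)
  then show ?thesis
    unfolding definable_def using 1(1,2) c assms(3)
    by (intro exI[of _ \<phi>] exI[of _ "c @ d"]) (auto simp: tuples_def add.assoc)
qed

text \<open>Index lists of this shape turn a relation in \<open>Suc n\<close> variables into one where variable
  0 is found among later variables.\<close>

lemma map_nth_tail: "length e = n \<Longrightarrow> map ((!) (e @ d)) ((n + k) # [0..<n]) = d ! k # e"
  by (auto intro!: nth_equalityI simp: nth_append nth_Cons split: nat.split)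

lemma definable_Cons:
  assumes "definable L U A (Suc n) D" "a \<in> B" "A \<subseteq> B" "B \<subseteq> carr U"
  shows "definable L U B n (\<lambda>y. D (a # y))"
proof -
  have "definable L U A (n + 1) (\<lambda>e. D (map ((!) e) ((n + 0) # [0..<n])))"
    using assms(1) by (intro definable_ren) auto
  then have "definable L U B n (\<lambda>y. D (map ((!) (y @ [a])) ((n + 0) # [0..<n])))" (is "definable _ _ _ _ ?D")
    using assms(2-4) by (intro definable_inst[where n=1]) auto
  moreover have "definable L U B n ?D = definable L U B n (\<lambda>y. D (a # y))"
    using map_nth_tail[OF tuplesD(1), of _ n _ "[a]" 0] by (intro definable_cong) (simp only: nth_Cons_0)
  ultimately show ?thesis by simp
qed

lemma definable_ex1:
  assumes "definable L U A (Suc k) D" shows "definable L U A k (\<lambda>e. \<exists>a\<in>carr U. D (a # e))"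
proof -
  obtain \<phi> d where 1: "set d \<subseteq> A" "wf_fm L (Suc k + length d) \<phi>"
    "\<And>e. e\<in>tuples (Suc k) (carr U) \<Longrightarrow> D e \<longleftrightarrow> sat U \<phi> (e @ d)" using assms unfolding definable_def by auto
  show ?thesis
    unfolding definable_def
    by (intro exI[of _ "Exi \<phi>"] exI[of _ d]) (use 1 in auto)
qed

lemma definable_ex:
  assumes "definable L U A (n + k) D" shows "definable L U A k (\<lambda>e. \<exists>y\<in>tuples n (carr U). D (y @ e))"
  using assms
proof (induction n arbitrary: D)
  case (Suc n)
  have "definable L U A k (\<lambda>e. \<exists>y\<in>tuples n (carr U). \<exists>a\<in>carr U. D (a # y @ e))"
    using Suc.prems by (intro Suc.IH definable_ex1) simp
  moreover have "(\<exists>y\<in>tuples n (carr U). \<exists>a\<in>carr U. D (a # y @ e)) \<longleftrightarrow>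
      (\<exists>y\<in>tuples (Suc n) (carr U). D (y @ e))" for e
    by (metis append_Cons tuples_Cons tuples_SucE)
  ultimately show ?case by simp
qed simp

section \<open>Saturation and Morley sequences\<close>

lemma small_countable:
  assumes "uncountable_cardinal \<kappa>" "countable A" shows "small \<kappa> A"
proof -
  obtain f :: "_ \<Rightarrow> nat" where "inj_on f A" using assms(2) by (rule countableE)
  then have "(card_of A, card_of (UNIV :: nat set)) \<in> ordLeq"
    by (subst card_of_ordLeq[symmetric]) auto
  then have "(card_of A, natLeq) \<in> ordLeq" using card_of_nat ordLeq_ordIso_trans by blast
  then show ?thesis
    using assms(1) ordLeq_ordLess_trans unfolding small_def uncountable_cardinal_def by blast
qed

lemma small_Un: "uncountable_cardinal \<kappa> \<Longrightarrow> small \<kappa> A \<Longrightarrow> small \<kappa> B \<Longrightarrow> small \<kappa> (A \<union> B)"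
  unfolding small_def uncountable_cardinal_def
  by (meson Un_Cinfinite_bound_strict cinfinite_mono natLeq_cinfinite ordLess_imp_ordLeq)

text \<open>Saturation is only postulated for complete types in one variable.\<close>

locale sat_struct =
  fixes L :: "('f, 'r) lang" and U :: "('u, 'f, 'r) struct" and \<kappa> :: "'k rel"
  assumes uncountable: "uncountable_cardinal \<kappa>" and saturated: "saturated \<kappa> L U"
begin

text \<open>A finitely satisfiable set is first completed, by compactness, to a type \<open>P\<close> in
  all variables. Its restriction to the first variable is realized by some \<open>a\<close>. Since \<open>P\<close>
  contains ``some \<open>y\<close> satisfies \<open>D(x;y)\<close> for all \<open>D\<close> in \<open>F\<close>'', the conditions
  on the remaining variables are finitely satisfiable over \<open>a\<close>, and the induction continues.\<close>

lemma realize_tuple: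
  assumes "A \<subseteq> carr U" "small \<kappa> A" and "\<And>D. D \<in> \<D> \<Longrightarrow> definable L U A n D"
    and "\<And>F. finite F \<Longrightarrow> F \<subseteq> \<D> \<Longrightarrow> \<exists>b\<in>tuples n (carr U). \<forall>D\<in>F. D b"
  shows "\<exists>b\<in>tuples n (carr U). \<forall>D\<in>\<D>. D b"
  using assms
proof (induction n arbitrary: A \<D>)
  case 0
  then have "\<forall>D\<in>\<D>. D []"
    using "0.prems"(4)[of "{_}"] by auto
  then show ?case by simp
next
  case (Suc n)
  define v :: "'u list \<Rightarrow> ('u list \<Rightarrow> bool) \<Rightarrow> real" where "v x D = of_bool (D x)" for x D
  have v01: "v x D \<in> {0..1}" for x D by (simp add: v_def)
  obtain p where "\<And>I J0 e. finite I \<Longrightarrow> finite J0 \<Longrightarrow> J0 \<subseteq> \<D> \<Longrightarrow> e > 0 \<Longrightarrow>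
      \<exists>x\<in>tuples (Suc n) (carr U). (\<forall>D\<in>J0. D x) \<and> (\<forall>i\<in>I. \<bar>v x i - p i\<bar> < e)"
    using cluster_point_of_consistent_conditions[of v \<D> "tuples (Suc n) (carr U)" "\<lambda>D x. D x", OF v01 Suc.prems(4)]
    by metis
  from this[where e="1/2"] have
    p': "\<exists>x\<in>tuples (Suc n) (carr U). (\<forall>D\<in>J0. D x) \<and> (\<forall>i\<in>I. \<bar>v x i - p i\<bar> < 1/2)"
    if "finite I" "finite J0" "J0 \<subseteq> \<D>" for I J0 using that by simp
  define P where "P D \<longleftrightarrow> p D > 1/2" for D
  have dec: "D x \<longleftrightarrow> P D" if "\<bar>v x D - p D\<bar> < 1/2" for x D
  proof (cases "D x")
    case True
    then have "\<bar>1 - p D\<bar> < 1/2" using that by (simp add: v_def)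
    then show ?thesis using True unfolding P_def by linarith
  next
    case False
    then have "\<bar>0 - p D\<bar> < 1/2" using that by (simp add: v_def)
    then show ?thesis using False unfolding P_def by linarith
  qed
  have p: "\<exists>x\<in>tuples (Suc n) (carr U). (\<forall>D\<in>J0. D x) \<and> (\<forall>D\<in>I. D x \<longleftrightarrow> P D)"
    if "finite I" "finite J0" "J0 \<subseteq> \<D>" for I J0
  proof -
    note p'[OF that]
    then obtain x where "x\<in>tuples (Suc n) (carr U)" "\<forall>D\<in>J0. D x" "\<forall>i\<in>I. \<bar>v x i - p i\<bar> < 1/2"
      by auto
    then show ?thesis using dec by (intro bexI[of _ x]) auto
  qed
  have P\<D>: "P D" if "D \<in> \<D>" for D using p[of "{D}" "{D}"] that by auto
  define q where "q = {(\<phi>, c)\<in>params L 1 A. P (\<lambda>e. sat U \<phi> (hd e # c))}"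
  have "q \<in> types L U 1 A"
    unfolding types_def
  proof (intro CollectI conjI allI impI ballI)
    show "q \<subseteq> params L 1 A" by (auto simp: q_def)
    fix \<theta> assume "\<theta> \<in> params L 1 A"
    then obtain \<phi> c where \<theta>: "\<theta> = (\<phi>, c)" "(\<phi>, c) \<in> params L 1 A" by (cases \<theta>) auto
    show "case \<theta> of (\<phi>, c) \<Rightarrow> (\<phi>, c) \<in> q \<or> (Neg \<phi>, c) \<in> q"
      using p[of "{\<lambda>e. sat U \<phi> (hd e # c), \<lambda>e. sat U (Neg \<phi>) (hd e # c)}" "{}"] \<theta>
      by (auto simp: q_def params_def)
  next
    fix F assume F: "finite F \<and> F \<subseteq> q"
    let ?I = "(\<lambda>(\<phi>, c). (\<lambda>e. sat U \<phi> (hd e # c))) ` F"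
    obtain x where x: "x \<in> tuples (Suc n) (carr U)" "\<forall>D\<in>?I. D x \<longleftrightarrow> P D"
      using p[of ?I "{}"] F by auto
    then have "\<forall>(\<phi>, c)\<in>F. sat U \<phi> (hd x # c)"
      using F by (fastforce simp: q_def)
    moreover have "[hd x] \<in> tuples 1 (carr U)"
      using x(1) by (auto elim!: tuples_SucE)
    ultimately show "\<exists>b\<in>tuples 1 (carr U). \<forall>(\<phi>, c)\<in>F. sat U \<phi> (b @ c)"
      by (intro bexI[of _ "[hd x]"]) auto
  qed
  then obtain a where a: "a \<in> carr U" "tp L U [a] A = q"
    using saturated Suc.prems(1,2) unfolding saturated_def by blast
  have aP: "D [a] \<longleftrightarrow> P (\<lambda>e. D [hd e])" if "definable L U A 1 D" for D
  proof -
    obtain \<phi> c where \<phi>: "set c \<subseteq> A" "wf_fm L (1 + length c) \<phi>"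
      "\<And>e. e\<in>tuples 1 (carr U) \<Longrightarrow> D e \<longleftrightarrow> sat U \<phi> (e @ c)"
      using \<open>definable L U A 1 D\<close> unfolding definable_def by blast
    have "D [a] \<longleftrightarrow> (\<phi>, c) \<in> tp L U [a] A"
      using \<phi> a(1) by (simp add: tp_def params_def)
    also have "\<dots> \<longleftrightarrow> P (\<lambda>e. sat U \<phi> (hd e # c))"
      using \<phi> by (simp add: a(2) q_def params_def)
    also have "\<dots> \<longleftrightarrow> P (\<lambda>e. D [hd e])"
    proof -
      obtain x where x: "x\<in>tuples (Suc n) (carr U)"
        "(sat U \<phi> (hd x # c)) \<longleftrightarrow> P (\<lambda>e. sat U \<phi> (hd e # c))" "D [hd x] \<longleftrightarrow> P (\<lambda>e. D [hd e])"
        using p[of "{\<lambda>e. sat U \<phi> (hd e # c), \<lambda>e. D [hd e]}" "{}"] by auto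
      moreover have "D [hd x] \<longleftrightarrow> sat U \<phi> (hd x # c)"
        using x(1) \<phi>(3)[of "[hd x]"] by (auto elim!: tuples_SucE)
      ultimately show ?thesis by simp
    qed
    finally show ?thesis .
  qed
  define \<D>' where "\<D>' = (\<lambda>D y. D (a # y)) ` \<D>"
  have "\<exists>b\<in>tuples n (carr U). \<forall>D\<in>\<D>'. D b"
  proof (rule Suc.IH)
    show "A \<union> {a} \<subseteq> carr U" using Suc.prems a by auto
    show "small \<kappa> (A \<union> {a})"
      using Suc.prems uncountable small_countable[of \<kappa> "{a}"] by (intro small_Un) auto
    show "definable L U (A \<union> {a}) n D'" if "D' \<in> \<D>'" for D'
      using that Suc.prems(1,3) a by (auto simp: \<D>'_def intro!: definable_Cons[of L U A])
    fix F assume F: "finite F" "F \<subseteq> \<D>'"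
    then obtain F0 where F0: "F0 \<subseteq> \<D>" "finite F0" "F = (\<lambda>D y. D (a # y)) ` F0"
      unfolding \<D>'_def by (meson finite_subset_image)
    define E where "E x \<longleftrightarrow> (\<exists>y\<in>tuples n (carr U). \<forall>D\<in>F0. D (hd x # y))" for x
    have "definable L U A 1 (\<lambda>x. \<exists>y\<in>tuples n (carr U). (\<forall>D\<in>F0. D (map ((!) (y @ x)) ((n + 0) # [0..<n]))))"
      using F0 Suc.prems(3)
      by (intro definable_ex[where D="\<lambda>z. \<forall>D\<in>F0. D (map ((!) z) ((n + 0) # [0..<n]))"] definable_ball definable_ren) auto
    moreover have "map ((!) (y @ x)) ((n + 0) # [0..<n]) = hd x # y"
      if "y \<in> tuples n (carr U)" "x \<in> tuples 1 (carr U)" for x y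
      using map_nth_tail[OF tuplesD(1)[OF that(1)], of x 0] tuplesD(1)[OF that(2)]
      by (cases x) (simp_all only: nth_Cons_0 list.sel list.size)
    ultimately have "definable L U A 1 E"
      unfolding E_def by (subst definable_cong[symmetric]) auto
    from aP[OF this] have "E [a] \<longleftrightarrow> P (\<lambda>e. E [hd e])" .
    moreover obtain x where x: "x\<in>tuples (Suc n) (carr U)" "\<forall>D\<in>F0. D x"
        "E [hd x] \<longleftrightarrow> P (\<lambda>e. E [hd e])"
      using p[of "{\<lambda>e. E [hd e]}" F0] F0 by auto
    moreover obtain a' y where "x = a' # y" "y \<in> tuples n (carr U)"
      using x(1) by (rule tuples_SucE)
    then have "E [hd x]" using x(2) by (auto simp: E_def)
    with calculation have "E [a]" by simp
    then show "\<exists>b\<in>tuples n (carr U). \<forall>D\<in>F. D b"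
      by (auto simp: E_def F0)
  qed
  then obtain b where "b\<in>tuples n (carr U)" "\<forall>D\<in>\<D>. D (a # b)"
    by (auto simp: \<D>'_def)
  then show ?case using a(1) by (intro bexI[of _ "a # b"]) auto
qed

end

locale ktype = sat_struct L U \<kappa>
  for L :: "('f, 'r) lang" and U :: "('u, 'f, 'r) struct" and \<kappa> :: "'k rel" +
  fixes M :: "'u set" and \<mu> :: "'u set \<Rightarrow> real"
  assumes M: "M \<subseteq> carr U" and small_M: "small \<kappa> M" and type: "global_type L U \<mu>"
begin

text \<open>\<open>gen D b\<close> says that \<open>D(x;b)\<close> belongs to the type \<open>\<mu>\<close>.\<close>

definition gen :: "('u list \<Rightarrow> bool) \<Rightarrow> 'u list \<Rightarrow> bool" where
  "gen D b \<longleftrightarrow> \<mu> {a\<in>carr U. D (a # b)} = 1"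

lemma gen_sat: "gen (sat U \<phi>) b \<longleftrightarrow> \<mu> (defset U \<phi> b) = 1"
  by (simp add: gen_def defset_def)

lemma gen_cong: "(\<And>a. a \<in> carr U \<Longrightarrow> D (a # b) = E (a # b')) \<Longrightarrow> gen D b = gen E b'"
  unfolding gen_def by (metis (mono_tags, lifting) Collect_cong)

lemma defsets_definable:
  assumes "definable L U (carr U) (Suc n) D" "b \<in> tuples n (carr U)"
  shows "{a\<in>carr U. D (a # b)} \<in> defsets L U"
proof -
  obtain \<phi> c where \<phi>: "set c \<subseteq> carr U" "wf_fm L (Suc n + length c) \<phi>"
    "\<And>e. e\<in>tuples (Suc n) (carr U) \<Longrightarrow> D e \<longleftrightarrow> sat U \<phi> (e @ c)"
    using assms(1) unfolding definable_def by blast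
  have "{a\<in>carr U. D (a # b)} = defset U \<phi> (b @ c)"
    using \<phi>(3)[of "_ # b"] assms(2) by (auto simp: defset_def)
  moreover have "(\<phi>, b @ c) \<in> params L 1 (carr U)"
    using \<phi> assms(2) by (auto simp: params_def tuples_def)
  ultimately show ?thesis unfolding defsets_def by force
qed

lemma mu_01: "X \<in> defsets L U \<Longrightarrow> \<mu> X = 0 \<or> \<mu> X = 1"
  using type by (auto simp: global_type_def)

lemma mu_Un: "X \<in> defsets L U \<Longrightarrow> Y \<in> defsets L U \<Longrightarrow> X \<inter> Y = {} \<Longrightarrow> \<mu> (X \<union> Y) = \<mu> X + \<mu> Y"
  using type by (auto simp: global_type_def keisler_measure_def)

lemma gen_neg:
  assumes "definable L U (carr U) (Suc n) D" "b \<in> tuples n (carr U)"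
  shows "gen (\<lambda>e. \<not> D e) b \<longleftrightarrow> \<not> gen D b"
proof -
  let ?X = "{a\<in>carr U. D (a # b)}" and ?Y = "{a\<in>carr U. \<not> D (a # b)}"
  have "?X \<union> ?Y = carr U" "?X \<inter> ?Y = {}" by auto
  moreover have "\<mu> (carr U) = 1" using type by (auto simp: global_type_def keisler_measure_def)
  moreover have X: "?X \<in> defsets L U" and Y: "?Y \<in> defsets L U"
    using defsets_definable[OF assms] defsets_definable[OF definable_neg[OF assms(1)] assms(2)] .
  ultimately have "\<mu> ?X + \<mu> ?Y = 1" using mu_Un[of ?X ?Y] by simp
  then show ?thesis unfolding gen_def using mu_01[OF X] mu_01[OF Y] by auto
qed

lemma gen_mono:
  assumes "definable L U (carr U) (Suc n) D" "definable L U (carr U) (Suc n) E" "b \<in> tuples n (carr U)"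
    and "\<And>a. a \<in> carr U \<Longrightarrow> D (a # b) \<Longrightarrow> E (a # b)" "gen D b"
  shows "gen E b"
proof -
  let ?X = "{a\<in>carr U. D (a # b)}" and ?Y = "{a\<in>carr U. E (a # b) \<and> \<not> D (a # b)}"
  have X: "?X \<in> defsets L U" using defsets_definable[OF assms(1,3)] .
  have Y: "?Y \<in> defsets L U" using defsets_definable[OF definable_conj[OF assms(2) definable_neg[OF assms(1)]] assms(3)] .
  have E: "{a\<in>carr U. E (a # b)} \<in> defsets L U" using defsets_definable[OF assms(2,3)] .
  have "{a\<in>carr U. E (a # b)} = ?X \<union> ?Y" using assms(4) by auto
  then have "\<mu> {a\<in>carr U. E (a # b)} = \<mu> ?X + \<mu> ?Y" using mu_Un[OF X Y] by auto
  then show ?thesis using assms(5) mu_01[OF Y] mu_01[OF E] unfolding gen_def by auto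
qed

lemma gen_conj:
  assumes D: "definable L U (carr U) (Suc n) D" and E: "definable L U (carr U) (Suc n) E" and b: "b \<in> tuples n (carr U)"
    and "gen D b" "gen E b"
  shows "gen (\<lambda>e. D e \<and> E e) b"
proof -
  let ?DE = "\<lambda>e. D e \<and> E e" and ?DnE = "\<lambda>e. D e \<and> \<not> E e"
  have dfDE: "definable L U (carr U) (Suc n) ?DE" and dfDnE: "definable L U (carr U) (Suc n) ?DnE"
    using definable_conj[OF D E] definable_conj[OF D definable_neg[OF E]] .
  have W: "{a\<in>carr U. ?DE (a # b)} \<in> defsets L U" and V: "{a\<in>carr U. ?DnE (a # b)} \<in> defsets L U"
    using defsets_definable[OF dfDE b] defsets_definable[OF dfDnE b] .
  have "\<not> gen (\<lambda>e. \<not> E e) b" using gen_neg[OF E b] assms(5) by simp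
  then have "\<not> gen ?DnE b"
    using gen_mono[of n ?DnE "\<lambda>e. \<not> E e" b, OF dfDnE definable_neg[OF E] b] by blast
  then have "\<mu> {a\<in>carr U. ?DnE (a # b)} = 0"
    using mu_01[OF V] by (simp add: gen_def)
  moreover have "{a\<in>carr U. D (a # b)} = {a\<in>carr U. ?DE (a # b)} \<union> {a\<in>carr U. ?DnE (a # b)}" by auto
  moreover have "{a\<in>carr U. ?DE (a # b)} \<inter> {a\<in>carr U. ?DnE (a # b)} = {}" by auto
  ultimately show ?thesis using mu_Un[OF W V] assms(4) by (simp add: gen_def)
qed

lemma gen_ex:
  assumes D: "definable L U (carr U) (Suc n) D" and b: "b \<in> tuples n (carr U)" and "gen D b"
  shows "\<exists>a\<in>carr U. D (a # b)"
proof (rule ccontr)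
  assume "\<not> ?thesis"
  then have "gen (\<lambda>e. \<not> D e) b"
    using gen_mono[of n D "\<lambda>e. \<not> D e" b, OF D definable_neg[OF D] b] \<open>gen D b\<close> by blast
  then show False using gen_neg[OF D b] \<open>gen D b\<close> by simp
qed

lemma realizes_on_definable:
  assumes "a \<in> carr U" "realizes_on L U a \<mu> A" "definable L U A (Suc n) D" "b \<in> tuples n A" "A \<subseteq> carr U"
  shows "D (a # b) \<longleftrightarrow> gen D b"
proof -
  obtain \<phi> c where \<phi>: "set c \<subseteq> A" "wf_fm L (Suc n + length c) \<phi>"
    "\<And>e. e\<in>tuples (Suc n) (carr U) \<Longrightarrow> D e \<longleftrightarrow> sat U \<phi> (e @ c)"
    using assms(3) unfolding definable_def by blast
  have b: "b \<in> tuples n (carr U)" using assms(4,5) by (auto simp: tuples_def)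
  have "gen D b \<longleftrightarrow> \<mu> (defset U \<phi> (b @ c)) = 1"
    unfolding gen_sat[symmetric] using \<phi>(3)[of "_ # b"] b by (intro gen_cong) simp
  moreover have "(\<phi>, b @ c) \<in> params L 1 A"
    using \<phi> assms(4) by (auto simp: params_def tuples_def)
  ultimately show ?thesis
    using assms(1,2) \<phi>(3)[of "a # b"] b by (auto simp: realizes_on_def)
qed

lemma realizes_on_mono: "realizes_on L U a \<mu> B \<Longrightarrow> A \<subseteq> B \<Longrightarrow> realizes_on L U a \<mu> A"
  by (auto simp: realizes_on_def params_def)

lemma ex_realization:
  assumes "A \<subseteq> carr U" "small \<kappa> A"
  shows "\<exists>a\<in>carr U. realizes_on L U a \<mu> A"
proof -
  define \<D> where "\<D> = {D. definable L U A 1 D \<and> gen D []}"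
  have dfU: "definable L U (carr U) (Suc 0) D" if "D \<in> \<D>" for D
    using that assms(1) definable_mono unfolding \<D>_def One_nat_def by blast
  have "\<exists>b\<in>tuples 1 (carr U). \<forall>D\<in>\<D>. D b"
  proof (rule realize_tuple[OF assms])
    show "definable L U A 1 D" if "D \<in> \<D>" for D using that by (simp add: \<D>_def)
    fix F assume F: "finite F" "F \<subseteq> \<D>"
    have dfF: "definable L U (carr U) (Suc 0) (\<lambda>e. \<forall>D\<in>G. D e)" if "finite G" "G \<subseteq> \<D>" for G
      using that dfU by (intro definable_ball) auto
    from F have "gen (\<lambda>e. \<forall>D\<in>F. D e) []"
    proof (induction F)
      case empty
      have "gen (\<lambda>_. True) []"
        using type by (simp add: gen_def global_type_def keisler_measure_def)
      then show ?case by simp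
    next
      case (insert D F)
      then have "gen (\<lambda>e. D e \<and> (\<forall>D\<in>F. D e)) []"
        using dfU dfF by (intro gen_conj[where n=0]) (auto simp: \<D>_def)
      then show ?case by simp
    qed
    then obtain a where "a \<in> carr U" "\<forall>D\<in>F. D [a]"
      using gen_ex[OF dfF[OF F]] by auto
    then show "\<exists>b\<in>tuples 1 (carr U). \<forall>D\<in>F. D b"
      by (intro bexI[of _ "[a]"]) (simp_all add: tuples_def)
  qed
  then obtain e where "e \<in> tuples (Suc 0) (carr U)" "\<forall>D\<in>\<D>. D e" by auto
  then obtain a where a: "a \<in> carr U" "\<And>D. D \<in> \<D> \<Longrightarrow> D [a]"
    by (metis tuples_SucE tuples_0 singletonD)
  have "realizes_on L U a \<mu> A"
    unfolding realizes_on_def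
  proof (intro ballI, clarify)
    fix \<phi> c assume "(\<phi>, c) \<in> params L 1 A"
    then have D: "definable L U A 1 (\<lambda>e. sat U \<phi> (e @ c))"
      by (intro definable_sat_params) (auto simp: params_def)
    then have DU: "definable L U (carr U) (Suc 0) (\<lambda>e. sat U \<phi> (e @ c))"
      using assms(1) definable_mono unfolding One_nat_def by blast
    have 1: "gen (\<lambda>e. sat U \<phi> (e @ c)) [] \<longleftrightarrow> \<mu> (defset U \<phi> c) = 1"
      by (simp add: gen_def defset_def)
    show "sat U \<phi> (a # c) \<longleftrightarrow> \<mu> (defset U \<phi> c) = 1"
    proof (cases "gen (\<lambda>e. sat U \<phi> (e @ c)) []")
      case True
      then show ?thesis using a(2)[of "\<lambda>e. sat U \<phi> (e @ c)"] D 1 by (auto simp: \<D>_def)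
    next
      case False
      then have "gen (\<lambda>e. \<not> sat U \<phi> (e @ c)) []" using gen_neg[OF DU] by simp
      then show ?thesis
        using a(2)[of "\<lambda>e. \<not> sat U \<phi> (e @ c)"] definable_neg[OF D] 1 False by (auto simp: \<D>_def)
    qed
  qed
  then show ?thesis using a(1) by blast
qed

text \<open>Finite Morley sequences over \<open>M\<close>. As a list they are written \<open>rev (map a [0..<m])\<close>, with
  the last element first, because that element is the variable \<open>x\<close> when one more step is made.\<close>

definition morley :: "nat \<Rightarrow> (nat \<Rightarrow> 'u) \<Rightarrow> bool" where
  "morley m a \<longleftrightarrow> (\<forall>i<m. a i \<in> carr U \<and> realizes_on L U (a i) \<mu> (M \<union> a ` {..<i}))"

text \<open>The new members realize \<open>\<mu>\<close> over the extra parameters \<open>B\<close> as well, so they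
  satisfy every formula over \<open>B\<close> that belongs to \<open>\<mu>\<close>.\<close>

lemma extend_morley:
  fixes a :: "nat \<Rightarrow> 'u"
  assumes "finite B" "B \<subseteq> carr U" "\<And>i. i < k \<Longrightarrow> a i \<in> carr U"
  shows "\<exists>a'. (\<forall>i<k. a' i = a i) \<and> (\<forall>i\<ge>k. realizes_on L U (a' i) \<mu> (M \<union> B \<union> a' ` {..<i})) \<and>
    (\<forall>i. a' i \<in> carr U)"
proof -
  define P where "P f x r \<longleftrightarrow> (if x < k then r = a x else
    f ` {..<x} \<subseteq> carr U \<longrightarrow> r \<in> carr U \<and> realizes_on L U r \<mu> (M \<union> B \<union> f ` {..<x}))" for f x r
  have "\<exists>f. \<forall>x. P f x (f x)"
  proof (rule dependent_wellorder_choice)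
    fix f g :: "nat \<Rightarrow> 'u" and x r
    assume "\<And>z. z < x \<Longrightarrow> f z = g z"
    then have "f ` {..<x} = g ` {..<x}" by (intro image_cong) auto
    then show "P f x r = P g x r" by (simp add: P_def)
  next
    fix x f
    show "\<exists>r. P f x r"
    proof (cases "x < k \<or> \<not> f ` {..<x} \<subseteq> carr U")
      case False
      have "small \<kappa> (M \<union> B \<union> f ` {..<x})"
        using uncountable small_M assms(1)
        by (intro small_Un small_countable[of \<kappa> B] small_countable[of \<kappa> "f ` {..<x}"]) (auto intro: countable_finite)
      then show ?thesis
        using ex_realization[of "M \<union> B \<union> f ` {..<x}"] False M assms(2) by (auto simp: P_def)
    qed (auto simp: P_def)
  qed
  then obtain f where f: "\<And>x. P f x (f x)" by blast
  have carr: "f i \<in> carr U" for i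
  proof (induction i rule: less_induct)
    case (less i)
    then have "f ` {..<i} \<subseteq> carr U" by auto
    then show ?case using f[of i] assms(3) by (auto simp: P_def split: if_splits)
  qed
  show ?thesis
  proof (intro exI[of _ f] conjI allI impI)
    show "f i = a i" if "i < k" for i using f[of i] that by (simp add: P_def)
    show "realizes_on L U (f i) \<mu> (M \<union> B \<union> f ` {..<i})" if "k \<le> i" for i
      using f[of i] that carr by (auto simp: P_def)
  qed (rule carr)
qed

lemma ex_morley: "\<exists>a. \<forall>m. morley m a"
proof -
  obtain a' :: "nat \<Rightarrow> 'u" where "\<forall>i. realizes_on L U (a' i) \<mu> (M \<union> a' ` {..<i})" "\<forall>i. a' i \<in> carr U"
    using extend_morley[of "{}" 0 "\<lambda>_. undefined"] by auto
  then show ?thesis by (intro exI[of _ a']) (simp add: morley_def)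
qed

lemma morley_carr: "morley m a \<Longrightarrow> rev (map a [0..<m]) \<in> tuples m (carr U)"
  by (auto simp: morley_def tuples_def)

lemma morley_mono: "morley m a \<Longrightarrow> k \<le> m \<Longrightarrow> morley k a"
  by (auto simp: morley_def)

text \<open>The parameters of \<open>D\<close> lie in \<open>M\<close>, so appending them to two tuples of the same type
  over \<open>M\<close> leaves the types over \<open>M\<close> equal.\<close>

lemma gen_invariant:
  assumes inv: "invariant L U M \<mu>" and D: "definable L U M (Suc n) D"
    and b: "b \<in> tuples n (carr U)" "b' \<in> tuples n (carr U)"
    and eq: "\<And>E. definable L U M n E \<Longrightarrow> E b \<longleftrightarrow> E b'"
  shows "gen D b \<longleftrightarrow> gen D b'"
proof -
  obtain \<phi> c where \<phi>: "set c \<subseteq> M" "wf_fm L (Suc n + length c) \<phi>"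
    "\<And>e. e\<in>tuples (Suc n) (carr U) \<Longrightarrow> D e \<longleftrightarrow> sat U \<phi> (e @ c)"
    using D unfolding definable_def by blast
  have g: "gen D d \<longleftrightarrow> \<mu> (defset U \<phi> (d @ c)) = 1" if "d \<in> tuples n (carr U)" for d
    unfolding gen_sat[symmetric] using \<phi>(3)[of "_ # d"] that by (intro gen_cong) simp
  have "tp L U (b @ c) M = tp L U (b' @ c) M"
  proof -
    have "sat U \<psi> ((b @ c) @ d) \<longleftrightarrow> sat U \<psi> ((b' @ c) @ d)"
      if "(\<psi>, d) \<in> params L (length (b @ c)) M" for \<psi> d
      using that b(1) \<phi>(1) eq[of "\<lambda>e. sat U \<psi> (e @ (c @ d))"] definable_sat_params[of "c @ d" M L n \<psi> U]
      by (simp add: params_def tuples_def add.assoc)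
    moreover have "length (b @ c) = length (b' @ c)" using b by (simp add: tuples_def)
    ultimately show ?thesis unfolding tp_def by auto
  qed
  moreover have "b @ c \<in> tuples (n + length c) (carr U)" "b' @ c \<in> tuples (n + length c) (carr U)"
    using b \<phi>(1) M by (auto simp: tuples_def)
  ultimately have "\<mu> (defset U \<phi> (b @ c)) = \<mu> (defset U \<phi> (b' @ c))"
    using inv \<phi>(2) unfolding invariant_def by (metis add_Suc)
  then show ?thesis using g b by simp
qed

text \<open>Truth of \<open>D\<close> at a Morley sequence of length \<open>Suc m\<close> amounts to
  \<open>gen D\<close> at its first \<open>m\<close> members; by induction these have the same type over \<open>M\<close> in both
  sequences, and invariance applies.\<close>

lemma morley_unique:
  assumes inv: "invariant L U M \<mu>"
  shows "definable L U M m D \<Longrightarrow> morley m a \<Longrightarrow> morley m a' \<Longrightarrow>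
    D (rev (map a [0..<m])) \<longleftrightarrow> D (rev (map a' [0..<m]))"
proof (induction m arbitrary: D)
  case (Suc m)
  have step: "D (rev (map f [0..<Suc m])) \<longleftrightarrow> gen D (rev (map f [0..<m]))" if "morley (Suc m) f" for f
  proof -
    have f: "f m \<in> carr U" "realizes_on L U (f m) \<mu> (M \<union> f ` {..<m})" "M \<union> f ` {..<m} \<subseteq> carr U"
      using that M by (auto simp: morley_def)
    show ?thesis
      using realizes_on_definable[OF f(1,2) definable_mono[OF Suc.prems(1)] _ f(3), of "rev (map f [0..<m])"]
      by (auto simp: tuples_def atLeast0LessThan)
  qed
  have "gen D (rev (map a [0..<m])) \<longleftrightarrow> gen D (rev (map a' [0..<m]))"
    using Suc.prems morley_mono[of "Suc m" _ m]
    by (intro gen_invariant[OF inv Suc.prems(1)] Suc.IH) (auto intro!: morley_carr)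
  then show ?case using step Suc.prems by simp
qed simp

lemma morley_subsequence:
  assumes "\<And>m. morley m a" "strict_mono_on {..<m} h"
  shows "morley m (a \<circ> h)"
  unfolding morley_def
proof (intro allI impI conjI)
  fix i assume i: "i < m"
  have "morley (Suc (h i)) a" by fact
  then have *: "a (h i) \<in> carr U" "realizes_on L U (a (h i)) \<mu> (M \<union> a ` {..<h i})"
    by (auto simp: morley_def)
  then show "(a \<circ> h) i \<in> carr U" by simp
  have "(a \<circ> h) ` {..<i} \<subseteq> a ` {..<h i}"
    using assms(2) i by (auto simp: strict_mono_on_def)
  then show "realizes_on L U ((a \<circ> h) i) \<mu> (M \<union> (a \<circ> h) ` {..<i})"
    unfolding o_def by (intro realizes_on_mono[OF *(2)]) auto
qed

end

section \<open>Generically stable types are definable\<close>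

lemma nth_rev_map_upt: "i < m \<Longrightarrow> rev (map a [0..<m]) ! (m - Suc i) = a i"
  by (simp add: rev_nth)

context ktype
begin

text \<open>Otherwise, for each \<open>j\<close>, some \<open>b\<close> with \<open>\<phi>(x;b)\<close> in \<open>\<mu>\<close> makes
  \<open>\<phi>\<close> fail on \<open>j + 1\<close> members of a Morley sequence. Continue the sequence over \<open>b\<close>: then
  \<open>\<phi>(a\<^sub>i;b)\<close> holds exactly for \<open>i > j\<close>. By uniqueness of Morley sequences this
  pattern is consistent with any fixed one, and realizing it for every \<open>j\<close> violates generic
  stability.\<close>

lemma generic_value_attained:
  assumes gs: "generically_stable L U M \<mu>" and \<phi>: "wf_fm L (Suc n) \<phi>"
  obtains N where "\<And>a b. morley N a \<Longrightarrow> b \<in> tuples n (carr U) \<Longrightarrow> gen (sat U \<phi>) b \<Longrightarrow>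
    \<exists>i<N. sat U \<phi> (a i # b)"
proof (rule ccontr)
  assume "\<not> thesis"
  then have bad: "\<exists>a b. morley N a \<and> b \<in> tuples n (carr U) \<and> gen (sat U \<phi>) b \<and>
      (\<forall>i<N. \<not> sat U \<phi> (a i # b))" for N
    using that by blast
  have inv: "invariant L U M \<mu>" using gs by (simp add: generically_stable_def)
  obtain \<alpha> where \<alpha>: "\<And>m. morley m \<alpha>" using ex_morley by auto
  then have \<alpha>c: "\<alpha> i \<in> carr U" for i by (auto simp: morley_def)
  have "\<exists>b\<in>tuples n (carr U). \<forall>i. sat U \<phi> (\<alpha> i # b) \<longleftrightarrow> j < i" for j
  proof -
    define X where "X i y \<longleftrightarrow> (sat U \<phi> (\<alpha> i # y) \<longleftrightarrow> j < i)" for i y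
    have "\<exists>b\<in>tuples n (carr U). \<forall>D\<in>range X. D b"
    proof (rule realize_tuple)
      show "range \<alpha> \<subseteq> carr U" using \<alpha>c by auto
      show "small \<kappa> (range \<alpha>)" using uncountable by (intro small_countable) auto
      show "definable L U (range \<alpha>) n D" if D: "D \<in> range X" for D
      proof -
        obtain i where i: "D = X i" using D by auto
        have "definable L U (range \<alpha>) n (\<lambda>y. sat U \<phi> (\<alpha> i # y))"
          using \<alpha>c by (intro definable_Cons[OF definable_sat[OF \<phi>], where A="{}"]) auto
        then show ?thesis
          unfolding i X_def by (intro definable_iff definable_const)
      qed
      fix F assume "finite F" "F \<subseteq> range X"
      then obtain I where I: "finite I" "F = X ` I" by (meson finite_subset_image)
      \<comment> \<open>finitely many conditions concern finitely many members, including the first \<open>j + 1\<close>\<close>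
      obtain m where m: "Suc j \<le> m" "I \<subseteq> {..<m}"
        using I(1) finite_nat_iff_bounded[of "insert j I"] by (metis finite_insert insert_subset lessThan_iff Suc_leI)
      from bad[of "Suc j"] obtain a b where ab: "morley (Suc j) a" "b \<in> tuples n (carr U)" "gen (sat U \<phi>) b"
        "\<And>i. i < Suc j \<Longrightarrow> \<not> sat U \<phi> (a i # b)" by (elim exE conjE) simp
      have setb: "finite (set b)" "set b \<subseteq> carr U" using ab(2) by (auto simp: tuples_def)
      have ac: "\<And>i. i < Suc j \<Longrightarrow> a i \<in> carr U" using ab(1) by (simp add: morley_def)
      obtain a' where a': "\<And>i. i < Suc j \<Longrightarrow> a' i = a i"
        "\<And>i. Suc j \<le> i \<Longrightarrow> realizes_on L U (a' i) \<mu> (M \<union> set b \<union> a' ` {..<i})" "\<And>i. a' i \<in> carr U"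
        using extend_morley[of "set b" "Suc j" a, OF setb ac] by auto
      have morley': "morley m a'"
        unfolding morley_def
      proof (intro allI impI conjI)
        fix i show "a' i \<in> carr U" by fact
        show "realizes_on L U (a' i) \<mu> (M \<union> a' ` {..<i})"
        proof (cases "i < Suc j")
          case True
          then have "a' ` {..<i} = a ` {..<i}" using a'(1) by (intro image_cong) auto
          then show ?thesis using True ab(1) a'(1) by (simp add: morley_def)
        next
          case False
          then show ?thesis by (intro realizes_on_mono[OF a'(2)]) auto
        qed
      qed
      have "sat U \<phi> (a' i # b) \<longleftrightarrow> j < i" for i
      proof (cases "i < Suc j")
        case True then show ?thesis using ab(4) a'(1) by simp
      next
        case False
        have "sat U \<phi> (a' i # b) \<longleftrightarrow> gen (sat U \<phi>) b"
          using False a' setb M ab(2)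
          by (intro realizes_on_definable[OF _ _ definable_sat[OF \<phi>], of _ "M \<union> set b \<union> a' ` {..<i}"])
            (auto simp: tuples_def)
        then show ?thesis using False ab(3) by simp
      qed
      define E where "E e \<longleftrightarrow> (\<exists>y\<in>tuples n (carr U). \<forall>i\<in>{..<m}. sat U \<phi> (e ! (m - Suc i) # y) \<longleftrightarrow> j < i)" for e
      have "definable L U {} m (\<lambda>e. \<exists>y\<in>tuples n (carr U). \<forall>i\<in>{..<m}.
          sat U \<phi> (map ((!) (y @ e)) ((n + (m - Suc i)) # [0..<n])) \<longleftrightarrow> j < i)"
        using definable_sat[OF \<phi>]
        by (intro definable_ex[where D="\<lambda>z. \<forall>i\<in>{..<m}. sat U \<phi> (map ((!) z) ((n + (m - Suc i)) # [0..<n])) \<longleftrightarrow> j < i"]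
            definable_ball definable_iff definable_const definable_ren) auto
      moreover have "map ((!) (y @ e)) ((n + k) # [0..<n]) = e ! k # y" if "y \<in> tuples n (carr U)" for y e k
        using map_nth_tail tuplesD(1)[OF that] .
      then have "(\<lambda>e. \<exists>y\<in>tuples n (carr U). \<forall>i\<in>{..<m}.
          sat U \<phi> (map ((!) (y @ e)) ((n + (m - Suc i)) # [0..<n])) \<longleftrightarrow> j < i) = E"
        unfolding E_def by (intro ext bex_cong refl ball_cong) (simp only:)
      ultimately have dE: "definable L U {} m E" by simp
      have "E (rev (map a' [0..<m]))"
        unfolding E_def using \<open>\<And>i. sat U \<phi> (a' i # b) \<longleftrightarrow> j < i\<close> ab(2)
        by (intro bexI[of _ b]) (auto simp: nth_rev_map_upt)
      then have "E (rev (map \<alpha> [0..<m]))"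
        using morley_unique[OF inv definable_mono[OF dE] morley' \<alpha>] by blast
      then obtain y where "y\<in>tuples n (carr U)" "\<And>i. i < m \<Longrightarrow> sat U \<phi> (\<alpha> i # y) \<longleftrightarrow> j < i"
        unfolding E_def by (auto simp: nth_rev_map_upt)
      then show "\<exists>b\<in>tuples n (carr U). \<forall>D\<in>F. D b"
        using I m by (intro bexI[of _ y]) (auto simp: X_def)
    qed
    then show ?thesis by (auto simp: X_def)
  qed
  then obtain b where b: "\<And>j. b j \<in> tuples n (carr U)" "\<And>j i. sat U \<phi> (\<alpha> i # b j) \<longleftrightarrow> j < i"
    by metis
  have "\<forall>i. \<alpha> i \<in> carr U \<and> realizes_on L U (\<alpha> i) \<mu> (M \<union> \<alpha> ` {..<i})"
    using \<alpha> by (meson lessI morley_def)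
  then show False
    using gs \<phi> b unfolding generically_stable_def by (metis leD)
qed

lemma generic_truth_value_attained:
  assumes gs: "generically_stable L U M \<mu>" and \<phi>: "wf_fm L (Suc n) \<phi>"
  obtains N where "\<And>a b. morley N a \<Longrightarrow> b \<in> tuples n (carr U) \<Longrightarrow>
    \<exists>i<N. sat U \<phi> (a i # b) \<longleftrightarrow> gen (sat U \<phi>) b"
proof -
  obtain N1 where N1: "\<And>a b. morley N1 a \<Longrightarrow> b \<in> tuples n (carr U) \<Longrightarrow> gen (sat U \<phi>) b \<Longrightarrow>
    \<exists>i<N1. sat U \<phi> (a i # b)" using generic_value_attained[OF gs \<phi>] by metis
  have "wf_fm L (Suc n) (Neg \<phi>)" using \<phi> by simp
  then obtain N2 where N2: "\<And>a b. morley N2 a \<Longrightarrow> b \<in> tuples n (carr U) \<Longrightarrow> gen (sat U (Neg \<phi>)) b \<Longrightarrow>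
    \<exists>i<N2. sat U (Neg \<phi>) (a i # b)" using generic_value_attained[OF gs] by metis
  show ?thesis
  proof (rule that[of "max N1 N2"])
    fix a b assume a: "morley (max N1 N2) a" and b: "b \<in> tuples n (carr U)"
    have neg: "gen (sat U (Neg \<phi>)) b \<longleftrightarrow> \<not> gen (sat U \<phi>) b"
      using gen_neg[OF definable_sat[OF \<phi>] b] by (simp add: gen_def)
    show "\<exists>i<max N1 N2. sat U \<phi> (a i # b) \<longleftrightarrow> gen (sat U \<phi>) b"
    proof (cases "gen (sat U \<phi>) b")
      case True
      then show ?thesis using N1[OF morley_mono[OF a] b] by (metis less_max_iff_disj max.cobounded1)
    next
      case False
      then show ?thesis using N2[OF morley_mono[OF a] b] neg
        by (metis less_max_iff_disj max.cobounded2 sat.simps(3))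
    qed
  qed
qed

text \<open>Among \<open>2N\<close> members of a Morley sequence fewer than \<open>N\<close> disagree with \<open>\<mu>\<close>, so
  membership in \<open>\<mu>\<close> is the majority vote \<open>maj\<close>, definable over these members. A relation definable
  over some small set that depends only on the type over \<open>M\<close> is definable over \<open>M\<close>: otherwise
  every finite set of relations over \<open>M\<close> fails to separate some pair of tuples with different votes,
  and by saturation there are two such tuples with the same type over \<open>M\<close>.\<close>

lemma gen_definable:
  assumes gs: "generically_stable L U M \<mu>" and \<phi>: "wf_fm L (Suc n) \<phi>"
  shows "definable L U M n (gen (sat U \<phi>))"
proof (rule ccontr)
  assume nd: "\<not> definable L U M n (gen (sat U \<phi>))"
  let ?G = "gen (sat U \<phi>)"
  have inv: "invariant L U M \<mu>" using gs by (simp add: generically_stable_def)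
  obtain N where N: "\<And>a b. morley N a \<Longrightarrow> b \<in> tuples n (carr U) \<Longrightarrow>
    \<exists>i<N. sat U \<phi> (a i # b) \<longleftrightarrow> ?G b" using generic_truth_value_attained[OF gs \<phi>] by metis
  obtain \<alpha> where \<alpha>: "\<And>m. morley m \<alpha>" using ex_morley by auto
  then have \<alpha>c: "\<alpha> i \<in> carr U" for i by (auto simp: morley_def)
  have N': "\<exists>i\<in>I. sat U \<phi> (\<alpha> i # b) \<longleftrightarrow> ?G b" if I: "finite I" "card I = N" and b: "b \<in> tuples n (carr U)" for I b
  proof -
    obtain h where h: "bij_betw h {..<N} I" "strict_mono_on {..<N} h"
      using ex_bij_betw_strict_mono_card[OF I(1)] I(2) by auto
    show ?thesis
    proof -
      obtain i where "i < N" "sat U \<phi> ((\<alpha> \<circ> h) i # b) \<longleftrightarrow> ?G b"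
        using N[OF morley_subsequence[OF \<alpha> h(2)] b] by blast
      moreover have "h i \<in> I" using h(1) \<open>i < N\<close> by (auto simp: bij_betw_def)
      ultimately show ?thesis by (intro bexI[of _ "h i"]) simp_all
    qed
  qed
  define maj where "maj b \<longleftrightarrow> (\<exists>I\<in>{I. I \<subseteq> {..<2*N} \<and> card I = N}. \<forall>i\<in>I. sat U \<phi> (\<alpha> i # b))" for b
  have Gmaj: "?G b \<longleftrightarrow> maj b" if b: "b \<in> tuples n (carr U)" for b
  proof
    assume G: "?G b"
    let ?S = "{i. i < 2*N \<and> sat U \<phi> (\<alpha> i # b)}" and ?R = "{i. i < 2*N \<and> \<not> sat U \<phi> (\<alpha> i # b)}"
    have "card ?R \<le> N"
    proof (rule ccontr)
      assume "\<not> card ?R \<le> N"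
      then obtain I where "I \<subseteq> ?R" "card I = N" "finite I"
        using obtain_subset_with_card_n[of N ?R] by auto
      then show False using N'[of I b] b G by auto
    qed
    moreover have "card ?S + card ?R = card (?S \<union> ?R)"
      by (subst card_Un_disjoint) auto
    moreover have "?S \<union> ?R = {..<2*N}" by auto
    ultimately have "N \<le> card ?S" by simp
    then obtain I where "I \<subseteq> ?S" "card I = N"
      using obtain_subset_with_card_n[of N ?S] by auto
    then show "maj b" unfolding maj_def by (intro bexI[of _ I]) auto
  next
    assume "maj b"
    then obtain I where I: "I \<subseteq> {..<2*N}" "card I = N" "\<forall>i\<in>I. sat U \<phi> (\<alpha> i # b)"
      unfolding maj_def by auto
    then have "finite I" using finite_subset by blast
    then show "?G b" using N'[of I b] I b by auto
  qed
  have dfmaj: "definable L U (range \<alpha>) n maj"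
  proof -
    have "definable L U (range \<alpha>) n (\<lambda>y. sat U \<phi> (\<alpha> i # y))" for i
      using \<alpha>c by (intro definable_Cons[OF definable_sat[OF \<phi>], where A="{}"]) auto
    then show ?thesis
      unfolding maj_def by (intro definable_bex definable_ball) (auto intro: finite_subset)
  qed
  define A where "A = M \<union> range \<alpha>"
  \<comment> \<open>a realization of these conditions on pairs is a pair of tuples with the same type over \<open>M\<close> that the vote separates\<close>
  define Sep where "Sep z \<longleftrightarrow> maj (take n z) \<and> \<not> maj (drop n z)" for z
  define Eqv where "Eqv \<rho> z \<longleftrightarrow> (\<rho> (take n z) \<longleftrightarrow> \<rho> (drop n z))" for \<rho> :: "'u list \<Rightarrow> bool" and z
  have take: "definable L U A (n + n) (\<lambda>z. \<rho> (take n z))" and drop: "definable L U A (n + n) (\<lambda>z. \<rho> (drop n z))" if "definable L U A n \<rho>" for \<rho>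
  proof -
    have 1: "definable L U A (n + n) (\<lambda>z. \<rho> (map ((!) z) [0..<n]))" "definable L U A (n + n) (\<lambda>z. \<rho> (map ((!) z) [n..<n+n]))"
      using that by (auto intro!: definable_ren)
    have 2: "map ((!) z) [0..<n] = take n z" "map ((!) z) [n..<n+n] = drop n z" if "z \<in> tuples (n + n) (carr U)" for z
      using tuplesD(1)[OF that] by (auto intro!: nth_equalityI)
    show "definable L U A (n + n) (\<lambda>z. \<rho> (take n z))" "definable L U A (n + n) (\<lambda>z. \<rho> (drop n z))"
      using 1 2 by (subst definable_cong; simp)+
  qed
  have dfmajA: "definable L U A n maj" using dfmaj by (rule definable_mono) (simp add: A_def)
  define \<D> where "\<D> = insert Sep (Eqv ` {\<rho>. definable L U M n \<rho>})"
  have "\<exists>z\<in>tuples (n + n) (carr U). \<forall>D\<in>\<D>. D z"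
  proof (rule realize_tuple)
    show "A \<subseteq> carr U" using M \<alpha>c by (auto simp: A_def)
    show "small \<kappa> A" unfolding A_def
      using small_M uncountable by (intro small_Un small_countable[of \<kappa> "range \<alpha>"]) auto
    show "definable L U A (n + n) D" if "D \<in> \<D>" for D
    proof -
      have "definable L U A (n + n) Sep"
        unfolding Sep_def using take drop dfmajA by (intro definable_conj definable_neg) auto
      moreover have "definable L U A (n + n) (Eqv \<rho>)" if "definable L U M n \<rho>" for \<rho>
        unfolding Eqv_def using take drop definable_mono[OF that, of A] by (intro definable_iff) (auto simp: A_def)
      ultimately show ?thesis using that by (auto simp: \<D>_def)
    qed
    fix F assume F: "finite F" "F \<subseteq> \<D>"
    then have "finite (F - {Sep})" "F - {Sep} \<subseteq> Eqv ` {\<rho>. definable L U M n \<rho>}" by (auto simp: \<D>_def)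
    then obtain R where R: "finite R" "R \<subseteq> {\<rho>. definable L U M n \<rho>}" "F - {Sep} = Eqv ` R"
      by (metis finite_subset_image)
    define pat where "pat b = {\<rho>\<in>R. \<rho> b}" for b
    show "\<exists>z\<in>tuples (n + n) (carr U). \<forall>D\<in>F. D z"
    proof (rule ccontr)
      assume no: "\<not> ?thesis"
      have same: "?G b'" if b: "b \<in> tuples n (carr U)" "b' \<in> tuples n (carr U)" "?G b" "pat b = pat b'" for b b'
      proof (rule ccontr)
        assume "\<not> ?G b'"
        then have "Sep (b @ b')" using b Gmaj tuplesD(1)[OF b(1)] by (simp add: Sep_def)
        moreover have "Eqv \<rho> (b @ b')" if "\<rho> \<in> R" for \<rho>
          using b(4) that tuplesD(1)[OF b(1)] by (auto simp: Eqv_def pat_def)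
        ultimately have "\<forall>D\<in>insert Sep (F - {Sep}). D (b @ b')" unfolding R(3) by auto
        then have "\<forall>D\<in>F. D (b @ b')" by auto
        then show False using no tuples_append[OF b(1,2)] by blast
      qed
      have "?G b \<longleftrightarrow> (\<exists>S\<in>pat ` {b\<in>tuples n (carr U). ?G b}. \<forall>\<rho>\<in>R. \<rho> b \<longleftrightarrow> \<rho> \<in> S)"
        if b: "b \<in> tuples n (carr U)" for b
      proof
        assume "?G b"
        then show "\<exists>S\<in>pat ` {b\<in>tuples n (carr U). ?G b}. \<forall>\<rho>\<in>R. \<rho> b \<longleftrightarrow> \<rho> \<in> S"
          using b by (intro bexI[of _ "pat b"]) (auto simp: pat_def)
      next
        assume "\<exists>S\<in>pat ` {b\<in>tuples n (carr U). ?G b}. \<forall>\<rho>\<in>R. \<rho> b \<longleftrightarrow> \<rho> \<in> S"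
        then obtain b0 where b0: "b0 \<in> tuples n (carr U)" "?G b0" "\<forall>\<rho>\<in>R. \<rho> b \<longleftrightarrow> \<rho> \<in> pat b0" by auto
        then have "pat b0 = pat b" by (auto simp: pat_def)
        then show "?G b" using same[OF b0(1) b b0(2)] by simp
      qed
      moreover have "definable L U M n (\<lambda>b. \<exists>S\<in>pat ` {b\<in>tuples n (carr U). ?G b}. \<forall>\<rho>\<in>R. \<rho> b \<longleftrightarrow> \<rho> \<in> S)"
      proof (intro definable_bex definable_ball definable_iff definable_const)
        have "pat ` {b\<in>tuples n (carr U). ?G b} \<subseteq> Pow R" by (auto simp: pat_def)
        then show "finite (pat ` {b\<in>tuples n (carr U). ?G b})" using R(1) by (meson finite_Pow_iff finite_subset)
      qed (use R in auto)
      ultimately have "definable L U M n ?G" by (subst definable_cong) auto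
      with nd show False ..
    qed
  qed
  then obtain z where z: "z\<in>tuples (n + n) (carr U)" "\<forall>D\<in>\<D>. D z" by blast
  have b: "take n z \<in> tuples n (carr U)" "drop n z \<in> tuples n (carr U)"
    using tuples_take_drop[OF z(1)] by auto
  have "Sep z" "\<And>\<rho>. definable L U M n \<rho> \<Longrightarrow> Eqv \<rho> z" using z(2) by (auto simp: \<D>_def)
  then have "?G (take n z)" "\<not> ?G (drop n z)" "\<And>\<rho>. definable L U M n \<rho> \<Longrightarrow> \<rho> (take n z) \<longleftrightarrow> \<rho> (drop n z)"
    using Gmaj b by (auto simp: Sep_def Eqv_def)
  then show False
    using gen_invariant[OF inv definable_sat[OF \<phi>] b] by blast
qed

end

section \<open>Atomless probability spaces\<close>

locale atomless_space = prob_space \<Omega> for \<Omega> :: "'w measure" +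
  assumes splits: "\<And>A. A \<in> sets \<Omega> \<Longrightarrow> 0 < prob A \<Longrightarrow> \<exists>B\<in>sets \<Omega>. B \<subseteq> A \<and> 0 < prob B \<and> prob B < prob A"
begin

text \<open>Of two parts into which a set is split, the smaller one has at most half of the measure.\<close>

lemma small_piece:
  assumes "A \<in> sets \<Omega>" "0 < prob A" "0 < e"
  shows "\<exists>B\<in>sets \<Omega>. B \<subseteq> A \<and> 0 < prob B \<and> prob B < e"
proof -
  have half: "\<exists>B\<in>sets \<Omega>. B \<subseteq> A \<and> 0 < prob B \<and> prob B \<le> prob A / 2 ^ n" for n
  proof (induction n)
    case 0 then show ?case using assms by (intro bexI[of _ A]) auto
  next
    case (Suc n)
    then obtain B where B: "B \<in> sets \<Omega>" "B \<subseteq> A" "0 < prob B" "prob B \<le> prob A / 2 ^ n" by auto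
    then obtain C where C: "C \<in> sets \<Omega>" "C \<subseteq> B" "0 < prob C" "prob C < prob B" using splits[of B] by auto
    have D: "prob (B - C) = prob B - prob C" using B C by (intro finite_measure_Diff)
    show ?case
    proof (cases "prob C \<le> prob B / 2")
      case True
      have "prob C \<le> (prob A / 2 ^ n) / 2" using True divide_right_mono[OF B(4), of 2] by (rule order_trans) simp
      then have "prob C \<le> prob A / 2 ^ Suc n" by simp
      then show ?thesis using B C by (intro bexI[of _ C]) auto
    next
      case False
      then have "prob (B - C) \<le> prob B / 2" using D by simp
      then have "prob (B - C) \<le> (prob A / 2 ^ n) / 2" using divide_right_mono[OF B(4), of 2] by (rule order_trans) simp
      then have "prob (B - C) \<le> prob A / 2 ^ Suc n" by simp
      then show ?thesis using B C D by (intro bexI[of _ "B - C"]) auto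
    qed
  qed
  have "(\<lambda>n. prob A / 2 ^ n) \<longlonglongrightarrow> 0"
    by (intro LIMSEQ_divide_realpow_zero) simp
  then have "eventually (\<lambda>n. prob A / 2 ^ n < e) sequentially"
    using assms(3) by (rule order_tendstoD)
  then obtain n where "prob A / 2 ^ n < e" by (auto simp: eventually_sequentially)
  then show ?thesis using half[of n] by (meson le_less_trans)
qed

text \<open>Sierpinski's theorem, by exhaustion: a set is enlarged step by step by a part that still
  fits below \<open>t\<close> and has at least half of the largest possible measure. If the union fell short of
  \<open>t\<close>, then a small piece of the rest would fit at each step, so the steps would all have
  measure bounded below.\<close>

lemma subset_of_measure:
  assumes E: "E \<in> sets \<Omega>" and t: "0 \<le> t" "t \<le> prob E"
  shows "\<exists>B\<in>sets \<Omega>. B \<subseteq> E \<and> prob B = t"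
proof -
  define P where "P B \<longleftrightarrow> B \<in> sets \<Omega> \<and> B \<subseteq> E \<and> prob B \<le> t" for B
  define fits where "fits B C \<longleftrightarrow> C \<in> sets \<Omega> \<and> C \<subseteq> E - B \<and> prob B + prob C \<le> t" for B C
  \<comment> \<open>the step from \<open>B\<close> to \<open>B'\<close> adds at least half of what could be added\<close>
  define Q where "Q B B' \<longleftrightarrow> B \<subseteq> B' \<and> (\<forall>C. fits B C \<longrightarrow> prob C \<le> 2 * (prob B' - prob B))" for B B'
  have "\<exists>B. \<forall>n::nat. P (B n) \<and> Q (B n) (B (Suc n))"
  proof (rule dependent_nat_choice)
    show "\<exists>B. P B" using t by (intro exI[of _ "{}"]) (auto simp: P_def)
    fix B assume B: "P B"
    define s where "s = Sup (prob ` Collect (fits B))"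
    have 0: "fits B {}" using B by (auto simp: P_def fits_def)
    have bdd: "bdd_above (prob ` Collect (fits B))" by (intro bdd_aboveI[of _ 1]) auto
    have le_s: "prob C \<le> s" if "fits B C" for C
      unfolding s_def using that bdd by (intro cSup_upper) auto
    obtain C where C: "fits B C" "s \<le> 2 * prob C"
    proof (cases "s > 0")
      case True
      then have "s / 2 < s" by simp
      have "prob ` Collect (fits B) \<noteq> {}" using 0 by auto
      then have "\<exists>x\<in>prob ` Collect (fits B). s / 2 < x"
        using less_cSup_iff[OF _ bdd, of "s / 2"] \<open>s / 2 < s\<close> unfolding s_def by simp
      then obtain C where "fits B C" "s / 2 < prob C" by auto
      then show ?thesis by (intro that) auto
    next
      case False
      then show ?thesis using 0 by (intro that) auto
    qed
    have "prob (B \<union> C) = prob B + prob C"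
      using B C(1) by (intro finite_measure_Union) (auto simp: P_def fits_def)
    moreover have "prob C' \<le> 2 * prob C" if "fits B C'" for C'
      using le_s[OF that] C(2) by linarith
    ultimately have "P (B \<union> C)" "Q B (B \<union> C)"
      using B C(1) by (auto simp: P_def fits_def Q_def)
    then show "\<exists>B'. P B' \<and> Q B B'" by blast
  qed
  then obtain B where B: "\<And>n. P (B n)" "\<And>n. Q (B n) (B (Suc n))" by auto
  let ?B = "\<Union>n. B n"
  have inc: "incseq B" using B(2) by (intro incseq_SucI) (auto simp: Q_def)
  have sets: "range B \<subseteq> sets \<Omega>" using B(1) by (auto simp: P_def)
  have lim: "(\<lambda>n. prob (B n)) \<longlonglongrightarrow> prob ?B" by (rule finite_Lim_measure_incseq[OF sets inc])
  have Bs: "?B \<in> sets \<Omega>" "?B \<subseteq> E" using B(1) by (auto simp: P_def)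
  have le: "prob ?B \<le> t" using B(1) by (intro LIMSEQ_le_const2[OF lim]) (auto simp: P_def)
  have "prob ?B = t"
  proof (rule ccontr)
    assume "prob ?B \<noteq> t"
    then have lt: "prob ?B < t" using le by simp
    have "prob (E - ?B) = prob E - prob ?B" using E Bs by (intro finite_measure_Diff) auto
    then have "0 < prob (E - ?B)" using lt t by simp
    then obtain C where C: "C \<in> sets \<Omega>" "C \<subseteq> E - ?B" "0 < prob C" "prob C < t - prob ?B"
      using small_piece[of "E - ?B" "t - prob ?B"] lt E Bs by auto
    have "prob C \<le> 2 * (prob (B (Suc n)) - prob (B n))" for n
    proof -
      have "prob (B n) \<le> prob ?B" using Bs by (intro finite_measure_mono) auto
      then have "fits (B n) C" using C by (auto simp: fits_def)
      then show ?thesis using B(2)[of n] by (auto simp: Q_def)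
    qed
    moreover have "(\<lambda>n. 2 * (prob (B (Suc n)) - prob (B n))) \<longlonglongrightarrow> 2 * (prob ?B - prob ?B)"
      using lim LIMSEQ_Suc[OF lim] by (intro tendsto_intros)
    ultimately have "prob C \<le> 0" using LIMSEQ_le_const[of _ "2 * (prob ?B - prob ?B)" "prob C"] by auto
    then show False using C(3) by simp
  qed
  then show ?thesis using Bs by blast
qed

lemma simple_Collect: "simple_function \<Omega> f \<Longrightarrow> {\<omega>\<in>space \<Omega>. Q (f \<omega>)} \<in> sets \<Omega>"
  using simple_functionD(2)[of \<Omega> f "Collect Q"] by (auto simp: vimage_def Int_def conj_commute)

text \<open>\<open>X\<close> is cut into pieces labelled by \<open>S\<close> of measures as close to the weights as
  the difference of the totals permits. Each label takes what it asks for as long as there is something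
  left; the last label takes the rest.\<close>

lemma distribute:
  assumes "finite S" "S \<noteq> {}" "X \<in> sets \<Omega>" "\<And>A. A \<in> S \<Longrightarrow> 0 \<le> t A"
  shows "\<exists>k. simple_function \<Omega> k \<and> (\<forall>\<omega>\<in>X. k \<omega> \<in> S) \<and>
    (\<forall>A\<in>S. \<bar>prob {\<omega>\<in>X. k \<omega> = A} - t A\<bar> \<le> \<bar>prob X - sum t S\<bar>)"
  using assms
proof (induction S arbitrary: X rule: finite_ne_induct)
  case (singleton A)
  then show ?case by (intro exI[of _ "\<lambda>_. A"]) auto
next
  case (insert A S)
  obtain B where B: "B \<in> sets \<Omega>" "B \<subseteq> X" "prob B = min (t A) (prob X)"
    using subset_of_measure[of X "min (t A) (prob X)"] insert.prems by auto
  obtain k where k: "simple_function \<Omega> k" "\<And>\<omega>. \<omega> \<in> X - B \<Longrightarrow> k \<omega> \<in> S"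
    "\<And>C. C \<in> S \<Longrightarrow> \<bar>prob {\<omega>\<in>X - B. k \<omega> = C} - t C\<bar> \<le> \<bar>prob (X - B) - sum t S\<bar>"
    using insert.IH[of "X - B"] insert.prems B(1) by blast
  have XB: "prob (X - B) = prob X - prob B" using insert.prems B by (intro finite_measure_Diff) auto
  have nn: "0 \<le> sum t S" using insert.prems by (intro sum_nonneg) auto
  let ?k = "\<lambda>\<omega>. if \<omega> \<in> B then A else k \<omega>"
  have "simple_function \<Omega> ?k"
    using simple_function_If_set[OF simple_function_const k(1), of B A] B(1) by (simp add: sets.Int_space_eq2)
  moreover have "\<forall>\<omega>\<in>X. ?k \<omega> \<in> insert A S" using k(2) by auto
  moreover have "\<bar>prob {\<omega>\<in>X. ?k \<omega> = C} - t C\<bar> \<le> \<bar>prob X - sum t (insert A S)\<bar>" if C: "C \<in> insert A S" for C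
  proof (cases "C = A")
    case True
    have kA: "k \<omega> \<noteq> A" if "\<omega> \<in> X - B" for \<omega> using k(2)[OF that] insert.hyps(3) by metis
    have "{\<omega>\<in>X. ?k \<omega> = A} = B"
    proof (intro equalityI subsetI)
      fix \<omega> assume "\<omega> \<in> {\<omega>\<in>X. ?k \<omega> = A}"
      then show "\<omega> \<in> B" using kA[of \<omega>] by (cases "\<omega> \<in> B") simp_all
    qed (use B(2) in auto)
    then have "prob {\<omega>\<in>X. ?k \<omega> = C} = min (t A) (prob X)" using True B(3) by simp
    then show ?thesis using True insert.hyps nn by (auto simp: min_def)
  next
    case False
    then have "{\<omega>\<in>X. ?k \<omega> = C} = {\<omega>\<in>X - B. k \<omega> = C}" by auto
    then have "\<bar>prob {\<omega>\<in>X. ?k \<omega> = C} - t C\<bar> \<le> \<bar>prob (X - B) - sum t S\<bar>" using k(3) C False by simp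
    also have "\<dots> \<le> \<bar>prob X - sum t (insert A S)\<bar>"
      using XB B(3) insert.hyps nn by (auto simp: min_def)
    finally show ?thesis .
  qed
  ultimately show ?case by blast
qed

lemma simple_function_select:
  assumes "simple_function \<Omega> q" "\<And>s. s \<in> q ` space \<Omega> \<Longrightarrow> simple_function \<Omega> (K s)"
  shows "simple_function \<Omega> (\<lambda>\<omega>. K (q \<omega>) \<omega>)"
  unfolding simple_function_def
proof
  have fin: "finite (q ` space \<Omega>)" using assms(1) by (rule simple_functionD)
  have "(\<lambda>\<omega>. K (q \<omega>) \<omega>) ` space \<Omega> \<subseteq> (\<Union>s\<in>q ` space \<Omega>. K s ` space \<Omega>)" by auto
  moreover have "finite (\<Union>s\<in>q ` space \<Omega>. K s ` space \<Omega>)"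
    using fin assms(2) simple_functionD(1) by blast
  ultimately show "finite ((\<lambda>\<omega>. K (q \<omega>) \<omega>) ` space \<Omega>)" by (rule finite_subset)
  show "\<forall>x\<in>(\<lambda>\<omega>. K (q \<omega>) \<omega>) ` space \<Omega>. (\<lambda>\<omega>. K (q \<omega>) \<omega>) -` {x} \<inter> space \<Omega> \<in> sets \<Omega>"
  proof
    fix x
    have "(\<lambda>\<omega>. K (q \<omega>) \<omega>) -` {x} \<inter> space \<Omega> =
      (\<Union>s\<in>q ` space \<Omega>. (q -` {s} \<inter> space \<Omega>) \<inter> (K s -` {x} \<inter> space \<Omega>))" by auto
    also have "\<dots> \<in> sets \<Omega>"
    proof (rule sets.finite_UN[OF fin], rule sets.Int)
      fix s assume s: "s \<in> q ` space \<Omega>"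
      show "q -` {s} \<inter> space \<Omega> \<in> sets \<Omega>" using assms(1) by (rule simple_functionD)
      show "K s -` {x} \<inter> space \<Omega> \<in> sets \<Omega>" using assms(2)[OF s] by (rule simple_functionD)
    qed
    finally show "(\<lambda>\<omega>. K (q \<omega>) \<omega>) -` {x} \<inter> space \<Omega> \<in> sets \<Omega>" .
  qed
qed

lemma simple_function_tuple:
  "\<forall>f\<in>set h. simple_function \<Omega> f \<Longrightarrow> simple_function \<Omega> (\<lambda>\<omega>. map (\<lambda>f. f \<omega>) h)"
  by (induction h) (auto intro: simple_function_compose2)

end

section \<open>Back and forth between random elements\<close>

locale random_elements = atomless_space \<Omega> for \<Omega> :: "'w measure" +
  fixes L :: "('f, 'r) lang" and U :: "('u, 'f, 'r) struct"
  assumes carr_ne: "carr U \<noteq> {}"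
begin

definition R0 where "R0 = mcarr (rand0 U \<Omega>)"

abbreviation vals :: "('w \<Rightarrow> 'u) list \<Rightarrow> 'w \<Rightarrow> 'u list" where "vals h \<omega> \<equiv> map (\<lambda>f. f \<omega>) h"

text \<open>The probability \<open>P\<lbrakk>D(h)\<rbrakk>\<close>, for simple random elements.\<close>

definition pr :: "('u list \<Rightarrow> bool) \<Rightarrow> ('w \<Rightarrow> 'u) list \<Rightarrow> real" where
  "pr D h = prob {\<omega>\<in>space \<Omega>. D (vals h \<omega>)}"

lemma R0_iff: "f \<in> R0 \<longleftrightarrow> simple_function \<Omega> f \<and> f ` space \<Omega> \<subseteq> carr U"
  by (simp add: R0_def rand0_def)

lemma simple_vals: "h \<in> tuples n R0 \<Longrightarrow> simple_function \<Omega> (vals h)"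
  by (intro simple_function_tuple) (auto simp: tuples_def R0_iff)

lemma vals_tuples: "h \<in> tuples n R0 \<Longrightarrow> \<omega> \<in> space \<Omega> \<Longrightarrow> vals h \<omega> \<in> tuples n (carr U)"
  by (fastforce simp: tuples_def R0_iff)

lemma vals_sets: "h \<in> tuples n R0 \<Longrightarrow> {\<omega>\<in>space \<Omega>. D (vals h \<omega>)} \<in> sets \<Omega>"
  using simple_Collect[OF simple_vals] .

lemma pr_cong: "(\<And>\<omega>. \<omega> \<in> space \<Omega> \<Longrightarrow> D (vals h \<omega>) = E (vals h' \<omega>)) \<Longrightarrow> pr D h = pr E h'"
  unfolding pr_def by (intro arg_cong[where f=prob]) auto

text \<open>A cell consists of the points where \<open>e\<close> admits the set \<open>S\<close> of patterns and
  \<open>g\<close> realizes the pattern \<open>A\<close> in \<open>S\<close>. That \<open>e\<close> admits exactly the patterns in \<open>S\<close>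
  is a definable property of \<open>e\<close>; if these properties have almost the same probabilities for
  \<open>e'\<close>, then the region of \<open>e'\<close> belonging to \<open>S\<close> is distributed among
  the patterns in the proportions prescribed by the cells of \<open>g\<close>. All probabilities for \<open>g # e\<close>
  are sums over cells.\<close>

lemma back_and_forth:
  assumes \<Psi>: "finite \<Psi>" "\<And>D. D \<in> \<Psi> \<Longrightarrow> definable L U {} (Suc n) D" and \<delta>: "0 < (\<delta>::real)"
  shows "\<exists>\<Psi>' \<delta>'. finite \<Psi>' \<and> (\<forall>D\<in>\<Psi>'. definable L U {} n D) \<and> 0 < (\<delta>'::real) \<and>
    (\<forall>e\<in>tuples n R0. \<forall>e'\<in>tuples n R0. (\<forall>D\<in>\<Psi>'. \<bar>pr D e - pr D e'\<bar> < \<delta>') \<longrightarrow>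
      (\<forall>g\<in>R0. \<exists>g'\<in>R0. \<forall>D\<in>\<Psi>. \<bar>pr D (g # e) - pr D (g' # e')\<bar> < \<delta>))"
proof -
  define pat where "pat u b = {D\<in>\<Psi>. D (u # b)}" for u b
  define ext where "ext b = (\<lambda>u. pat u b) ` carr U" for b
  define E where "E S b \<longleftrightarrow> ext b = S" for S b
  define \<I> where "\<I> = Pow (Pow \<Psi>) \<times> Pow \<Psi>"
  have fin\<I>: "finite \<I>" using \<Psi>(1) by (simp add: \<I>_def)
  \<comment> \<open>an error of \<open>\<delta>'\<close> is made on each cell\<close>
  define \<delta>' where "\<delta>' = \<delta> / (card \<I> + 1)"
  have ext_sub: "ext b \<in> Pow (Pow \<Psi>)" for b by (auto simp: ext_def pat_def)
  have ext_ne: "ext b \<noteq> {}" for b using carr_ne by (simp add: ext_def)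
  define w where "w b A = (SOME u. u \<in> carr U \<and> pat u b = A)" for b A
  have w: "w b A \<in> carr U \<and> pat (w b A) b = A" if "A \<in> ext b" for b A
    unfolding w_def by (rule someI_ex) (use that in \<open>auto simp: ext_def\<close>)
  define cell where "cell g e S A = {\<omega>\<in>space \<Omega>. ext (vals e \<omega>) = S \<and> pat (g \<omega>) (vals e \<omega>) = A}" for g e S A
  have cell_sets: "cell g e S A \<in> sets \<Omega>" if "g \<in> R0" "e \<in> tuples n R0" for g e S A
    using vals_sets[of "g # e" "Suc n" "\<lambda>z. ext (tl z) = S \<and> pat (hd z) (tl z) = A"] that
    by (simp add: cell_def)
  have pr_cells: "pr D (g # e) = (\<Sum>(S, A)\<in>{(S, A)\<in>\<I>. A \<in> S \<and> D \<in> A}. prob (cell g e S A))"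
    if "g \<in> R0" "e \<in> tuples n R0" "D \<in> \<Psi>" for g e D
  proof -
    let ?J = "{(S, A)\<in>\<I>. A \<in> S \<and> D \<in> A}"
    have in_ext: "pat (g \<omega>) (vals e \<omega>) \<in> ext (vals e \<omega>)" if "\<omega> \<in> space \<Omega>" for \<omega>
      using \<open>g \<in> R0\<close> that by (auto simp: ext_def R0_iff)
    have "{\<omega>\<in>space \<Omega>. D (vals (g # e) \<omega>)} = (\<Union>i\<in>?J. case i of (S, A) \<Rightarrow> cell g e S A)"
    proof (intro equalityI subsetI)
      fix \<omega> assume "\<omega> \<in> {\<omega>\<in>space \<Omega>. D (vals (g # e) \<omega>)}"
      then have \<omega>: "\<omega> \<in> space \<Omega>" "D (g \<omega> # vals e \<omega>)" by auto
      then have "(ext (vals e \<omega>), pat (g \<omega>) (vals e \<omega>)) \<in> ?J"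
        using in_ext[OF \<omega>(1)] ext_sub[of "vals e \<omega>"] \<open>D \<in> \<Psi>\<close> by (auto simp: \<I>_def pat_def)
      then show "\<omega> \<in> (\<Union>i\<in>?J. case i of (S, A) \<Rightarrow> cell g e S A)"
        using \<omega>(1) by (intro UN_I) (auto simp: cell_def)
    qed (auto simp: cell_def pat_def)
    moreover have "prob (\<Union>i\<in>?J. case i of (S, A) \<Rightarrow> cell g e S A) = (\<Sum>i\<in>?J. prob (case i of (S, A) \<Rightarrow> cell g e S A))"
      using finite_subset[OF _ fin\<I>, of ?J] cell_sets[OF that(1,2)]
      by (intro finite_measure_finite_Union) (auto simp: disjoint_family_on_def cell_def)
    ultimately show ?thesis
      unfolding pr_def by (simp add: case_prod_beta)
  qed
  show ?thesis
  proof (intro exI[of _ "E ` Pow (Pow \<Psi>)"] exI[of _ \<delta>'] conjI ballI impI)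
    show "finite (E ` Pow (Pow \<Psi>))" using \<Psi>(1) by simp
    show "0 < \<delta>'" using \<delta> by (simp add: \<delta>'_def)
    show "definable L U {} n D" if "D \<in> E ` Pow (Pow \<Psi>)" for D
    proof -
      from that obtain S where S: "S \<subseteq> Pow \<Psi>" "D = E S" by auto
      have "definable L U {} n (\<lambda>b. \<forall>A\<in>Pow \<Psi>. (\<exists>u\<in>carr U. \<forall>D\<in>\<Psi>. D (u # b) \<longleftrightarrow> D \<in> A) \<longleftrightarrow> A \<in> S)"
        using \<Psi> by (intro definable_ball definable_iff definable_const definable_ex1[where D="\<lambda>z. \<forall>D\<in>\<Psi>. D z \<longleftrightarrow> D \<in> _"]) auto
      moreover have "E S b \<longleftrightarrow> (\<forall>A\<in>Pow \<Psi>. (\<exists>u\<in>carr U. \<forall>D\<in>\<Psi>. D (u # b) \<longleftrightarrow> D \<in> A) \<longleftrightarrow> A \<in> S)" for b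
      proof -
        have "(\<exists>u\<in>carr U. \<forall>D\<in>\<Psi>. D (u # b) \<longleftrightarrow> D \<in> A) \<longleftrightarrow> A \<in> ext b" if A: "A \<in> Pow \<Psi>" for A
        proof -
          have "(\<forall>D\<in>\<Psi>. D (u # b) \<longleftrightarrow> D \<in> A) \<longleftrightarrow> A = pat u b" for u
            using A unfolding pat_def by blast
          then show ?thesis by (simp add: ext_def image_iff)
        qed
        then have "(\<forall>A\<in>Pow \<Psi>. (\<exists>u\<in>carr U. \<forall>D\<in>\<Psi>. D (u # b) \<longleftrightarrow> D \<in> A) \<longleftrightarrow> A \<in> S) \<longleftrightarrow>
            (\<forall>A\<in>Pow \<Psi>. A \<in> ext b \<longleftrightarrow> A \<in> S)" by simp
        also have "\<dots> \<longleftrightarrow> ext b = S" using S(1) ext_sub[of b] by blast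
        finally show ?thesis by (simp add: E_def)
      qed
      ultimately show ?thesis unfolding S(2) by (subst definable_cong) auto
    qed
    fix e e' g assume e: "e \<in> tuples n R0" and e': "e' \<in> tuples n R0" and g: "g \<in> R0"
      and close: "\<forall>D\<in>E ` Pow (Pow \<Psi>). \<bar>pr D e - pr D e'\<bar> < \<delta>'"
    define X where "X e S = {\<omega>\<in>space \<Omega>. ext (vals e \<omega>) = S}" for e S
    have X_sets: "X e' S \<in> sets \<Omega>" for S
      unfolding X_def using vals_sets[OF e', of "\<lambda>b. ext b = S"] .
    have X_cells: "(\<Sum>A\<in>S. prob (cell g e S A)) = prob (X e S)" if "S \<in> Pow (Pow \<Psi>)" for S
    proof -
      have "finite S" using that \<Psi>(1) by (meson PowD finite_Pow_iff finite_subset)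
      moreover have "pat (g \<omega>) (vals e \<omega>) \<in> ext (vals e \<omega>)" if "\<omega> \<in> space \<Omega>" for \<omega>
        using g that by (auto simp: ext_def R0_iff)
      then have "X e S = (\<Union>A\<in>S. cell g e S A)" by (auto simp: X_def cell_def)
      ultimately show ?thesis
        using cell_sets[OF g e]
        by (simp, intro finite_measure_finite_Union[symmetric]) (auto simp: disjoint_family_on_def cell_def)
    qed
    define good where "good S k \<longleftrightarrow> simple_function \<Omega> k \<and> (S \<noteq> {} \<longrightarrow> (\<forall>\<omega>\<in>X e' S. k \<omega> \<in> S) \<and>
        (\<forall>A\<in>S. \<bar>prob {\<omega>\<in>X e' S. k \<omega> = A} - prob (cell g e S A)\<bar> \<le> \<bar>prob (X e' S) - prob (X e S)\<bar>))"
      for S k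
    have "\<exists>k. good S k"
      if S: "S \<in> Pow (Pow \<Psi>)" for S
    proof (cases "S = {}")
      case True then show ?thesis by (intro exI[of _ "\<lambda>_. {}"]) (simp add: good_def)
    next
      case False
      have "finite S" using S \<Psi>(1) by (meson PowD finite_Pow_iff finite_subset)
      then show ?thesis
        using distribute[OF _ False X_sets, of "\<lambda>A. prob (cell g e S A)" S] X_cells[OF S]
        unfolding good_def by auto
    qed
    then have "\<forall>S\<in>Pow (Pow \<Psi>). \<exists>k. good S k" by blast
    from bchoice[OF this] obtain K where good: "\<forall>S\<in>Pow (Pow \<Psi>). good S (K S)" by blast
    have K: "\<And>S. S \<in> Pow (Pow \<Psi>) \<Longrightarrow> simple_function \<Omega> (K S)"
      "\<And>S \<omega>. S \<in> Pow (Pow \<Psi>) \<Longrightarrow> S \<noteq> {} \<Longrightarrow> \<omega> \<in> X e' S \<Longrightarrow> K S \<omega> \<in> S"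
      "\<And>S A. S \<in> Pow (Pow \<Psi>) \<Longrightarrow> A \<in> S \<Longrightarrow>
        \<bar>prob {\<omega>\<in>X e' S. K S \<omega> = A} - prob (cell g e S A)\<bar> \<le> \<bar>prob (X e' S) - prob (X e S)\<bar>"
      using good unfolding good_def by blast+
    define k where "k \<omega> = K (ext (vals e' \<omega>)) \<omega>" for \<omega>
    \<comment> \<open>on each region, realize the pattern that \<open>k\<close> prescribes, by a choice that depends on the value of \<open>e'\<close> only\<close>
    define g' where "g' \<omega> = w (vals e' \<omega>) (k \<omega>)" for \<omega>
    have k: "k \<omega> \<in> ext (vals e' \<omega>)" if "\<omega> \<in> space \<Omega>" for \<omega>
      unfolding k_def using that by (intro K(2)[OF ext_sub ext_ne]) (simp add: X_def)
    have simple_k: "simple_function \<Omega> k"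
      unfolding k_def
      using simple_function_compose1[OF simple_vals[OF e'], of ext] K(1)[OF ext_sub]
      by (intro simple_function_select[where q="\<lambda>\<omega>. ext (vals e' \<omega>)" and K=K]) auto
    have "simple_function \<Omega> g'"
      unfolding g'_def using simple_vals[OF e'] simple_k by (rule simple_function_compose2)
    then have g'R: "g' \<in> R0" using w k by (auto simp: R0_iff g'_def)
    have "\<bar>pr D (g # e) - pr D (g' # e')\<bar> < \<delta>" if D: "D \<in> \<Psi>" for D
    proof -
      let ?J = "{(S, A)\<in>\<I>. A \<in> S \<and> D \<in> A}"
      have diff: "\<bar>prob (cell g e S A) - prob (cell g' e' S A)\<bar> \<le> \<delta>'" if SA: "(S, A) \<in> ?J" for S A
      proof -
        have S: "S \<in> Pow (Pow \<Psi>)" "A \<in> S" using SA by (auto simp: \<I>_def)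
        have "cell g' e' S A = {\<omega>\<in>X e' S. K S \<omega> = A}"
          using w k by (auto simp: cell_def X_def g'_def k_def)
        then have "\<bar>prob (cell g e S A) - prob (cell g' e' S A)\<bar> \<le> \<bar>prob (X e' S) - prob (X e S)\<bar>"
          using K(3)[OF S] by (simp add: abs_minus_commute)
        also have "\<dots> = \<bar>pr (E S) e - pr (E S) e'\<bar>"
          by (simp add: pr_def X_def E_def abs_minus_commute)
        also have "\<dots> \<le> \<delta>'" using bspec[OF close imageI[OF S(1)]] by (rule less_imp_le)
        finally show ?thesis .
      qed
      have "\<bar>pr D (g # e) - pr D (g' # e')\<bar> =
          \<bar>\<Sum>(S, A)\<in>?J. prob (cell g e S A) - prob (cell g' e' S A)\<bar>"
        by (simp add: pr_cells[OF g e D] pr_cells[OF g'R e' D] sum_subtractf case_prod_beta)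
      also have "\<dots> \<le> (\<Sum>(S, A)\<in>?J. \<bar>prob (cell g e S A) - prob (cell g' e' S A)\<bar>)"
        by (rule order_trans[OF sum_abs]) (simp add: case_prod_beta)
      also have "\<dots> \<le> (\<Sum>(S, A)\<in>?J. \<delta>')" using diff by (intro sum_mono) auto
      also have "\<dots> = card ?J * \<delta>'" by (simp add: case_prod_beta)
      also have "\<dots> \<le> card \<I> * \<delta>'"
        using fin\<I> \<open>0 < \<delta>'\<close> by (intro mult_right_mono of_nat_mono card_mono) auto
      also have "\<dots> < \<delta>" using \<delta> by (simp add: \<delta>'_def field_simps)
      finally show ?thesis .
    qed
    then show "\<exists>g'\<in>R0. \<forall>D\<in>\<Psi>. \<bar>pr D (g # e) - pr D (g' # e')\<bar> < \<delta>" using g'R by blast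
  qed
qed

end

section \<open>Continuous formulas: bounds and uniform continuity\<close>

lemma tendsto_fun_iff:
  fixes f :: "'a \<Rightarrow> 'i \<Rightarrow> real"
  shows "(f \<longlongrightarrow> l) F \<longleftrightarrow> (\<forall>i. ((\<lambda>x. f x i) \<longlongrightarrow> l i) F)"
proof -
  have "(f \<longlongrightarrow> l) F \<longleftrightarrow> limitin (product_topology (\<lambda>_. euclideanreal) UNIV) f l F"
    by (simp add: euclidean_product_topology)
  also have "\<dots> \<longleftrightarrow> (\<forall>i. ((\<lambda>x. f x i) \<longlongrightarrow> l i) F)"
    by (subst limitin_componentwise) simp
  finally show ?thesis .
qed

text \<open>Coordinatewise uniform continuity of connectives. As the cube is compact, it is enough that
  two sequences whose coordinates approach each other have a common limit.\<close>

lemma cube_uniform: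
  assumes u: "continuous_on (cube k) u" and \<epsilon>: "0 < (\<epsilon>::real)"
  shows "\<exists>\<delta>>0. \<forall>v\<in>cube k. \<forall>w\<in>cube k. (\<forall>i<k. \<bar>v i - w i\<bar> < \<delta>) \<longrightarrow> \<bar>u v - u w\<bar> < \<epsilon>"
proof (rule ccontr)
  assume no: "\<not> ?thesis"
  have "\<exists>v w. v \<in> cube k \<and> w \<in> cube k \<and> (\<forall>i<k. \<bar>v i - w i\<bar> < 1 / real (Suc n)) \<and> \<epsilon> \<le> \<bar>u v - u w\<bar>" for n
  proof -
    have "0 < 1 / real (Suc n)" by simp
    with no have "\<not> (\<forall>v\<in>cube k. \<forall>w\<in>cube k. (\<forall>i<k. \<bar>v i - w i\<bar> < 1 / real (Suc n)) \<longrightarrow> \<bar>u v - u w\<bar> < \<epsilon>)"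
      by blast
    then show ?thesis by (auto simp: not_less)
  qed
  then obtain v w where vw: "\<And>n. v n \<in> cube k" "\<And>n. w n \<in> cube k"
    "\<And>n i. i < k \<Longrightarrow> \<bar>v n i - w n i\<bar> < 1 / real (Suc n)" "\<And>n. \<epsilon> \<le> \<bar>u (v n) - u (w n)\<bar>"
    by metis
  have "cube k = PiE UNIV (\<lambda>i. if i < k then {0..1} else {0})"
  proof (rule set_eqI)
    fix v
    have "v \<in> cube k \<longleftrightarrow> (\<forall>i. v i \<in> (if i < k then {0..1} else {0}))"
      unfolding cube_def mem_Collect_eq
    proof (intro iffI conjI allI impI)
      fix i assume "(\<forall>i<k. v i \<in> {0..1}) \<and> (\<forall>i\<ge>k. v i = 0)"
      then show "v i \<in> (if i < k then {0..1} else {0})" by (cases "i < k") simp_all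
    next
      fix i assume a: "\<forall>i. v i \<in> (if i < k then {0..1} else {0})" "i < k"
      show "v i \<in> {0..1}" using a(1)[rule_format, of i] a(2) by simp
    next
      fix i assume a: "\<forall>i. v i \<in> (if i < k then {0..1} else {0})" "k \<le> i"
      show "v i = 0" using a(1)[rule_format, of i] a(2) by simp
    qed
    then show "v \<in> cube k \<longleftrightarrow> v \<in> PiE UNIV (\<lambda>i. if i < k then {0..1} else {0})"
      by (simp add: PiE_iff)
  qed
  then have "compactin (product_topology (\<lambda>_. euclideanreal) UNIV) (cube k)"
    by (simp add: compactin_PiE)
  then have "compact (cube k)" by (simp add: euclidean_product_topology)
  then have "seq_compact (cube k)" by (rule compact_imp_seq_compact)
  then obtain l r where l: "l \<in> cube k" "strict_mono r" "(v \<circ> r) \<longlonglongrightarrow> l"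
    using vw(1) unfolding seq_compact_def by metis
  have vi: "(\<lambda>n. v (r n) i) \<longlonglongrightarrow> l i" for i
    using l(3) by (simp add: o_def tendsto_fun_iff)
  have "(\<lambda>n. w (r n) i) \<longlonglongrightarrow> l i" for i
  proof (cases "i < k")
    case True
    have "(\<lambda>n. v (r n) i - w (r n) i) \<longlonglongrightarrow> 0"
    proof (rule tendsto_rabs_zero_cancel, rule tendsto_sandwich[OF _ _ tendsto_const])
      have "\<bar>v (r n) i - w (r n) i\<bar> \<le> 1 / real (Suc n)" for n
      proof -
        have "\<bar>v (r n) i - w (r n) i\<bar> \<le> 1 / real (Suc (r n))" using vw(3)[OF True] by (simp add: less_imp_le)
        also have "\<dots> \<le> 1 / real (Suc n)"
          using seq_suble[OF l(2), of n] by (intro divide_left_mono) auto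
        finally show ?thesis .
      qed
      then show "\<forall>\<^sub>F n in sequentially. \<bar>v (r n) i - w (r n) i\<bar> \<le> 1 / real (Suc n)" by simp
      show "(\<lambda>n. 1 / real (Suc n)) \<longlonglongrightarrow> 0" using LIMSEQ_inverse_real_of_nat by (simp add: inverse_eq_divide)
    qed simp
    from tendsto_diff[OF vi[of i] this] show ?thesis by simp
  next
    case False
    then have "w (r n) i = v (r n) i" for n using vw(1,2) by (simp add: cube_def)
    then show ?thesis using vi by simp
  qed
  then have "(\<lambda>n. w (r n)) \<longlonglongrightarrow> l" by (simp add: tendsto_fun_iff)
  moreover have "(\<lambda>n. v (r n)) \<longlonglongrightarrow> l" using l(3) by (simp add: o_def)
  ultimately have "(\<lambda>n. u (v (r n)) - u (w (r n))) \<longlonglongrightarrow> u l - u l"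
    using u l(1) vw(1,2) by (intro tendsto_diff continuous_on_tendsto_compose[OF u]) auto
  then have "(\<lambda>n. \<bar>u (v (r n)) - u (w (r n))\<bar>) \<longlonglongrightarrow> 0"
    by (simp add: tendsto_rabs_zero)
  then have "\<epsilon> \<le> 0" using vw(4) by (intro LIMSEQ_le_const) auto
  then show False using \<epsilon> by simp
qed

text \<open>The suprema differ by at most \<open>\<epsilon>\<close> as soon as each value of either function is matched by
  the other one within \<open>\<epsilon>\<close>, up to arbitrarily small errors; the witnesses may be different points.\<close>

lemma abs_SUP_diff_le:
  fixes f g :: "'a \<Rightarrow> real"
  assumes "A \<noteq> {}" "\<And>a. a \<in> A \<Longrightarrow> f a \<in> {0..1}" "\<And>a. a \<in> A \<Longrightarrow> g a \<in> {0..1}"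
    and "\<And>a \<eta>. a \<in> A \<Longrightarrow> 0 < \<eta> \<Longrightarrow> \<exists>b\<in>A. f a \<le> g b + \<epsilon> + \<eta>" "\<And>a \<eta>. a \<in> A \<Longrightarrow> 0 < \<eta> \<Longrightarrow> \<exists>b\<in>A. g a \<le> f b + \<epsilon> + \<eta>"
  shows "\<bar>(SUP a\<in>A. f a) - (SUP a\<in>A. g a)\<bar> \<le> \<epsilon>"
proof -
  have *: "(SUP a\<in>A. f a) \<le> (SUP a\<in>A. g a) + \<epsilon>"
    if fg: "\<And>a. a \<in> A \<Longrightarrow> f a \<in> {0..1}" "\<And>a. a \<in> A \<Longrightarrow> g a \<in> {0..1}"
      "\<And>a \<eta>. a \<in> A \<Longrightarrow> 0 < \<eta> \<Longrightarrow> \<exists>b\<in>A. f a \<le> g b + \<epsilon> + \<eta>" for f g :: "'a \<Rightarrow> real"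
  proof (rule cSUP_least[OF assms(1)])
    fix a assume a: "a \<in> A"
    have bdd: "bdd_above (g ` A)" using fg(2) by (intro bdd_aboveI[of _ 1]) auto
    show "f a \<le> (SUP a\<in>A. g a) + \<epsilon>"
    proof (rule field_le_epsilon)
      fix \<eta> :: real assume "0 < \<eta>"
      then obtain b where "b \<in> A" "f a \<le> g b + \<epsilon> + \<eta>" using fg(3)[OF a] by blast
      moreover have "g b \<le> (SUP a\<in>A. g a)" using cSUP_upper[OF \<open>b \<in> A\<close> bdd] .
      ultimately show "f a \<le> (SUP a\<in>A. g a) + \<epsilon> + \<eta>" by linarith
    qed
  qed
  from *[of f g] *[of g f] show ?thesis using assms by (simp add: abs_le_iff)
qed

lemma abs_INF_diff_le:
  fixes f g :: "'a \<Rightarrow> real"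
  assumes "A \<noteq> {}" "\<And>a. a \<in> A \<Longrightarrow> f a \<in> {0..1}" "\<And>a. a \<in> A \<Longrightarrow> g a \<in> {0..1}"
    and "\<And>a \<eta>. a \<in> A \<Longrightarrow> 0 < \<eta> \<Longrightarrow> \<exists>b\<in>A. g b \<le> f a + \<epsilon> + \<eta>" "\<And>a \<eta>. a \<in> A \<Longrightarrow> 0 < \<eta> \<Longrightarrow> \<exists>b\<in>A. f b \<le> g a + \<epsilon> + \<eta>"
  shows "\<bar>(INF a\<in>A. f a) - (INF a\<in>A. g a)\<bar> \<le> \<epsilon>"
proof -
  have *: "(INF a\<in>A. g a) - \<epsilon> \<le> (INF a\<in>A. f a)"
    if fg: "\<And>a. a \<in> A \<Longrightarrow> f a \<in> {0..1}" "\<And>a. a \<in> A \<Longrightarrow> g a \<in> {0..1}"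
      "\<And>a \<eta>. a \<in> A \<Longrightarrow> 0 < \<eta> \<Longrightarrow> \<exists>b\<in>A. g b \<le> f a + \<epsilon> + \<eta>" for f g :: "'a \<Rightarrow> real"
  proof (rule cINF_greatest[OF assms(1)])
    fix a assume a: "a \<in> A"
    have bdd: "bdd_below (g ` A)" using fg(2) by (intro bdd_belowI[of _ 0]) auto
    show "(INF a\<in>A. g a) - \<epsilon> \<le> f a"
    proof (rule field_le_epsilon)
      fix \<eta> :: real assume "0 < \<eta>"
      then obtain b where "b \<in> A" "g b \<le> f a + \<epsilon> + \<eta>" using fg(3)[OF a] by blast
      moreover have "(INF a\<in>A. g a) \<le> g b" using cINF_lower[OF bdd \<open>b \<in> A\<close>] .
      ultimately show "(INF a\<in>A. g a) - \<epsilon> \<le> f a + \<eta>" by linarith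
    qed
  qed
  from *[of f g] *[of g f] show ?thesis using assms by (simp add: abs_le_iff)
qed

lemma abs_SUP_close_le:
  fixes f g :: "'a \<Rightarrow> real"
  assumes "A \<noteq> {}" "\<And>a. a \<in> A \<Longrightarrow> f a \<in> {0..1}" "\<And>a. a \<in> A \<Longrightarrow> g a \<in> {0..1}"
    and "\<And>a. a \<in> A \<Longrightarrow> \<bar>f a - g a\<bar> \<le> \<epsilon>"
  shows "\<bar>(SUP a\<in>A. f a) - (SUP a\<in>A. g a)\<bar> \<le> \<epsilon>"
proof (rule abs_SUP_diff_le[OF assms(1-3)])
  fix a and \<eta> :: real assume a: "a \<in> A" "0 < \<eta>"
  have "f a \<le> g a + \<epsilon> + \<eta>" "g a \<le> f a + \<epsilon> + \<eta>" using assms(4)[OF a(1)] a(2) by linarith+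
  then show "\<exists>b\<in>A. f a \<le> g b + \<epsilon> + \<eta>" "\<exists>b\<in>A. g a \<le> f b + \<epsilon> + \<eta>" using a(1) by blast+
qed

lemma abs_INF_close_le:
  fixes f g :: "'a \<Rightarrow> real"
  assumes "A \<noteq> {}" "\<And>a. a \<in> A \<Longrightarrow> f a \<in> {0..1}" "\<And>a. a \<in> A \<Longrightarrow> g a \<in> {0..1}"
    and "\<And>a. a \<in> A \<Longrightarrow> \<bar>f a - g a\<bar> \<le> \<epsilon>"
  shows "\<bar>(INF a\<in>A. f a) - (INF a\<in>A. g a)\<bar> \<le> \<epsilon>"
proof (rule abs_INF_diff_le[OF assms(1-3)])
  fix a and \<eta> :: real assume a: "a \<in> A" "0 < \<eta>"
  have "f a \<le> g a + \<epsilon> + \<eta>" "g a \<le> f a + \<epsilon> + \<eta>" using assms(4)[OF a(1)] a(2) by linarith+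
  then show "\<exists>b\<in>A. g b \<le> f a + \<epsilon> + \<eta>" "\<exists>b\<in>A. f b \<le> g a + \<epsilon> + \<eta>" using a(1) by blast+
qed

lemma finite_common_bound:
  fixes P :: "'a \<Rightarrow> real \<Rightarrow> bool"
  assumes "finite A" "\<And>a. a \<in> A \<Longrightarrow> \<exists>d>0. P a d" "\<And>a d d'. P a d \<Longrightarrow> 0 < d' \<Longrightarrow> d' \<le> d \<Longrightarrow> P a d'"
  shows "\<exists>d>0. \<forall>a\<in>A. P a d"
  using assms(1,2)
proof (induction A)
  case empty show ?case by (intro exI[of _ 1]) simp
next
  case (insert a A)
  obtain d where d: "0 < d" "\<forall>a\<in>A. P a d" using insert by auto
  obtain d' where d': "0 < d'" "P a d'" using insert by auto
  show ?case
    by (intro exI[of _ "min d d'"]) (use d d' assms(3) in \<open>auto intro: assms(3)\<close>)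
qed

locale cstructure =
  fixes S :: "('p \<times> nat) set" and C :: "('c, 'p) mstruct"
  assumes metric: "metric_structure S C"
begin

lemma ms: "Metric_space (mcarr C) (mdist C)" and ne: "mcarr C \<noteq> {}"
  and dist_le1: "x \<in> mcarr C \<Longrightarrow> y \<in> mcarr C \<Longrightarrow> mdist C x y \<le> 1"
  and pred01: "(P, n) \<in> S \<Longrightarrow> xs \<in> tuples n (mcarr C) \<Longrightarrow> mpred C P xs \<in> {0..1}"
  using metric unfolding metric_structure_def by blast+

lemma pred_uniform:
  "(P, n) \<in> S \<Longrightarrow> 0 < \<epsilon> \<Longrightarrow> \<exists>\<delta>>0. \<forall>xs\<in>tuples n (mcarr C). \<forall>ys\<in>tuples n (mcarr C).
           (\<forall>i<n. mdist C (xs ! i) (ys ! i) < \<delta>) \<longrightarrow> \<bar>mpred C P xs - mpred C P ys\<bar> \<le> \<epsilon>"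
  using metric unfolding metric_structure_def by blast

lemma dist_nonneg: "0 \<le> mdist C x y"
  by (simp add: Metric_space.nonneg[OF ms])

lemma dist_sym: "mdist C x y = mdist C y x"
  by (simp add: Metric_space.commute[OF ms])

lemma dist_self: "x \<in> mcarr C \<Longrightarrow> mdist C x x = 0"
  by (simp add: Metric_space.mdist_zero[OF ms])

lemma dist_triangle: "x \<in> mcarr C \<Longrightarrow> y \<in> mcarr C \<Longrightarrow> z \<in> mcarr C \<Longrightarrow> mdist C x z \<le> mdist C x y + mdist C y z"
  by (simp add: Metric_space.triangle[OF ms])

lemma nth_tuples: "x \<in> tuples n A \<Longrightarrow> i < n \<Longrightarrow> x ! i \<in> A"
  by (auto simp: tuples_def)

lemma select_tuples: "x \<in> tuples n A \<Longrightarrow> set js \<subseteq> {..<n} \<Longrightarrow> map ((!) x) js \<in> tuples (length js) A"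
  by (auto simp: tuples_def subset_iff)

lemma conn_arg_cube:
  assumes "\<And>\<phi>. \<phi> \<in> set \<phi>s \<Longrightarrow> ceval C \<phi> e \<in> {0..1}"
  shows "(\<lambda>i. if i < length \<phi>s then map (\<lambda>\<phi>. ceval C \<phi> e) \<phi>s ! i else 0) \<in> cube (length \<phi>s)"
  using assms by (auto simp: cube_def)

lemma ceval01: "cwf S \<phi> n \<Longrightarrow> e \<in> tuples n (mcarr C) \<Longrightarrow> ceval C \<phi> e \<in> {0..1}"
proof (induction \<phi> arbitrary: n e)
  case (CDist i j)
  then have "e ! i \<in> mcarr C" "e ! j \<in> mcarr C" using nth_tuples by auto
  then show ?case using dist_nonneg dist_le1 by simp
next
  case (CPred P js)
  then show ?case using pred01[of P "length js"] select_tuples[of e n "mcarr C" js] by auto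
next
  case (CConn u \<phi>s)
  have "(\<lambda>i. if i < length \<phi>s then map (\<lambda>\<phi>. ceval C \<phi> e) \<phi>s ! i else 0) \<in> cube (length \<phi>s)"
    using CConn by (intro conn_arg_cube CConn.IH) (auto simp: list_all_iff)
  then show ?case using CConn.prems(1) by auto
next
  case (CSup \<phi>)
  have *: "a \<in> mcarr C \<Longrightarrow> ceval C \<phi> (a # e) \<in> {0..1}" for a
    using CSup.IH[of "Suc n" "a # e"] CSup.prems by simp
  obtain a where a: "a \<in> mcarr C" using ne by auto
  have bdd: "bdd_above ((\<lambda>a. ceval C \<phi> (a # e)) ` mcarr C)" using * by (intro bdd_aboveI[of _ 1]) auto
  have "0 \<le> (SUP a\<in>mcarr C. ceval C \<phi> (a # e))"
    using cSUP_upper[OF a bdd] *[OF a] by auto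
  moreover have "(SUP a\<in>mcarr C. ceval C \<phi> (a # e)) \<le> 1" using * by (intro cSUP_least[OF ne]) auto
  ultimately show ?case by simp
next
  case (CInf \<phi>)
  have *: "a \<in> mcarr C \<Longrightarrow> ceval C \<phi> (a # e) \<in> {0..1}" for a
    using CInf.IH[of "Suc n" "a # e"] CInf.prems by simp
  obtain a where a: "a \<in> mcarr C" using ne by auto
  have bdd: "bdd_below ((\<lambda>a. ceval C \<phi> (a # e)) ` mcarr C)" using * by (intro bdd_belowI[of _ 0]) auto
  have "(INF a\<in>mcarr C. ceval C \<phi> (a # e)) \<le> 1"
    using cINF_lower[OF bdd a] *[OF a] by auto
  moreover have "0 \<le> (INF a\<in>mcarr C. ceval C \<phi> (a # e))" using * by (intro cINF_greatest[OF ne]) auto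
  ultimately show ?case by simp
qed

lemma ceval_uniform:
  "cwf S \<phi> n \<Longrightarrow> 0 < \<epsilon> \<Longrightarrow> \<exists>\<delta>>0. \<forall>x\<in>tuples n (mcarr C). \<forall>y\<in>tuples n (mcarr C).
     (\<forall>i<n. mdist C (x ! i) (y ! i) < \<delta>) \<longrightarrow> \<bar>ceval C \<phi> x - ceval C \<phi> y\<bar> \<le> \<epsilon>"
proof (induction \<phi> arbitrary: n \<epsilon>)
  case (CDist i j)
  have "\<bar>mdist C (x ! i) (x ! j) - mdist C (y ! i) (y ! j)\<bar> \<le> \<epsilon>"
    if xy: "x \<in> tuples n (mcarr C)" "y \<in> tuples n (mcarr C)" and d: "\<forall>i<n. mdist C (x ! i) (y ! i) < \<epsilon> / 2" for x y
  proof -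
    have m: "x ! i \<in> mcarr C" "x ! j \<in> mcarr C" "y ! i \<in> mcarr C" "y ! j \<in> mcarr C"
      using xy CDist.prems nth_tuples by auto
    have "mdist C (x ! i) (y ! i) < \<epsilon> / 2" "mdist C (x ! j) (y ! j) < \<epsilon> / 2"
      using d CDist.prems by auto
    then show ?thesis
      using dist_triangle[OF m(1) m(3) m(2)] dist_triangle[OF m(3) m(4) m(2)]
        dist_triangle[OF m(3) m(1) m(4)] dist_triangle[OF m(1) m(2) m(4)]
        dist_sym[of "x ! i" "y ! i"] dist_sym[of "x ! j" "y ! j"] by linarith
  qed
  then show ?case using CDist.prems by (intro exI[of _ "\<epsilon> / 2"]) simp
next
  case (CPred P js)
  then obtain \<delta> where \<delta>: "0 < \<delta>" "\<And>xs ys. xs\<in>tuples (length js) (mcarr C) \<Longrightarrow> ys\<in>tuples (length js) (mcarr C) \<Longrightarrow>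
           (\<forall>i<length js. mdist C (xs ! i) (ys ! i) < \<delta>) \<Longrightarrow> \<bar>mpred C P xs - mpred C P ys\<bar> \<le> \<epsilon>"
    using pred_uniform[of P "length js" \<epsilon>] by auto
  show ?case
  proof (intro exI[of _ \<delta>] conjI ballI impI)
    fix x y assume xy: "x \<in> tuples n (mcarr C)" "y \<in> tuples n (mcarr C)" "\<forall>i<n. mdist C (x ! i) (y ! i) < \<delta>"
    have js: "set js \<subseteq> {..<n}" using CPred.prems by simp
    have "\<forall>i<length js. mdist C (map ((!) x) js ! i) (map ((!) y) js ! i) < \<delta>"
      using xy(3) js by (auto simp: subset_iff)
    then show "\<bar>ceval C (CPred P js) x - ceval C (CPred P js) y\<bar> \<le> \<epsilon>"
      using \<delta>(2)[OF select_tuples[OF xy(1) js] select_tuples[OF xy(2) js]] by simp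
  qed (rule \<delta>(1))
next
  case (CConn u \<phi>s)
  let ?k = "length \<phi>s"
  have wf: "\<And>\<phi>. \<phi> \<in> set \<phi>s \<Longrightarrow> cwf S \<phi> n" using CConn.prems by (auto simp: list_all_iff)
  have "continuous_on (cube ?k) u" using CConn.prems by simp
  from cube_uniform[OF this CConn.prems(2)] obtain \<eta> where \<eta>: "0 < \<eta>"
    "\<And>v w. v \<in> cube ?k \<Longrightarrow> w \<in> cube ?k \<Longrightarrow> \<forall>i<?k. \<bar>v i - w i\<bar> < \<eta> \<Longrightarrow> \<bar>u v - u w\<bar> < \<epsilon>"
    by auto
  have "\<exists>\<delta>>0. \<forall>\<phi>\<in>set \<phi>s. \<forall>x\<in>tuples n (mcarr C). \<forall>y\<in>tuples n (mcarr C).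
     (\<forall>i<n. mdist C (x ! i) (y ! i) < \<delta>) \<longrightarrow> \<bar>ceval C \<phi> x - ceval C \<phi> y\<bar> \<le> \<eta> / 2"
  proof (rule finite_common_bound)
    fix \<phi> assume "\<phi> \<in> set \<phi>s"
    then show "\<exists>\<delta>>0. \<forall>x\<in>tuples n (mcarr C). \<forall>y\<in>tuples n (mcarr C).
     (\<forall>i<n. mdist C (x ! i) (y ! i) < \<delta>) \<longrightarrow> \<bar>ceval C \<phi> x - ceval C \<phi> y\<bar> \<le> \<eta> / 2"
      using CConn.IH[of \<phi> n "\<eta> / 2"] wf \<eta>(1) by simp
  qed (auto intro: less_le_trans)
  then obtain \<delta> where \<delta>: "0 < \<delta>" "\<And>\<phi> x y. \<phi>\<in>set \<phi>s \<Longrightarrow> x\<in>tuples n (mcarr C) \<Longrightarrow> y\<in>tuples n (mcarr C) \<Longrightarrow>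
     \<forall>i<n. mdist C (x ! i) (y ! i) < \<delta> \<Longrightarrow> \<bar>ceval C \<phi> x - ceval C \<phi> y\<bar> \<le> \<eta> / 2" by blast
  show ?case
  proof (intro exI[of _ \<delta>] conjI ballI impI)
    fix x y assume xy: "x \<in> tuples n (mcarr C)" "y \<in> tuples n (mcarr C)" "\<forall>i<n. mdist C (x ! i) (y ! i) < \<delta>"
    have "\<bar>ceval C (\<phi>s ! i) x - ceval C (\<phi>s ! i) y\<bar> < \<eta>" if "i < ?k" for i
      using \<delta>(2)[OF nth_mem[OF that] xy] \<eta>(1) by linarith
    then have c: "\<forall>i<?k. \<bar>(if i < ?k then map (\<lambda>\<phi>. ceval C \<phi> x) \<phi>s ! i else 0) -
        (if i < ?k then map (\<lambda>\<phi>. ceval C \<phi> y) \<phi>s ! i else 0)\<bar> < \<eta>" by simp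
    have "\<bar>ceval C (CConn u \<phi>s) x - ceval C (CConn u \<phi>s) y\<bar> < \<epsilon>"
      unfolding ceval.simps
      by (rule \<eta>(2)[OF _ _ c]) (intro conn_arg_cube ceval01[OF wf] xy(1,2); assumption)+
    then show "\<bar>ceval C (CConn u \<phi>s) x - ceval C (CConn u \<phi>s) y\<bar> \<le> \<epsilon>" by simp
  qed (rule \<delta>(1))
next
  case (CSup \<phi>)
  then obtain \<delta> where \<delta>: "0 < \<delta>" "\<And>x y. x\<in>tuples (Suc n) (mcarr C) \<Longrightarrow> y\<in>tuples (Suc n) (mcarr C) \<Longrightarrow>
     \<forall>i<Suc n. mdist C (x ! i) (y ! i) < \<delta> \<Longrightarrow> \<bar>ceval C \<phi> x - ceval C \<phi> y\<bar> \<le> \<epsilon>" by fastforce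
  show ?case
  proof (intro exI[of _ \<delta>] conjI ballI impI)
    fix x y assume xy: "x \<in> tuples n (mcarr C)" "y \<in> tuples n (mcarr C)" "\<forall>i<n. mdist C (x ! i) (y ! i) < \<delta>"
    have "\<bar>ceval C \<phi> (a # x) - ceval C \<phi> (a # y)\<bar> \<le> \<epsilon>" if "a \<in> mcarr C" for a
      using that xy \<delta>(1) by (intro \<delta>(2)) (auto simp: nth_Cons dist_self split: nat.split)
    then show "\<bar>ceval C (CSup \<phi>) x - ceval C (CSup \<phi>) y\<bar> \<le> \<epsilon>"
      unfolding ceval.simps using xy CSup.prems(1)
      by (intro abs_SUP_close_le ne ceval01[of \<phi> "Suc n"]) auto
  qed (rule \<delta>(1))
next
  case (CInf \<phi>)
  then obtain \<delta> where \<delta>: "0 < \<delta>" "\<And>x y. x\<in>tuples (Suc n) (mcarr C) \<Longrightarrow> y\<in>tuples (Suc n) (mcarr C) \<Longrightarrow>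
     \<forall>i<Suc n. mdist C (x ! i) (y ! i) < \<delta> \<Longrightarrow> \<bar>ceval C \<phi> x - ceval C \<phi> y\<bar> \<le> \<epsilon>" by fastforce
  show ?case
  proof (intro exI[of _ \<delta>] conjI ballI impI)
    fix x y assume xy: "x \<in> tuples n (mcarr C)" "y \<in> tuples n (mcarr C)" "\<forall>i<n. mdist C (x ! i) (y ! i) < \<delta>"
    have "\<bar>ceval C \<phi> (a # x) - ceval C \<phi> (a # y)\<bar> \<le> \<epsilon>" if "a \<in> mcarr C" for a
      using that xy \<delta>(1) by (intro \<delta>(2)) (auto simp: nth_Cons dist_self split: nat.split)
    then show "\<bar>ceval C (CInf \<phi>) x - ceval C (CInf \<phi>) y\<bar> \<le> \<epsilon>"
      unfolding ceval.simps using xy CInf.prems(1)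
      by (intro abs_INF_close_le ne ceval01[of \<phi> "Suc n"]) auto
  qed (rule \<delta>(1))
qed

end

section \<open>Approximation by simple random elements\<close>

locale rand_in = random_elements \<Omega> L U + cstructure "LR L" C
  for \<Omega> :: "'w measure" and L :: "('f, 'r) lang" and U :: "('u, 'f, 'r) struct"
    and C :: "('c, ('f, 'r) fm) mstruct" +
  fixes \<iota> :: "(nat \<Rightarrow> 'w \<Rightarrow> 'u) \<Rightarrow> 'c"
  assumes emb: "celem_embedding (LR L) (randomization U \<Omega>) C \<iota>"
begin

abbreviation R :: "'u set \<Rightarrow> ('w \<Rightarrow> 'u) set" where "R X \<equiv> mcarr (rand0 (sub U X) \<Omega>)"
abbreviation RR :: "'u set \<Rightarrow> (nat \<Rightarrow> 'w \<Rightarrow> 'u, ('f, 'r) fm) mstruct" where "RR X \<equiv> randomization (sub U X) \<Omega>"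
abbreviation E :: "('w \<Rightarrow> 'u) \<Rightarrow> 'c" where "E \<equiv> emb0 \<iota>"

text \<open>The admissible ranges of random elements: \<open>U\<close> itself and its submodel \<open>M\<close>, whose
  randomizations are elementary in \<open>C\<close>. Treating both at once, \<open>R X\<close> is the set of simple random
  elements with values in \<open>X\<close>, \<open>RR X\<close> is the completed randomization and \<open>E\<close> embeds
  simple elements into \<open>C\<close>.\<close>

definition elem_range :: "'u set \<Rightarrow> bool" where
  "elem_range X \<longleftrightarrow> X \<noteq> {} \<and> X \<subseteq> carr U \<and> celem_embedding (LR L) (RR X) C \<iota>"

lemma sub_carr: "sub U (carr U) = U" by simp

lemma elem_range_U: "elem_range (carr U)"
  using carr_ne emb by (simp add: elem_range_def sub_carr)

lemma R_iff: "f \<in> R X \<longleftrightarrow> simple_function \<Omega> f \<and> f ` space \<Omega> \<subseteq> X"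
  by (simp add: rand0_def)

lemma R_U: "mcarr (rand0 U \<Omega>) = R0" by (simp add: R0_def)

lemma R_mono: "X \<subseteq> Y \<Longrightarrow> R X \<subseteq> R Y" by (fastforce simp: R_iff)

lemma R_R0: "X \<subseteq> carr U \<Longrightarrow> R X \<subseteq> R0" using R_mono[of X "carr U"] by (simp add: R_U)

lemma elem_range_tuples: "elem_range X \<Longrightarrow> h \<in> tuples n (R X) \<Longrightarrow> h \<in> tuples n R0"
  using tuples_mono[OF R_R0, of X n] by (auto simp: elem_range_def)

lemma const_R: "x \<in> X \<Longrightarrow> (\<lambda>_. x) \<in> R X" by (auto simp: R_iff)

abbreviation d0 where "d0 f g \<equiv> prob {\<omega>\<in>space \<Omega>. f \<omega> \<noteq> g \<omega>}"

lemma mcarr_RR: "F \<in> mcarr (RR X) \<longleftrightarrow> range F \<subseteq> R X \<and> (\<forall>\<epsilon>>0. \<exists>k. \<forall>m\<ge>k. \<forall>n\<ge>k. d0 (F m) (F n) < \<epsilon>)"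
  by (simp add: randomization_def completion_def) (simp add: rand0_def)

lemma mdist_RR: "mdist (RR X) F G = lim (\<lambda>n. d0 (F n) (G n))"
  by (simp add: randomization_def completion_def) (simp add: rand0_def)

lemma mpred_RR: "mpred (RR X) \<phi> Fs = lim (\<lambda>n. prob {\<omega>\<in>space \<Omega>. sat (sub U X) \<phi> (vals (map (\<lambda>F. F n) Fs) \<omega>)})"
  by (simp add: randomization_def completion_def) (simp add: rand0_def)

lemma const_RR: "f \<in> R X \<Longrightarrow> (\<lambda>_. f) \<in> mcarr (RR X)"
  by (auto simp: mcarr_RR)

lemma consts_RR: "h \<in> tuples n (R X) \<Longrightarrow> map (\<lambda>f _. f) h \<in> tuples n (mcarr (RR X))"
  unfolding tuples_def using const_RR[of _ X] by fastforce

lemma map_E: "map E h = map \<iota> (map (\<lambda>f _. f) h)"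
  by (simp add: emb0_def)

lemma elem_range_ceval: "elem_range X \<Longrightarrow> cwf (LR L) \<phi> n \<Longrightarrow> e \<in> tuples n (mcarr (RR X)) \<Longrightarrow> ceval C \<phi> (map \<iota> e) = ceval (RR X) \<phi> e"
  unfolding elem_range_def celem_embedding_def by blast

lemma elem_range_mcarr: "elem_range X \<Longrightarrow> F \<in> mcarr (RR X) \<Longrightarrow> \<iota> F \<in> mcarr C"
  unfolding elem_range_def celem_embedding_def by blast

lemma E_mcarr: "f \<in> R0 \<Longrightarrow> E f \<in> mcarr C"
  using elem_range_mcarr[OF elem_range_U const_RR, of f] by (simp add: R_U emb0_def)

lemma E_tuples: "h \<in> tuples n R0 \<Longrightarrow> map E h \<in> tuples n (mcarr C)"
  using E_mcarr by (auto simp: tuples_def)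

lemma cwf_pred: "wf_fm L n \<psi> \<Longrightarrow> cwf (LR L) (CPred \<psi> [0..<n]) n"
  by (auto simp: LR_def)

lemma ceval_pred: "length e = n \<Longrightarrow> ceval C' (CPred \<psi> [0..<n]) e = mpred C' \<psi> e"
  by (auto simp: map_nth)

lemma mpred_E:
  assumes "wf_fm L n \<psi>" "h \<in> tuples n R0" shows "mpred C \<psi> (map E h) = pr (sat U \<psi>) h"
proof -
  have l: "length h = n" using assms(2) by (simp add: tuplesD)
  have "mpred C \<psi> (map E h) = ceval C (CPred \<psi> [0..<n]) (map \<iota> (map (\<lambda>f _. f) h))"
    unfolding map_E using l by (simp only: ceval_pred length_map)
  also have "\<dots> = ceval (RR (carr U)) (CPred \<psi> [0..<n]) (map (\<lambda>f _. f) h)"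
    using elem_range_ceval[OF elem_range_U cwf_pred[OF assms(1)] consts_RR] assms(2) by (simp add: R_U)
  also have "\<dots> = mpred (RR (carr U)) \<psi> (map (\<lambda>f _. f) h)"
    using l by (simp only: ceval_pred length_map)
  also have "\<dots> = pr (sat U \<psi>) h"
    unfolding mpred_RR unfolding map_map comp_def sub_carr by (simp add: pr_def)
  finally show ?thesis .
qed

lemma mdist_RR_C:
  assumes "elem_range X" "F \<in> mcarr (RR X)" "G \<in> mcarr (RR X)"
  shows "mdist C (\<iota> F) (\<iota> G) = lim (\<lambda>n. d0 (F n) (G n))"
proof -
  have "ceval C (CDist 0 1) (map \<iota> [F, G]) = ceval (RR X) (CDist 0 1) [F, G]"
    using assms by (intro elem_range_ceval[where n=2]) (auto simp: tuples_def)
  then show ?thesis by (simp add: mdist_RR)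
qed

lemma mdist_E:
  assumes "f \<in> R0" "g \<in> R0" shows "mdist C (E f) (E g) = d0 f g"
  using mdist_RR_C[OF elem_range_U const_RR const_RR, of f g] assms by (simp add: R_U emb0_def)

lemma d0_triangle:
  assumes "f \<in> R X" "g \<in> R X" "h \<in> R X"
  shows "d0 f h \<le> d0 f g + d0 g h"
proof -
  have s: "{\<omega>\<in>space \<Omega>. f \<omega> \<noteq> g \<omega>} \<in> sets \<Omega>" if "f \<in> R X" "g \<in> R X" for f g
  proof -
    have "simple_function \<Omega> (\<lambda>\<omega>. (f \<omega>, g \<omega>))" using that by (auto simp: R_iff)
    from simple_Collect[OF this, of "\<lambda>(x, y). x \<noteq> y"] show ?thesis by simp
  qed
  have "d0 f h \<le> prob ({\<omega>\<in>space \<Omega>. f \<omega> \<noteq> g \<omega>} \<union> {\<omega>\<in>space \<Omega>. g \<omega> \<noteq> h \<omega>})"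
    using s assms by (intro finite_measure_mono) auto
  also have "\<dots> \<le> d0 f g + d0 g h" using s assms by (intro measure_Un_le) auto
  finally show ?thesis .
qed

text \<open>A Cauchy sequence is approximated by its own members.\<close>

lemma dense:
  assumes X: "elem_range X" and F: "F \<in> mcarr (RR X)" and \<delta>: "0 < (\<delta>::real)"
  shows "\<exists>f\<in>R X. mdist C (\<iota> F) (E f) < \<delta>"
proof -
  have FR: "F n \<in> R X" for n using F by (auto simp: mcarr_RR)
  obtain k where k: "\<And>m n. m \<ge> k \<Longrightarrow> n \<ge> k \<Longrightarrow> d0 (F m) (F n) < \<delta> / 2"
    using F \<delta> unfolding mcarr_RR by (meson half_gt_zero)
  have Ek: "mdist C (\<iota> F) (E (F k)) = lim (\<lambda>n. d0 (F n) (F k))"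
    unfolding emb0_def using mdist_RR_C[OF X F const_RR[OF FR]] by simp
  have "Cauchy (\<lambda>n. d0 (F n) (F k))"
  proof (rule metric_CauchyI)
    fix e :: real assume "0 < e"
    then obtain m where m: "\<And>i j. i \<ge> m \<Longrightarrow> j \<ge> m \<Longrightarrow> d0 (F i) (F j) < e"
      using F unfolding mcarr_RR by meson
    have "dist (d0 (F i) (F k)) (d0 (F j) (F k)) < e" if "i \<ge> m" "j \<ge> m" for i j
      using d0_triangle[OF FR[of i] FR[of j] FR[of k]] d0_triangle[OF FR[of j] FR[of i] FR[of k]]
        m[OF that] m[OF that(2,1)] by (simp add: dist_real_def abs_less_iff)
    then show "\<exists>M. \<forall>m\<ge>M. \<forall>n\<ge>M. dist (d0 (F m) (F k)) (d0 (F n) (F k)) < e" by blast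
  qed
  then have "(\<lambda>n. d0 (F n) (F k)) \<longlonglongrightarrow> lim (\<lambda>n. d0 (F n) (F k))"
    by (simp add: Cauchy_convergent_iff convergent_LIMSEQ_iff)
  moreover have "\<exists>N. \<forall>n\<ge>N. d0 (F n) (F k) \<le> \<delta> / 2" using k[of _ k] by (intro exI[of _ k]) (simp add: less_imp_le)
  ultimately have "lim (\<lambda>n. d0 (F n) (F k)) \<le> \<delta> / 2" by (rule LIMSEQ_le_const2)
  then show ?thesis using Ek \<delta> FR by (intro bexI[of _ "F k"]) auto
qed

lemma dense_tuple:
  assumes "elem_range X" "H \<in> tuples n (mcarr (RR X))" "0 < (\<delta>::real)"
  shows "\<exists>h\<in>tuples n (R X). \<forall>i<n. mdist C (map \<iota> H ! i) (map E h ! i) < \<delta>"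
  using assms(2)
proof (induction n arbitrary: H)
  case (Suc n)
  obtain F H' where H: "H = F # H'" "F \<in> mcarr (RR X)" "H' \<in> tuples n (mcarr (RR X))"
    using Suc.prems by (rule tuples_SucE)
  obtain f where f: "f \<in> R X" "mdist C (\<iota> F) (E f) < \<delta>" using dense[OF assms(1) H(2) assms(3)] by auto
  obtain h where h: "h \<in> tuples n (R X)" "\<forall>i<n. mdist C (map \<iota> H' ! i) (map E h ! i) < \<delta>"
    using Suc.IH[OF H(3)] by auto
  show ?case
    by (intro bexI[of _ "f # h"]) (use f h H(1) in \<open>auto simp: nth_Cons split: nat.split\<close>)
qed simp

lemma funpow_CInf_wf: "cwf S \<psi> (k + m) \<Longrightarrow> cwf S ((CInf ^^ k) \<psi>) m"
proof (induction k arbitrary: m)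
  case (Suc k)
  have "cwf S ((CInf ^^ k) \<psi>) (Suc m)" using Suc by simp
  then show ?case by simp
qed simp

lemma funpow_CInf_le:
  assumes "cwf (LR L) \<psi> (k + m)" "e \<in> tuples k (mcarr C)" "c \<in> tuples m (mcarr C)"
  shows "ceval C ((CInf ^^ k) \<psi>) c \<le> ceval C \<psi> (e @ c)"
  using assms
proof (induction k arbitrary: \<psi> e)
  case (Suc k)
  then obtain a e' where e: "e = a # e'" "a \<in> mcarr C" "e' \<in> tuples k (mcarr C)" by (auto elim: tuples_SucE)
  have 1: "e' @ c \<in> tuples (k + m) (mcarr C)" using tuples_append[OF e(3) Suc.prems(3)] .
  have "ceval C ((CInf ^^ Suc k) \<psi>) c = ceval C ((CInf ^^ k) (CInf \<psi>)) c" by (simp only: funpow_Suc_right comp_def)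
  also have "\<dots> \<le> ceval C (CInf \<psi>) (e' @ c)" using Suc e by (intro Suc.IH) simp_all
  also have "\<dots> \<le> ceval C \<psi> (a # e' @ c)"
    using Suc.prems(1) 1 ceval01[of \<psi> "Suc (k + m)" "_ # e' @ c"]
    by (simp, intro cINF_lower[OF _ e(2)] bdd_belowI[of _ 0]) auto
  finally show ?case using e(1) by simp
qed simp

text \<open>An iterated infimum is approximately attained in any elementary substructure; this is how
  elementarity produces tuples.\<close>

lemma funpow_CInf_witness:
  assumes X: "elem_range X" and "cwf (LR L) \<psi> (k + m)" "c \<in> tuples m (mcarr (RR X))"
    and "ceval (RR X) ((CInf ^^ k) \<psi>) c < \<eta>"
  shows "\<exists>h\<in>tuples k (mcarr (RR X)). ceval (RR X) \<psi> (h @ c) < \<eta>"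
  using assms(2-4)
proof (induction k arbitrary: \<psi>)
  case (Suc k)
  have "ceval (RR X) ((CInf ^^ k) (CInf \<psi>)) c < \<eta>"
    using Suc.prems(3) by (simp only: funpow_Suc_right comp_def)
  then obtain h where h: "h\<in>tuples k (mcarr (RR X))" "ceval (RR X) (CInf \<psi>) (h @ c) < \<eta>"
    using Suc.IH[of "CInf \<psi>"] Suc.prems by auto
  have ne: "mcarr (RR X) \<noteq> {}" using X const_R[THEN const_RR] by (auto simp: elem_range_def)
  have "ceval (RR X) \<psi> (F # h @ c) \<in> {0..1}" if F: "F \<in> mcarr (RR X)" for F
  proof -
    have t: "F # h @ c \<in> tuples (Suc (k + m)) (mcarr (RR X))" using F tuples_append[OF h(1) Suc.prems(2)] by simp
    have "map \<iota> (F # h @ c) \<in> tuples (Suc (k + m)) (mcarr C)"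
      using t elem_range_mcarr[OF X] by (auto simp: tuples_def)
    then have "ceval C \<psi> (map \<iota> (F # h @ c)) \<in> {0..1}" using Suc.prems(1) by (intro ceval01) auto
    then show ?thesis using elem_range_ceval[OF X _ t, of \<psi>] Suc.prems(1) by simp
  qed
  then have "bdd_below ((\<lambda>F. ceval (RR X) \<psi> (F # h @ c)) ` mcarr (RR X))" by (intro bdd_belowI[of _ 0]) auto
  then obtain F where "F \<in> mcarr (RR X)" "ceval (RR X) \<psi> (F # h @ c) < \<eta>"
    using h(2) cINF_less_iff[OF ne] by auto
  then show ?case using h(1) by (intro bexI[of _ "F # h"]) auto
qed simp

text \<open>A formula measuring how far the values of given formulas are from given reals. The
  truncation at 1 makes it a connective with values in the unit interval.\<close>

definition deviation :: "(('f, 'r) fm cfm \<times> real) list \<Rightarrow> ('f, 'r) fm cfm" where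
  "deviation \<Phi> = CConn (\<lambda>v. min 1 (\<Sum>i<length \<Phi>. \<bar>v i - snd (\<Phi> ! i)\<bar>)) (map fst \<Phi>)"

lemma deviation_wf: "(\<And>\<phi> r. (\<phi>, r) \<in> set \<Phi> \<Longrightarrow> cwf (LR L) \<phi> n) \<Longrightarrow> cwf (LR L) (deviation \<Phi>) n"
  unfolding deviation_def cwf.simps
  by (intro conjI continuous_intros continuous_on_subset[OF continuous_on_product_coordinates])
    (auto simp: list_all_iff intro!: sum_nonneg)

lemma deviation_eval: "ceval A (deviation \<Phi>) e = min 1 (\<Sum>i<length \<Phi>. \<bar>ceval A (fst (\<Phi> ! i)) e - snd (\<Phi> ! i)\<bar>)"
proof -
  have "(\<Sum>i<length \<Phi>. \<bar>(if i < length (map fst \<Phi>) then map (\<lambda>\<phi>. ceval A \<phi> e) (map fst \<Phi>) ! i else 0) - snd (\<Phi> ! i)\<bar>)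
     = (\<Sum>i<length \<Phi>. \<bar>ceval A (fst (\<Phi> ! i)) e - snd (\<Phi> ! i)\<bar>)"
    by (intro sum.cong) auto
  then show ?thesis unfolding deviation_def ceval.simps by simp
qed

lemma deviation_less:
  assumes "ceval A (deviation \<Phi>) e < \<eta>" "\<eta> \<le> 1" "(\<phi>, r) \<in> set \<Phi>"
  shows "\<bar>ceval A \<phi> e - r\<bar> < \<eta>"
proof -
  obtain i where i: "i < length \<Phi>" "\<Phi> ! i = (\<phi>, r)" using assms(3) by (auto simp: in_set_conv_nth)
  have "(\<Sum>i<length \<Phi>. \<bar>ceval A (fst (\<Phi> ! i)) e - snd (\<Phi> ! i)\<bar>) < \<eta>"
    using assms(1,2) by (auto simp: deviation_eval min_def split: if_splits)
  moreover have "\<bar>ceval A (fst (\<Phi> ! i)) e - snd (\<Phi> ! i)\<bar> \<le> (\<Sum>i<length \<Phi>. \<bar>ceval A (fst (\<Phi> ! i)) e - snd (\<Phi> ! i)\<bar>)"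
    using i(1) by (intro member_le_sum) auto
  ultimately show ?thesis using i(2) by simp
qed

text \<open>The iterated infimum of the deviation from the values at \<open>e\<close> is zero in \<open>C\<close>,
  hence zero in the randomization, so some tuple of the randomization has small deviation; by density
  and uniform continuity it may be taken simple.\<close>

lemma approximation:
  assumes X: "elem_range X" and e: "e \<in> tuples k (mcarr C)" and c: "c \<in> tuples m (R X)"
    and \<Phi>: "finite \<Phi>" "\<And>\<phi>. \<phi> \<in> \<Phi> \<Longrightarrow> cwf (LR L) \<phi> (k + m)" and \<epsilon>: "0 < (\<epsilon>::real)"
  shows "\<exists>h\<in>tuples k (R X). \<forall>\<phi>\<in>\<Phi>. \<bar>ceval C \<phi> (map E h @ map E c) - ceval C \<phi> (e @ map E c)\<bar> < \<epsilon>"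
proof -
  let ?c = "map (\<lambda>f _. f) c" and ?B = "RR X"
  have c0: "c \<in> tuples m R0" using elem_range_tuples[OF X c] .
  have cB: "?c \<in> tuples m (mcarr ?B)" using consts_RR[OF c] .
  have cC: "map E c \<in> tuples m (mcarr C)" using E_tuples[OF c0] .
  obtain \<phi>s where \<phi>s: "set \<phi>s = \<Phi>" using finite_list[OF \<Phi>(1)] by auto
  define dev where "dev = deviation (map (\<lambda>\<phi>. (\<phi>, ceval C \<phi> (e @ map E c))) \<phi>s)"
  have dev_wf: "cwf (LR L) dev (k + m)" unfolding dev_def using \<Phi>(2) \<phi>s by (intro deviation_wf) auto
  have "ceval C dev (e @ map E c) = 0" by (simp add: dev_def deviation_eval)
  then have "ceval C ((CInf ^^ k) dev) (map E c) \<le> 0" using funpow_CInf_le[OF dev_wf e cC] by simp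
  then have "ceval ?B ((CInf ^^ k) dev) ?c \<le> 0"
    using elem_range_ceval[OF X funpow_CInf_wf[OF dev_wf] cB] by (simp only: map_E)
  then have "ceval ?B ((CInf ^^ k) dev) ?c < min 1 (\<epsilon> / 2)" using \<epsilon> by (simp add: min_def)
  from funpow_CInf_witness[OF X dev_wf cB this]
  obtain H where H: "H\<in>tuples k (mcarr ?B)" "ceval ?B dev (H @ ?c) < min 1 (\<epsilon> / 2)" by auto
  then have "ceval C dev (map \<iota> H @ map E c) < min 1 (\<epsilon> / 2)"
    using elem_range_ceval[OF X dev_wf tuples_append[OF H(1) cB]] by (simp only: map_E map_append)
  then have dH: "\<bar>ceval C \<phi> (map \<iota> H @ map E c) - ceval C \<phi> (e @ map E c)\<bar> < min 1 (\<epsilon> / 2)" if "\<phi> \<in> \<Phi>" for \<phi>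
    unfolding dev_def by (rule deviation_less) (use that \<phi>s in auto)
  have "\<exists>\<delta>>0. \<forall>\<phi>\<in>\<Phi>. \<forall>x\<in>tuples (k + m) (mcarr C). \<forall>y\<in>tuples (k + m) (mcarr C).
     (\<forall>i<k + m. mdist C (x ! i) (y ! i) < \<delta>) \<longrightarrow> \<bar>ceval C \<phi> x - ceval C \<phi> y\<bar> \<le> \<epsilon> / 2"
  proof (rule finite_common_bound[OF \<Phi>(1)])
    fix \<phi> assume "\<phi> \<in> \<Phi>"
    then show "\<exists>\<delta>>0. \<forall>x\<in>tuples (k + m) (mcarr C). \<forall>y\<in>tuples (k + m) (mcarr C).
     (\<forall>i<k + m. mdist C (x ! i) (y ! i) < \<delta>) \<longrightarrow> \<bar>ceval C \<phi> x - ceval C \<phi> y\<bar> \<le> \<epsilon> / 2"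
      using ceval_uniform[OF \<Phi>(2), of \<phi> "\<epsilon> / 2"] \<epsilon> by simp
  qed (auto intro: less_le_trans)
  then obtain \<delta> where \<delta>: "0 < \<delta>" "\<And>\<phi> x y. \<phi> \<in> \<Phi> \<Longrightarrow> x\<in>tuples (k + m) (mcarr C) \<Longrightarrow> y\<in>tuples (k + m) (mcarr C) \<Longrightarrow>
     \<forall>i<k + m. mdist C (x ! i) (y ! i) < \<delta> \<Longrightarrow> \<bar>ceval C \<phi> x - ceval C \<phi> y\<bar> \<le> \<epsilon> / 2" by auto
  obtain h where h: "h\<in>tuples k (R X)" "\<forall>i<k. mdist C (map \<iota> H ! i) (map E h ! i) < \<delta>"
    using dense_tuple[OF X H(1) \<delta>(1)] by auto
  have h0: "h \<in> tuples k R0" using elem_range_tuples[OF X h(1)] .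
  have HC: "map \<iota> H \<in> tuples k (mcarr C)" using H(1) elem_range_mcarr[OF X] by (auto simp: tuples_def)
  have near: "\<forall>i<k + m. mdist C ((map \<iota> H @ map E c) ! i) ((map E h @ map E c) ! i) < \<delta>"
  proof (intro allI impI)
    fix i assume i: "i < k + m"
    show "mdist C ((map \<iota> H @ map E c) ! i) ((map E h @ map E c) ! i) < \<delta>"
    proof (cases "i < k")
      case True
      then show ?thesis using h H(1) by (simp add: nth_append tuplesD)
    next
      case False
      then have "map E c ! (i - k) \<in> mcarr C" using i by (intro nth_tuples[OF cC]) simp
      then show ?thesis using False \<delta>(1) tuplesD(1)[OF h(1)] tuplesD(1)[OF H(1)] by (simp add: nth_append dist_self)
    qed
  qed
  show ?thesis
  proof (intro bexI[OF _ h(1)] ballI)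
    fix \<phi> assume \<phi>: "\<phi> \<in> \<Phi>"
    have "\<bar>ceval C \<phi> (map \<iota> H @ map E c) - ceval C \<phi> (map E h @ map E c)\<bar> \<le> \<epsilon> / 2"
      by (rule \<delta>(2)[OF \<phi> tuples_append[OF HC cC] tuples_append[OF E_tuples[OF h0] cC] near])
    then show "\<bar>ceval C \<phi> (map E h @ map E c) - ceval C \<phi> (e @ map E c)\<bar> < \<epsilon>"
      using dH[OF \<phi>] by linarith
  qed
qed

end

lemma ex_positions:
  "\<exists>pos. \<forall>c. set c \<subseteq> set zs \<longrightarrow> set (pos c) \<subseteq> {..<length zs} \<and> map ((!) zs) (pos c) = c \<and> length (pos c) = length c"
proof -
  define loc where "loc x = (SOME i. i < length zs \<and> zs ! i = x)" for x
  have loc: "loc x < length zs \<and> zs ! loc x = x" if "x \<in> set zs" for x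
    unfolding loc_def by (rule someI_ex) (use that in \<open>auto simp: in_set_conv_nth\<close>)
  show ?thesis
    by (intro exI[of _ "map loc"]) (use loc in \<open>auto intro!: map_idI\<close>)
qed

context rand_in
begin

text \<open>Here each condition has its own parameters \<open>c\<close> and its own selection \<open>js\<close> of entries
  of the tuple. All parameters are collected in one list \<open>zs\<close>, and predicate symbols are applied to
  the appropriate index lists.\<close>

lemma approximate_pr:
  assumes X: "elem_range X" and e: "e \<in> tuples n (mcarr C)" and \<epsilon>: "0 < (\<epsilon>::real)"
    and Q: "finite Q" "\<And>\<psi> js c. (\<psi>, js, c) \<in> Q \<Longrightarrow>
      set js \<subseteq> {..<n} \<and> set c \<subseteq> R X \<and> wf_fm L (length js + length c) \<psi>"
  shows "\<exists>h\<in>tuples n (R X). \<forall>(\<psi>, js, c)\<in>Q.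
    \<bar>pr (sat U \<psi>) (map ((!) h) js @ c) - mpred C \<psi> (map ((!) e) js @ map E c)\<bar> < \<epsilon>"
proof -
  have "finite (\<Union>(\<psi>, js, c)\<in>Q. set c)" using Q(1) by auto
  then obtain zs where zs: "set zs = (\<Union>(\<psi>, js, c)\<in>Q. set c)" using finite_list by metis
  have zsR: "zs \<in> tuples (length zs) (R X)" using zs Q(2) by (intro tuplesI refl) fastforce
  obtain pos where pos': "\<And>c. set c \<subseteq> set zs \<Longrightarrow> set (pos c) \<subseteq> {..<length zs} \<and>
    map ((!) zs) (pos c) = c \<and> length (pos c) = length c"
    using ex_positions[of zs] by blast
  have pos: "set (pos c) \<subseteq> {..<length zs}" "map ((!) zs) (pos c) = c" "length (pos c) = length c"
    if "(\<psi>, js, c) \<in> Q" for \<psi> js c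
    using pos'[of c] that unfolding zs by blast+
  define pred_at where "pred_at \<psi> js c = CPred \<psi> (js @ map ((+) n) (pos c))" for \<psi> :: "('f, 'r) fm" and js c
  have at_eval: "ceval C (pred_at \<psi> js c) (d @ map E zs) = mpred C \<psi> (map ((!) d) js @ map E c)"
    if Qc: "(\<psi>, js, c) \<in> Q" and d: "d \<in> tuples n (mcarr C)" for \<psi> js c d
  proof -
    have l: "length d = n" using d by (simp add: tuplesD)
    have "map ((!) (d @ map E zs)) (map ((+) n) (pos c)) = map E (map ((!) zs) (pos c))"
      using pos(1)[OF Qc] l by (auto simp: nth_append)
    moreover have "map ((!) (d @ map E zs)) js = map ((!) d) js"
      using l Q(2)[OF Qc] by (auto simp: nth_append)
    ultimately show ?thesis
      unfolding pred_at_def ceval.simps map_append using pos(2)[OF Qc] by (simp only:)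
  qed
  define F where "F = (\<lambda>(\<psi>, js, c). pred_at \<psi> js c) ` Q"
  have wf: "cwf (LR L) \<phi> (n + length zs)" if "\<phi> \<in> F" for \<phi>
  proof -
    obtain \<psi> js c where Qc: "(\<psi>, js, c) \<in> Q" "\<phi> = pred_at \<psi> js c" using \<open>\<phi> \<in> F\<close> by (auto simp: F_def)
    then show ?thesis using Q(2)[OF Qc(1)] pos(1)[OF Qc(1)]
      pos(3)[OF Qc(1)]
      by (auto simp: pred_at_def LR_def trans_less_add1)
  qed
  have "finite F" using Q(1) by (simp add: F_def)
  from approximation[OF X e zsR this wf \<epsilon>] obtain h where h: "h\<in>tuples n (R X)"
    "\<forall>\<phi>\<in>F. \<bar>ceval C \<phi> (map E h @ map E zs) - ceval C \<phi> (e @ map E zs)\<bar> < \<epsilon>" by auto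
  have h0: "h \<in> tuples n R0" using elem_range_tuples[OF X h(1)] .
  show ?thesis
  proof (intro bexI[OF _ h(1)] ballI, clarify)
    fix \<psi> js c assume Qc: "(\<psi>, js, c) \<in> Q"
    then have c: "c \<in> tuples (length c) R0" using Q(2)[OF Qc] by (intro elem_range_tuples[OF X] tuplesI) auto
    have js: "map ((!) h) js \<in> tuples (length js) R0" using Q(2)[OF Qc] by (intro select_tuples[OF h0]) auto
    have "mpred C \<psi> (map E (map ((!) h) js @ c)) = pr (sat U \<psi>) (map ((!) h) js @ c)"
      using Q(2)[OF Qc] tuples_append[OF js c] by (intro mpred_E) auto
    moreover have "map ((!) (map E h)) js = map E (map ((!) h) js)"
      using Q(2)[OF Qc] tuplesD(1)[OF h0] by auto
    ultimately have "ceval C (pred_at \<psi> js c) (map E h @ map E zs) = pr (sat U \<psi>) (map ((!) h) js @ c)"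
      using at_eval[OF Qc E_tuples[OF h0]] by (simp only: map_append)
    moreover have "pred_at \<psi> js c \<in> F" using Qc by (force simp: F_def)
    ultimately show "\<bar>pr (sat U \<psi>) (map ((!) h) js @ c) - mpred C \<psi> (map ((!) e) js @ map E c)\<bar> < \<epsilon>"
      using h(2) at_eval[OF Qc e] by fastforce
  qed
qed

lemma map_nth_id: "e \<in> tuples n A \<Longrightarrow> map ((!) e) [0..<n] = e"
  using map_nth[of e] by (simp add: tuplesD)

lemma approximate_pr_tuple:
  assumes X: "elem_range X" and e: "e \<in> tuples n (mcarr C)" and \<epsilon>: "0 < (\<epsilon>::real)"
    and Q: "finite Q" "\<And>\<psi> c. (\<psi>, c) \<in> Q \<Longrightarrow> set c \<subseteq> R X \<and> wf_fm L (n + length c) \<psi>"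
  shows "\<exists>h\<in>tuples n (R X). \<forall>(\<psi>, c)\<in>Q. \<bar>pr (sat U \<psi>) (h @ c) - mpred C \<psi> (e @ map E c)\<bar> < \<epsilon>"
proof -
  have "\<exists>h\<in>tuples n (R X). \<forall>(\<psi>, js, c)\<in>(\<lambda>(\<psi>, c). (\<psi>, [0..<n], c)) ` Q.
    \<bar>pr (sat U \<psi>) (map ((!) h) js @ c) - mpred C \<psi> (map ((!) e) js @ map E c)\<bar> < \<epsilon>"
    using Q by (intro approximate_pr[OF X e \<epsilon>]) auto
  then show ?thesis using map_nth_id[OF e] map_nth_id by (force split: prod.splits)
qed

text \<open>A witness \<open>a\<close> in \<open>C\<close> over \<open>e\<close> is first replaced by a simple
  random element, at the cost of \<open>\<eta>\<close>; back and forth then yields a matching one over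
  \<open>e'\<close>.\<close>

lemma quantifier_step:
  assumes \<phi>: "cwf (LR L) \<phi> (Suc n)" and \<epsilon>: "0 < (\<epsilon>::real)"
    and IH: "\<exists>\<Psi> \<delta>. finite \<Psi> \<and> (\<forall>D\<in>\<Psi>. definable L U {} (Suc n) D) \<and> 0 < (\<delta>::real) \<and>
    (\<forall>e\<in>tuples (Suc n) R0. \<forall>e'\<in>tuples (Suc n) R0. (\<forall>D\<in>\<Psi>. \<bar>pr D e - pr D e'\<bar> < \<delta>) \<longrightarrow>
      \<bar>ceval C \<phi> (map E e) - ceval C \<phi> (map E e')\<bar> \<le> \<epsilon>)"
  shows "\<exists>\<Psi> \<delta>. finite \<Psi> \<and> (\<forall>D\<in>\<Psi>. definable L U {} n D) \<and> 0 < (\<delta>::real) \<and>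
    (\<forall>e\<in>tuples n R0. \<forall>e'\<in>tuples n R0. (\<forall>D\<in>\<Psi>. \<bar>pr D e - pr D e'\<bar> < \<delta>) \<longrightarrow>
      (\<forall>a\<in>mcarr C. \<forall>\<eta>>0. \<exists>b\<in>mcarr C. \<bar>ceval C \<phi> (a # map E e) - ceval C \<phi> (b # map E e')\<bar> \<le> \<epsilon> + \<eta>))"
proof -
  obtain \<Psi> \<delta> where \<Psi>: "finite \<Psi>" "\<And>D. D \<in> \<Psi> \<Longrightarrow> definable L U {} (Suc n) D" "0 < (\<delta>::real)"
    "\<And>e e'. e\<in>tuples (Suc n) R0 \<Longrightarrow> e'\<in>tuples (Suc n) R0 \<Longrightarrow> \<forall>D\<in>\<Psi>. \<bar>pr D e - pr D e'\<bar> < \<delta> \<Longrightarrow>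
      \<bar>ceval C \<phi> (map E e) - ceval C \<phi> (map E e')\<bar> \<le> \<epsilon>"
    using IH by auto
  obtain \<Psi>' \<delta>' where \<Psi>': "finite \<Psi>'" "\<And>D. D \<in> \<Psi>' \<Longrightarrow> definable L U {} n D" "0 < (\<delta>'::real)"
    "\<And>e e' g. e \<in> tuples n R0 \<Longrightarrow> e' \<in> tuples n R0 \<Longrightarrow> \<forall>D\<in>\<Psi>'. \<bar>pr D e - pr D e'\<bar> < \<delta>' \<Longrightarrow> g \<in> R0 \<Longrightarrow>
      \<exists>g'\<in>R0. \<forall>D\<in>\<Psi>. \<bar>pr D (g # e) - pr D (g' # e')\<bar> < \<delta>"
    using back_and_forth[OF \<Psi>(1-3)] by auto
  have match: "\<exists>b\<in>mcarr C. \<bar>ceval C \<phi> (a # map E e) - ceval C \<phi> (b # map E e')\<bar> \<le> \<epsilon> + \<eta>"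
    if e: "e \<in> tuples n R0" "e' \<in> tuples n R0" "\<forall>D\<in>\<Psi>'. \<bar>pr D e - pr D e'\<bar> < \<delta>'"
      and a: "a \<in> mcarr C" and \<eta>: "0 < \<eta>" for e e' a \<eta>
  proof -
    have "\<exists>h\<in>tuples 1 (R (carr U)). \<forall>\<phi>'\<in>{\<phi>}. \<bar>ceval C \<phi>' (map E h @ map E e) - ceval C \<phi>' ([a] @ map E e)\<bar> < \<eta>"
      using a e \<phi> \<eta> by (intro approximation[OF elem_range_U, where m=n]) (auto simp: R_U tuples_def)
    then obtain h where h: "h \<in> tuples (Suc 0) R0"
      "\<bar>ceval C \<phi> (map E h @ map E e) - ceval C \<phi> (a # map E e)\<bar> < \<eta>" by (auto simp: R_U)
    then obtain g where g: "g \<in> R0" "h = [g]" by (metis tuples_SucE tuples_0 singletonD)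
    obtain g' where g': "g' \<in> R0" "\<forall>D\<in>\<Psi>. \<bar>pr D (g # e) - pr D (g' # e')\<bar> < \<delta>"
      using \<Psi>'(4)[OF e g(1)] by auto
    have "\<bar>ceval C \<phi> (map E (g # e)) - ceval C \<phi> (map E (g' # e'))\<bar> \<le> \<epsilon>"
      using e g(1) g' by (intro \<Psi>(4)) simp_all
    then have "\<bar>ceval C \<phi> (a # map E e) - ceval C \<phi> (E g' # map E e')\<bar> \<le> \<epsilon> + \<eta>"
      using h(2) g(2) by (simp add: abs_le_iff abs_less_iff)
    then show ?thesis using E_mcarr[OF g'(1)] by blast
  qed
  show ?thesis
    using \<Psi>'(1-3) match by (intro exI[of _ \<Psi>'] exI[of _ \<delta>']) auto
qed

text \<open>By induction on \<open>\<phi>\<close>. Connectives are uniformly continuous, and quantifiers are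
  the previous lemma; the distance is the probability of an inequality.\<close>

lemma quantifier_elimination_simple:
  "cwf (LR L) \<phi> n \<Longrightarrow> 0 < (\<epsilon>::real) \<Longrightarrow> \<exists>\<Psi> \<delta>. finite \<Psi> \<and> (\<forall>D\<in>\<Psi>. definable L U {} n D) \<and> 0 < (\<delta>::real) \<and>
    (\<forall>e\<in>tuples n R0. \<forall>e'\<in>tuples n R0. (\<forall>D\<in>\<Psi>. \<bar>pr D e - pr D e'\<bar> < \<delta>) \<longrightarrow>
      \<bar>ceval C \<phi> (map E e) - ceval C \<phi> (map E e')\<bar> \<le> \<epsilon>)"
proof (induction \<phi> arbitrary: n \<epsilon>)
  case (CDist i j)
  define D where "D e \<longleftrightarrow> e ! i \<noteq> e ! j" for e :: "'u list"
  have ij: "i < n" "j < n" using CDist by auto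
  have "definable L U {} n D"
    using definable_neg[OF definable_sat[of L n "Eq (Var i) (Var j)"], of U "{}"] ij by (simp add: D_def[abs_def])
  moreover have "ceval C (CDist i j) (map E e) = pr D e" if e: "e \<in> tuples n R0" for e
    using ij tuplesD(1)[OF e] nth_tuples[OF e] by (simp add: mdist_E pr_def D_def)
  ultimately show ?case using CDist.prems(2)
    by (intro exI[of _ "{D}"] exI[of _ \<epsilon>]) simp
next
  case (CPred \<psi> js)
  define D where "D e \<longleftrightarrow> sat U \<psi> (map ((!) e) js)" for e
  have wf: "wf_fm L (length js) \<psi>" "set js \<subseteq> {..<n}" using CPred by (auto simp: LR_def)
  have "definable L U {} n D" unfolding D_def[abs_def] using definable_ren[OF definable_sat[OF wf(1)] wf(2)] by simp
  moreover have "ceval C (CPred \<psi> js) (map E e) = pr D e" if e: "e \<in> tuples n R0" for e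
  proof -
    have "map ((!) (map E e)) js = map E (map ((!) e) js)"
      using wf(2) tuplesD(1)[OF e] by auto
    then have "ceval C (CPred \<psi> js) (map E e) = mpred C \<psi> (map E (map ((!) e) js))"
      by (simp only: ceval.simps)
    also have "\<dots> = pr (sat U \<psi>) (map ((!) e) js)"
      using mpred_E[OF wf(1) select_tuples[OF e wf(2)]] .
    also have "\<dots> = pr D e"
      using wf(2) tuplesD(1)[OF e] by (intro pr_cong) (auto simp: D_def comp_def subset_iff intro!: arg_cong[where f="sat U \<psi>"])
    finally show ?thesis .
  qed
  ultimately show ?case using CPred.prems(2)
    by (intro exI[of _ "{D}"] exI[of _ \<epsilon>]) simp
next
  case (CConn u \<phi>s)
  let ?k = "length \<phi>s"
  have wf: "\<And>\<phi>. \<phi> \<in> set \<phi>s \<Longrightarrow> cwf (LR L) \<phi> n" using CConn.prems by (auto simp: list_all_iff)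
  have "continuous_on (cube ?k) u" using CConn.prems by simp
  from cube_uniform[OF this CConn.prems(2)] obtain \<eta> where \<eta>: "0 < \<eta>"
    "\<And>v w. v \<in> cube ?k \<Longrightarrow> w \<in> cube ?k \<Longrightarrow> \<forall>i<?k. \<bar>v i - w i\<bar> < \<eta> \<Longrightarrow> \<bar>u v - u w\<bar> < \<epsilon>"
    by auto
  define ok where "ok \<phi> \<Psi> \<delta> \<longleftrightarrow> finite \<Psi> \<and> (\<forall>D\<in>\<Psi>. definable L U {} n D) \<and> 0 < (\<delta>::real) \<and>
    (\<forall>e\<in>tuples n R0. \<forall>e'\<in>tuples n R0. (\<forall>D\<in>\<Psi>. \<bar>pr D e - pr D e'\<bar> < \<delta>) \<longrightarrow>
      \<bar>ceval C \<phi> (map E e) - ceval C \<phi> (map E e')\<bar> \<le> \<eta> / 2)" for \<phi> \<Psi> \<delta>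
  have "\<forall>\<phi>\<in>set \<phi>s. \<exists>\<Psi> \<delta>. ok \<phi> \<Psi> \<delta>"
    unfolding ok_def by (intro ballI CConn.IH wf) (use \<eta>(1) in simp_all)
  then obtain \<Psi> where "\<forall>\<phi>\<in>set \<phi>s. \<exists>\<delta>. ok \<phi> (\<Psi> \<phi>) \<delta>" by (auto dest!: bchoice)
  then obtain \<delta> where ok: "\<And>\<phi>. \<phi> \<in> set \<phi>s \<Longrightarrow> ok \<phi> (\<Psi> \<phi>) (\<delta> \<phi>)" by (auto dest!: bchoice)
  have "\<exists>d>0. \<forall>\<phi>\<in>set \<phi>s. d \<le> \<delta> \<phi>"
    using ok by (intro finite_common_bound) (auto simp: ok_def)
  then obtain d where d: "0 < d" "\<And>\<phi>. \<phi> \<in> set \<phi>s \<Longrightarrow> d \<le> \<delta> \<phi>" by auto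
  show ?case
  proof (intro exI[of _ "\<Union>\<phi>\<in>set \<phi>s. \<Psi> \<phi>"] exI[of _ d] conjI ballI impI)
    show "finite (\<Union>\<phi>\<in>set \<phi>s. \<Psi> \<phi>)" "\<And>D. D \<in> (\<Union>\<phi>\<in>set \<phi>s. \<Psi> \<phi>) \<Longrightarrow> definable L U {} n D"
      using ok by (auto simp: ok_def)
    fix e e' assume e: "e\<in>tuples n R0" "e'\<in>tuples n R0"
      and close: "\<forall>D\<in>(\<Union>\<phi>\<in>set \<phi>s. \<Psi> \<phi>). \<bar>pr D e - pr D e'\<bar> < d"
    have "\<bar>ceval C (\<phi>s ! i) (map E e) - ceval C (\<phi>s ! i) (map E e')\<bar> < \<eta>" if i: "i < ?k" for i
    proof -
      have \<phi>: "\<phi>s ! i \<in> set \<phi>s" using i by simp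
      have "\<bar>pr D e - pr D e'\<bar> < \<delta> (\<phi>s ! i)" if "D \<in> \<Psi> (\<phi>s ! i)" for D
        using close that \<phi> d(2)[OF \<phi>] by fastforce
      then have "\<bar>ceval C (\<phi>s ! i) (map E e) - ceval C (\<phi>s ! i) (map E e')\<bar> \<le> \<eta> / 2"
        using ok[OF \<phi>] e unfolding ok_def by blast
      then show ?thesis using \<eta>(1) by linarith
    qed
    then have c: "\<forall>i<?k. \<bar>(if i < ?k then map (\<lambda>\<phi>. ceval C \<phi> (map E e)) \<phi>s ! i else 0) -
        (if i < ?k then map (\<lambda>\<phi>. ceval C \<phi> (map E e')) \<phi>s ! i else 0)\<bar> < \<eta>" by simp
    have "\<bar>ceval C (CConn u \<phi>s) (map E e) - ceval C (CConn u \<phi>s) (map E e')\<bar> < \<epsilon>"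
      unfolding ceval.simps
      by (rule \<eta>(2)[OF _ _ c]) (intro conn_arg_cube ceval01[OF wf] E_tuples e; assumption)+
    then show "\<bar>ceval C (CConn u \<phi>s) (map E e) - ceval C (CConn u \<phi>s) (map E e')\<bar> \<le> \<epsilon>" by simp
  qed (rule d(1))
next
  case (CSup \<phi>)
  note case_prems = CSup.prems and case_IH = CSup.IH
  obtain \<Psi>' \<delta>' where \<Psi>': "finite \<Psi>'" "\<And>D. D \<in> \<Psi>' \<Longrightarrow> definable L U {} n D" "0 < (\<delta>'::real)"
    and match: "\<And>e e' a \<eta>. e\<in>tuples n R0 \<Longrightarrow> e'\<in>tuples n R0 \<Longrightarrow> \<forall>D\<in>\<Psi>'. \<bar>pr D e - pr D e'\<bar> < \<delta>' \<Longrightarrow>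
      a\<in>mcarr C \<Longrightarrow> 0 < \<eta> \<Longrightarrow> \<exists>b\<in>mcarr C. \<bar>ceval C \<phi> (a # map E e) - ceval C \<phi> (b # map E e')\<bar> \<le> \<epsilon> + \<eta>"
    using quantifier_step[of \<phi> n \<epsilon>] case_IH[of "Suc n" \<epsilon>] case_prems by auto
  show ?case
  proof (intro exI[of _ \<Psi>'] exI[of _ \<delta>'] conjI ballI impI)
    fix e e' assume e: "e\<in>tuples n R0" "e'\<in>tuples n R0" "\<forall>D\<in>\<Psi>'. \<bar>pr D e - pr D e'\<bar> < \<delta>'"
    then have e': "\<forall>D\<in>\<Psi>'. \<bar>pr D e' - pr D e\<bar> < \<delta>'" by (simp add: abs_minus_commute)
    show "\<bar>ceval C (CSup \<phi>) (map E e) - ceval C (CSup \<phi>) (map E e')\<bar> \<le> \<epsilon>"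
      unfolding ceval.simps
    proof (rule abs_SUP_diff_le[OF ne])
      fix a assume a: "a \<in> mcarr C"
      show "ceval C \<phi> (a # map E e) \<in> {0..1}" "ceval C \<phi> (a # map E e') \<in> {0..1}"
        using a case_prems E_tuples[OF e(1)] E_tuples[OF e(2)] by (auto intro!: ceval01[of \<phi> "Suc n"] simp del: atLeastAtMost_iff)
      fix \<eta> :: real assume \<eta>: "0 < \<eta>"
      obtain b where "b\<in>mcarr C" "\<bar>ceval C \<phi> (a # map E e) - ceval C \<phi> (b # map E e')\<bar> \<le> \<epsilon> + \<eta>"
        using match[OF e a \<eta>] by blast
      then show "\<exists>b\<in>mcarr C. ceval C \<phi> (a # map E e) \<le> ceval C \<phi> (b # map E e') + \<epsilon> + \<eta>"
        by (intro bexI[of _ b]) linarith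
      obtain b where "b\<in>mcarr C" "\<bar>ceval C \<phi> (a # map E e') - ceval C \<phi> (b # map E e)\<bar> \<le> \<epsilon> + \<eta>"
        using match[OF e(2,1) e' a \<eta>] by blast
      then show "\<exists>b\<in>mcarr C. ceval C \<phi> (a # map E e') \<le> ceval C \<phi> (b # map E e) + \<epsilon> + \<eta>"
        by (intro bexI[of _ b]) linarith
    qed
  qed (use \<Psi>' in auto)
next
  case (CInf \<phi>)
  note case_prems = CInf.prems and case_IH = CInf.IH
  obtain \<Psi>' \<delta>' where \<Psi>': "finite \<Psi>'" "\<And>D. D \<in> \<Psi>' \<Longrightarrow> definable L U {} n D" "0 < (\<delta>'::real)"
    and match: "\<And>e e' a \<eta>. e\<in>tuples n R0 \<Longrightarrow> e'\<in>tuples n R0 \<Longrightarrow> \<forall>D\<in>\<Psi>'. \<bar>pr D e - pr D e'\<bar> < \<delta>' \<Longrightarrow>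
      a\<in>mcarr C \<Longrightarrow> 0 < \<eta> \<Longrightarrow> \<exists>b\<in>mcarr C. \<bar>ceval C \<phi> (a # map E e) - ceval C \<phi> (b # map E e')\<bar> \<le> \<epsilon> + \<eta>"
    using quantifier_step[of \<phi> n \<epsilon>] case_IH[of "Suc n" \<epsilon>] case_prems by auto
  show ?case
  proof (intro exI[of _ \<Psi>'] exI[of _ \<delta>'] conjI ballI impI)
    fix e e' assume e: "e\<in>tuples n R0" "e'\<in>tuples n R0" "\<forall>D\<in>\<Psi>'. \<bar>pr D e - pr D e'\<bar> < \<delta>'"
    then have e': "\<forall>D\<in>\<Psi>'. \<bar>pr D e' - pr D e\<bar> < \<delta>'" by (simp add: abs_minus_commute)
    show "\<bar>ceval C (CInf \<phi>) (map E e) - ceval C (CInf \<phi>) (map E e')\<bar> \<le> \<epsilon>"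
      unfolding ceval.simps
    proof (rule abs_INF_diff_le[OF ne])
      fix a assume a: "a \<in> mcarr C"
      show "ceval C \<phi> (a # map E e) \<in> {0..1}" "ceval C \<phi> (a # map E e') \<in> {0..1}"
        using a case_prems E_tuples[OF e(1)] E_tuples[OF e(2)] by (auto intro!: ceval01[of \<phi> "Suc n"] simp del: atLeastAtMost_iff)
      fix \<eta> :: real assume \<eta>: "0 < \<eta>"
      obtain b where "b\<in>mcarr C" "\<bar>ceval C \<phi> (a # map E e) - ceval C \<phi> (b # map E e')\<bar> \<le> \<epsilon> + \<eta>"
        using match[OF e a \<eta>] by blast
      then show "\<exists>b\<in>mcarr C. ceval C \<phi> (b # map E e') \<le> ceval C \<phi> (a # map E e) + \<epsilon> + \<eta>"
        by (intro bexI[of _ b]) linarith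
      obtain b where "b\<in>mcarr C" "\<bar>ceval C \<phi> (a # map E e') - ceval C \<phi> (b # map E e)\<bar> \<le> \<epsilon> + \<eta>"
        using match[OF e(2,1) e' a \<eta>] by blast
      then show "\<exists>b\<in>mcarr C. ceval C \<phi> (b # map E e) \<le> ceval C \<phi> (a # map E e') + \<epsilon> + \<eta>"
        by (intro bexI[of _ b]) linarith
    qed
  qed (use \<Psi>' in auto)
qed

end

section \<open>Quantifier elimination and types in the monster model\<close>

context rand_in
begin

text \<open>Each of the two tuples of \<open>C\<close> is approximated by a simple one with respect to
  \<open>\<phi>\<close> and the finitely many probabilities that control it on simple tuples.\<close>

lemma quantifier_elimination:
  assumes \<phi>: "cwf (LR L) \<phi> n" and \<epsilon>: "0 < (\<epsilon>::real)"
  shows "\<exists>\<Psi> \<delta>. finite \<Psi> \<and> (\<forall>\<psi>\<in>\<Psi>. wf_fm L n \<psi>) \<and> 0 < (\<delta>::real) \<and>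
    (\<forall>e\<in>tuples n (mcarr C). \<forall>e'\<in>tuples n (mcarr C). (\<forall>\<psi>\<in>\<Psi>. \<bar>mpred C \<psi> e - mpred C \<psi> e'\<bar> < \<delta>) \<longrightarrow>
      \<bar>ceval C \<phi> e - ceval C \<phi> e'\<bar> \<le> \<epsilon>)"
proof -
  have "0 < \<epsilon> / 3" using \<epsilon> by simp
  from quantifier_elimination_simple[OF \<phi> this]
  obtain \<D> \<delta> where \<D>: "finite \<D>" "\<forall>D\<in>\<D>. definable L U {} n D" "0 < (\<delta>::real)"
    "\<And>e e'. e\<in>tuples n R0 \<Longrightarrow> e'\<in>tuples n R0 \<Longrightarrow> \<forall>D\<in>\<D>. \<bar>pr D e - pr D e'\<bar> < \<delta> \<Longrightarrow>
      \<bar>ceval C \<phi> (map E e) - ceval C \<phi> (map E e')\<bar> \<le> \<epsilon> / 3" by auto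
  have "\<forall>D\<in>\<D>. \<exists>\<psi>. wf_fm L n \<psi> \<and> (\<forall>e\<in>tuples n (carr U). D e \<longleftrightarrow> sat U \<psi> e)"
    using \<D>(2) by (metis definable_emptyE)
  from bchoice[OF this] obtain f where f: "\<And>D. D \<in> \<D> \<Longrightarrow> wf_fm L n (f D)"
    "\<And>D e. D \<in> \<D> \<Longrightarrow> e \<in> tuples n (carr U) \<Longrightarrow> D e \<longleftrightarrow> sat U (f D) e" by auto
  define F where "F = insert \<phi> ((\<lambda>D. CPred (f D) [0..<n]) ` \<D>)"
  have F: "finite F" "cwf (LR L) \<theta> (n + 0)" if "\<theta> \<in> F" for \<theta>
    using \<D>(1) \<phi> f(1) that cwf_pred by (auto simp: F_def simp del: cwf.simps)
  have finF: "finite F" using \<D>(1) by (simp add: F_def)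
  define \<eta> where "\<eta> = min (\<epsilon> / 3) (\<delta> / 3)"
  have \<eta>: "0 < \<eta>" using \<epsilon> \<D>(3) by (simp add: \<eta>_def)
  have ap: "\<exists>h\<in>tuples n R0. \<bar>ceval C \<phi> (map E h) - ceval C \<phi> e\<bar> < \<eta> \<and>
      (\<forall>D\<in>\<D>. \<bar>pr D h - mpred C (f D) e\<bar> < \<eta>)" if e: "e \<in> tuples n (mcarr C)" for e
  proof -
    have "[] \<in> tuples 0 (R (carr U))" by simp
    from approximation[OF elem_range_U e this finF F(2) \<eta>]
    obtain h where h: "h \<in> tuples n R0" "\<forall>\<theta>\<in>F. \<bar>ceval C \<theta> (map E h) - ceval C \<theta> e\<bar> < \<eta>"
      by (auto simp: R_U)
    have "pr D h = ceval C (CPred (f D) [0..<n]) (map E h)" if D: "D \<in> \<D>" for D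
    proof -
      have "pr D h = pr (sat U (f D)) h" using vals_tuples[OF h(1)] f(2)[OF D] by (intro pr_cong) blast
      also have "\<dots> = mpred C (f D) (map E h)" using mpred_E[OF f(1)[OF D] h(1)] by simp
      also have "\<dots> = ceval C (CPred (f D) [0..<n]) (map E h)"
        using tuplesD(1)[OF h(1)] by (simp only: ceval_pred length_map)
      finally show ?thesis .
    qed
    moreover have "ceval C (CPred (f D) [0..<n]) e = mpred C (f D) e" for D
      using tuplesD(1)[OF e] by (simp only: ceval_pred)
    ultimately show ?thesis
      using h by (intro bexI[of _ h]) (auto simp: F_def simp del: ceval.simps)
  qed
  have "\<bar>ceval C \<phi> e - ceval C \<phi> e'\<bar> \<le> \<epsilon>"
    if e: "e \<in> tuples n (mcarr C)" "e' \<in> tuples n (mcarr C)"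
      and close: "\<forall>\<psi>\<in>f ` \<D>. \<bar>mpred C \<psi> e - mpred C \<psi> e'\<bar> < \<delta> / 3" for e e'
  proof -
    obtain h where h: "h\<in>tuples n R0" "\<bar>ceval C \<phi> (map E h) - ceval C \<phi> e\<bar> < \<eta>"
      "\<forall>D\<in>\<D>. \<bar>pr D h - mpred C (f D) e\<bar> < \<eta>" using ap[OF e(1)] by auto
    obtain h' where h': "h'\<in>tuples n R0" "\<bar>ceval C \<phi> (map E h') - ceval C \<phi> e'\<bar> < \<eta>"
      "\<forall>D\<in>\<D>. \<bar>pr D h' - mpred C (f D) e'\<bar> < \<eta>" using ap[OF e(2)] by auto
    have \<eta>le: "\<eta> \<le> \<epsilon> / 3" "\<eta> \<le> \<delta> / 3" by (auto simp: \<eta>_def)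
    have "\<bar>pr D h - pr D h'\<bar> < \<delta>" if D: "D \<in> \<D>" for D
    proof -
      have "\<bar>pr D h - mpred C (f D) e\<bar> < \<eta>" "\<bar>pr D h' - mpred C (f D) e'\<bar> < \<eta>"
        "\<bar>mpred C (f D) e - mpred C (f D) e'\<bar> < \<delta> / 3"
        using h(3) h'(3) close D by auto
      then show ?thesis using \<eta>le(2) by linarith
    qed
    then have "\<bar>ceval C \<phi> (map E h) - ceval C \<phi> (map E h')\<bar> \<le> \<epsilon> / 3"
      using \<D>(4)[OF h(1) h'(1)] by blast
    then show ?thesis using h(2) h'(2) \<eta>le(1) by linarith
  qed
  then show ?thesis
    using \<D>(1,3) f(1) by (intro exI[of _ "f ` \<D>"] exI[of _ "\<delta> / 3"]) auto
qed

text \<open>Global random types.\<close>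

abbreviation rtypes where "rtypes \<equiv> ctypes (LR L) C 1 (mcarr C)"

lemma type_approx:
  assumes p: "p \<in> rtypes" and F: "finite F" "\<And>\<phi> c. (\<phi>, c) \<in> F \<Longrightarrow> cwf (LR L) \<phi> (Suc (length c)) \<and> set c \<subseteq> mcarr C"
    and \<epsilon>: "0 < (\<epsilon>::real)"
  shows "\<exists>x\<in>mcarr C. \<forall>(\<phi>, c)\<in>F. \<bar>ceval C \<phi> (x # c) - p (\<phi>, c)\<bar> < \<epsilon>"
proof -
  have "F \<subseteq> cparams (LR L) 1 (mcarr C)" using F(2) by (auto simp: cparams_def)
  then obtain b where b: "b \<in> tuples 1 (mcarr C)" "\<forall>(\<phi>, c)\<in>F. \<bar>ceval C \<phi> (b @ c) - p (\<phi>, c)\<bar> < \<epsilon>"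
    using p F(1) \<epsilon> unfolding ctypes_def by blast
  obtain x where x: "b = [x]" "x \<in> mcarr C"
    using b(1) unfolding One_nat_def by (metis tuples_SucE tuples_0 singletonD)
  then show ?thesis using b(2) by (intro bexI[of _ x]) auto
qed

lemma Pval_eq: "c \<in> tuples n A \<Longrightarrow> Pval p \<psi> c = p (CPred \<psi> [0..<Suc n], c)"
  by (simp add: Pval_def tuplesD)

lemma type_approx_Pval:
  assumes p: "p \<in> rtypes" and \<phi>: "cwf (LR L) \<phi> (Suc n)" and c: "c \<in> tuples n (mcarr C)"
    and \<Psi>: "finite \<Psi>" "\<forall>\<psi>\<in>\<Psi>. wf_fm L (Suc n) \<psi>" and \<epsilon>: "0 < (\<epsilon>::real)"
  shows "\<exists>x\<in>mcarr C. \<bar>ceval C \<phi> (x # c) - p (\<phi>, c)\<bar> < \<epsilon> \<and> (\<forall>\<psi>\<in>\<Psi>. \<bar>mpred C \<psi> (x # c) - Pval p \<psi> c\<bar> < \<epsilon>)"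
proof -
  let ?F = "insert (\<phi>, c) ((\<lambda>\<psi>. (CPred \<psi> [0..<Suc n], c)) ` \<Psi>)"
  have "\<exists>x\<in>mcarr C. \<forall>(\<phi>, c)\<in>?F. \<bar>ceval C \<phi> (x # c) - p (\<phi>, c)\<bar> < \<epsilon>"
  proof (rule type_approx[OF p _ _ \<epsilon>])
    show "finite ?F" using \<Psi>(1) by simp
    fix \<theta> d assume "(\<theta>, d) \<in> ?F"
    then show "cwf (LR L) \<theta> (Suc (length d)) \<and> set d \<subseteq> mcarr C"
      using \<phi> c \<Psi>(2) cwf_pred tuplesD[OF c] by (auto simp del: cwf.simps upt_Suc)
  qed
  then obtain x where x: "x \<in> mcarr C" "\<forall>(\<phi>, c)\<in>?F. \<bar>ceval C \<phi> (x # c) - p (\<phi>, c)\<bar> < \<epsilon>" by auto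
  have "ceval C (CPred \<psi> [0..<Suc n]) (x # c) = mpred C \<psi> (x # c)" for \<psi>
    using tuplesD(1)[OF c] by (intro ceval_pred) simp
  then show ?thesis
    using x by (intro bexI[OF _ x(1)]) (auto simp: Pval_eq[OF c] simp del: ceval.simps upt_Suc)
qed

text \<open>Two types may be compared over different tuples, which covers both uniqueness of types with given
  probabilities and their invariance.\<close>

lemma type_determined:
  assumes p: "p \<in> rtypes" and q: "q \<in> rtypes" and \<phi>: "cwf (LR L) \<phi> (Suc n)"
    and c: "c \<in> tuples n (mcarr C)" "c' \<in> tuples n (mcarr C)"
    and eq: "\<And>\<psi>. wf_fm L (Suc n) \<psi> \<Longrightarrow> Pval p \<psi> c = Pval q \<psi> c'"
  shows "p (\<phi>, c) = q (\<phi>, c')"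
proof -
  have "\<bar>p (\<phi>, c) - q (\<phi>, c')\<bar> \<le> 0 + \<epsilon>" if \<epsilon>: "0 < \<epsilon>" for \<epsilon>
  proof -
    have "0 < \<epsilon> / 3" using \<epsilon> by simp
    from quantifier_elimination[OF \<phi> this]
    obtain \<Psi> \<delta> where \<Psi>: "finite \<Psi>" "\<forall>\<psi>\<in>\<Psi>. wf_fm L (Suc n) \<psi>" "0 < (\<delta>::real)"
      "\<And>e e'. e\<in>tuples (Suc n) (mcarr C) \<Longrightarrow> e'\<in>tuples (Suc n) (mcarr C) \<Longrightarrow>
        \<forall>\<psi>\<in>\<Psi>. \<bar>mpred C \<psi> e - mpred C \<psi> e'\<bar> < \<delta> \<Longrightarrow> \<bar>ceval C \<phi> e - ceval C \<phi> e'\<bar> \<le> \<epsilon> / 3" by auto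
    define \<eta> where "\<eta> = min (\<epsilon> / 3) (\<delta> / 3)"
    have \<eta>: "0 < \<eta>" "\<eta> \<le> \<epsilon> / 3" "\<eta> \<le> \<delta> / 3" using \<epsilon> \<Psi>(3) by (auto simp: \<eta>_def)
    obtain x where x: "x\<in>mcarr C" "\<bar>ceval C \<phi> (x # c) - p (\<phi>, c)\<bar> < \<eta>"
      "\<forall>\<psi>\<in>\<Psi>. \<bar>mpred C \<psi> (x # c) - Pval p \<psi> c\<bar> < \<eta>"
      using type_approx_Pval[OF p \<phi> c(1) \<Psi>(1,2) \<eta>(1)] by auto
    obtain y where y: "y\<in>mcarr C" "\<bar>ceval C \<phi> (y # c') - q (\<phi>, c')\<bar> < \<eta>"
      "\<forall>\<psi>\<in>\<Psi>. \<bar>mpred C \<psi> (y # c') - Pval q \<psi> c'\<bar> < \<eta>"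
      using type_approx_Pval[OF q \<phi> c(2) \<Psi>(1,2) \<eta>(1)] by auto
    have "\<bar>mpred C \<psi> (x # c) - mpred C \<psi> (y # c')\<bar> < \<delta>" if \<psi>: "\<psi> \<in> \<Psi>" for \<psi>
    proof -
      have "\<bar>mpred C \<psi> (x # c) - Pval p \<psi> c\<bar> < \<eta>" "\<bar>mpred C \<psi> (y # c') - Pval q \<psi> c'\<bar> < \<eta>"
        "Pval p \<psi> c = Pval q \<psi> c'" using x(3) y(3) eq \<Psi>(2) \<psi> by auto
      then show ?thesis using \<eta> \<Psi>(3) by linarith
    qed
    then have "\<bar>ceval C \<phi> (x # c) - ceval C \<phi> (y # c')\<bar> \<le> \<epsilon> / 3"
      using x(1) y(1) c by (intro \<Psi>(4)) auto
    then show ?thesis using x(2) y(2) \<eta>(2) by linarith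
  qed
  then have "\<bar>p (\<phi>, c) - q (\<phi>, c')\<bar> \<le> 0" by (rule field_le_epsilon)
  then show ?thesis by simp
qed

lemma ctp_type:
  assumes "a \<in> mcarr C" shows "ctp (LR L) C [a] (mcarr C) \<in> rtypes"
  unfolding ctypes_def ctp_def
proof (intro CollectI conjI allI impI)
  show "restrict (\<lambda>(\<phi>, c). ceval C \<phi> ([a] @ c)) (cparams (LR L) (length [a]) (mcarr C))
    \<in> extensional (cparams (LR L) 1 (mcarr C))" by simp
  fix F and \<epsilon> :: real assume F: "finite F \<and> F \<subseteq> cparams (LR L) 1 (mcarr C) \<and> 0 < \<epsilon>"
  show "\<exists>b\<in>tuples 1 (mcarr C). \<forall>(\<phi>, c)\<in>F. \<bar>ceval C \<phi> (b @ c) -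
      restrict (\<lambda>(\<phi>, c). ceval C \<phi> ([a] @ c)) (cparams (LR L) (length [a]) (mcarr C)) (\<phi>, c)\<bar> < \<epsilon>"
    using F assms by (intro bexI[of _ "[a]"]) (auto simp: tuples_def subset_iff)
qed

lemma ctp_value: "cwf (LR L) \<phi> (Suc (length c)) \<Longrightarrow> set c \<subseteq> A \<Longrightarrow> ctp (LR L) C [a] A (\<phi>, c) = ceval C \<phi> (a # c)"
  by (simp add: ctp_def cparams_def)

lemma Pval_uniform:
  assumes p: "p \<in> rtypes" and \<psi>: "wf_fm L (Suc n) \<psi>" and \<epsilon>: "0 < (\<epsilon>::real)"
  shows "\<exists>\<delta>>0. \<forall>c\<in>tuples n (mcarr C). \<forall>c'\<in>tuples n (mcarr C). (\<forall>i<n. mdist C (c ! i) (c' ! i) < \<delta>) \<longrightarrow>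
    \<bar>Pval p \<psi> c - Pval p \<psi> c'\<bar> \<le> \<epsilon>"
proof -
  have "0 < \<epsilon> / 3" using \<epsilon> by simp
  from ceval_uniform[OF cwf_pred[OF \<psi>] this]
  obtain \<delta> where \<delta>: "0 < \<delta>" "\<And>x y. x\<in>tuples (Suc n) (mcarr C) \<Longrightarrow> y\<in>tuples (Suc n) (mcarr C) \<Longrightarrow>
     \<forall>i<Suc n. mdist C (x ! i) (y ! i) < \<delta> \<Longrightarrow>
     \<bar>ceval C (CPred \<psi> [0..<Suc n]) x - ceval C (CPred \<psi> [0..<Suc n]) y\<bar> \<le> \<epsilon> / 3" by auto
  show ?thesis
  proof (intro exI[of _ \<delta>] conjI ballI impI)
    fix c c' assume c: "c\<in>tuples n (mcarr C)" "c'\<in>tuples n (mcarr C)" "\<forall>i<n. mdist C (c ! i) (c' ! i) < \<delta>"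
    have "\<exists>x\<in>mcarr C. \<forall>(\<phi>, d)\<in>{(CPred \<psi> [0..<Suc n], c), (CPred \<psi> [0..<Suc n], c')}. \<bar>ceval C \<phi> (x # d) - p (\<phi>, d)\<bar> < \<epsilon> / 3"
      using \<epsilon> c cwf_pred[OF \<psi>] tuplesD
      by (intro type_approx[OF p]) (auto simp: tuplesD(1) simp del: cwf.simps upt_Suc, auto simp: tuples_def)
    then obtain x where x: "x\<in>mcarr C" "\<bar>ceval C (CPred \<psi> [0..<Suc n]) (x # c) - Pval p \<psi> c\<bar> < \<epsilon> / 3"
      "\<bar>ceval C (CPred \<psi> [0..<Suc n]) (x # c') - Pval p \<psi> c'\<bar> < \<epsilon> / 3"
      unfolding Pval_eq[OF c(1)] Pval_eq[OF c(2)] by (auto simp del: ceval.simps upt_Suc)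
    have "\<bar>ceval C (CPred \<psi> [0..<Suc n]) (x # c) - ceval C (CPred \<psi> [0..<Suc n]) (x # c')\<bar> \<le> \<epsilon> / 3"
      using x(1) c \<delta>(1) by (intro \<delta>(2)) (auto simp: nth_Cons dist_self split: nat.split)
    then show "\<bar>Pval p \<psi> c - Pval p \<psi> c'\<bar> \<le> \<epsilon>" using x(2,3) by linarith
  qed (rule \<delta>(1))
qed

end

section \<open>Random extensions over simple random elements\<close>

text \<open>That \<open>M\<close> is an admissible range expresses the chain of elementary embeddings
  \<open>M\<^sup>\<Omega> \<preceq> U\<^sup>\<Omega> \<preceq> C\<close> through its composite.\<close>

locale rand_setting = ktype L U \<kappa> M \<mu> + rand_in \<Omega> L U C \<iota>
  for L :: "('f, 'r) lang" and U :: "('u, 'f, 'r) struct" and \<kappa> :: "'k rel" and M :: "'u set"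
    and \<mu> :: "'u set \<Rightarrow> real" and \<Omega> :: "'w measure" and C :: "('c, ('f, 'r) fm) mstruct"
    and \<iota> :: "(nat \<Rightarrow> 'w \<Rightarrow> 'u) \<Rightarrow> 'c" +
  assumes elem_range_M: "elem_range M"
begin

text \<open>The tuple of constant random elements \<open>b\<^sup>\<Omega>\<close>.\<close>

abbreviation K :: "'u list \<Rightarrow> ('w \<Rightarrow> 'u) list" where "K b \<equiv> map (\<lambda>u _. u) b"

lemma K_R: "set b \<subseteq> X \<Longrightarrow> K b \<in> tuples (length b) (R X)"
  using const_R by (auto simp: tuples_def)

lemma K_R0: "b \<in> tuples n (carr U) \<Longrightarrow> K b \<in> tuples n R0"
  using K_R[of b "carr U"] by (simp add: R_U tuples_def)

lemma vals_K: "vals (K b) \<omega> = b"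
  by (induction b) auto

lemma vals_append: "vals (h @ h') \<omega> = vals h \<omega> @ vals h' \<omega>"
  by simp

lemma map_embc: "map (embc \<iota>) b = map E (K b)"
  by (simp add: embc_def)

lemma embc_tuples: "b \<in> tuples n (carr U) \<Longrightarrow> map (embc \<iota>) b \<in> tuples n (mcarr C)"
  unfolding map_embc by (intro E_tuples K_R0)

lemma pr_K: "pr D (K b) = of_bool (D b)"
  unfolding pr_def vals_K by (simp add: prob_space)

lemma mpred_embc: "wf_fm L n \<psi> \<Longrightarrow> b \<in> tuples n (carr U) \<Longrightarrow> mpred C \<psi> (map (embc \<iota>) b) = of_bool (sat U \<psi> b)"
  unfolding map_embc using mpred_E[OF _ K_R0] pr_K by simp

lemma finite_vals: "h \<in> tuples n R0 \<Longrightarrow> finite (vals h ` space \<Omega>)"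
  using simple_vals simple_functionD(1) by blast

lemma mu_gen: "wf_fm L (Suc n) \<psi> \<Longrightarrow> b \<in> tuples n (carr U) \<Longrightarrow> \<mu> (defset U \<psi> b) = of_bool (gen (sat U \<psi>) b)"
  using mu_01[OF defsets_definable[OF definable_sat], of n \<psi> b] by (auto simp: gen_def defset_def)

text \<open>The weights \<open>\<mu>(\<psi>(x;a))\<close> are 0 or 1, so the sum defining \<open>r\<^sub>\<mu>\<close> is a probability.\<close>

lemma rmu0_pr:
  assumes "wf_fm L (Suc n) \<psi>" "h \<in> tuples n R0"
  shows "rmu0 U \<Omega> \<mu> \<psi> h = pr (gen (sat U \<psi>)) h"
proof -
  define v where "v \<omega> = vals h \<omega>" for \<omega>
  let ?V = "v ` space \<Omega>"
  have V: "finite ?V" "?V \<subseteq> tuples n (carr U)"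
    using finite_vals[OF assms(2)] vals_tuples[OF assms(2)] unfolding v_def by auto
  have s: "{\<omega>\<in>space \<Omega>. v \<omega> = b} \<in> sets \<Omega>" for b
    using vals_sets[OF assms(2), of "\<lambda>z. z = b"] unfolding v_def .
  have "{\<omega>\<in>space \<Omega>. gen (sat U \<psi>) (v \<omega>)} = (\<Union>b\<in>{b\<in>?V. gen (sat U \<psi>) b}. {\<omega>\<in>space \<Omega>. v \<omega> = b})"
    by auto
  then have "pr (gen (sat U \<psi>)) h = (\<Sum>b\<in>{b\<in>?V. gen (sat U \<psi>) b}. prob {\<omega>\<in>space \<Omega>. v \<omega> = b})"
    unfolding pr_def v_def[symmetric] using V s
    by (simp, intro finite_measure_finite_Union) (auto simp: disjoint_family_on_def)
  also have "\<dots> = (\<Sum>b\<in>?V. prob {\<omega>\<in>space \<Omega>. v \<omega> = b} * \<mu> (defset U \<psi> b))"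
    using V mu_gen[OF assms(1)]
    by (intro sum.mono_neutral_cong_left) auto
  finally show ?thesis by (simp add: rmu0_def v_def[abs_def])
qed

lemma abs_prob_diff_le:
  assumes "A \<in> sets \<Omega>" "B \<in> sets \<Omega>"
  shows "\<bar>prob A - prob B\<bar> \<le> prob ((A - B) \<union> (B - A))"
proof -
  have "prob A \<le> prob (B \<union> ((A - B) \<union> (B - A)))" "prob B \<le> prob (A \<union> ((A - B) \<union> (B - A)))"
    using assms by (auto intro!: finite_measure_mono)
  moreover have "prob (B \<union> ((A - B) \<union> (B - A))) \<le> prob B + prob ((A - B) \<union> (B - A))"
    "prob (A \<union> ((A - B) \<union> (B - A))) \<le> prob A + prob ((A - B) \<union> (B - A))"
    using assms by (auto intro!: measure_Un_le)
  ultimately show ?thesis by linarith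
qed

text \<open>Let \<open>h\<close> take the values \<open>b \<in> V\<close>. A realization \<open>f\<close> of the type, up to
  \<open>\<eta>\<close>, over \<open>h\<close> and these constants satisfies \<open>\<psi>(x;b)\<close> with probability close to 1 or
  to 0, as \<open>\<mu>\<close> prescribes; so on the event \<open>h = b\<close> the truth value of \<open>\<psi>(f;h)\<close> is
  also the prescribed one, up to small probability.\<close>

lemma random_extension_R0:
  assumes p: "random_extension L U C \<iota> \<mu> p" and \<psi>: "wf_fm L (Suc n) \<psi>" and h: "h \<in> tuples n R0"
  shows "Pval p \<psi> (map E h) = pr (gen (sat U \<psi>)) h"
proof -
  have pT: "p \<in> rtypes" using p by (simp add: random_extension_def)
  let ?V = "vals h ` space \<Omega>"
  have V: "finite ?V" "?V \<subseteq> tuples n (carr U)" using finite_vals[OF h] vals_tuples[OF h] by auto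
  have pK: "Pval p \<psi> (map E (K b)) = of_bool (gen (sat U \<psi>) b)" if "b \<in> tuples n (carr U)" for b
    using p \<psi> that mu_gen[OF \<psi> that] unfolding random_extension_def map_embc by metis
  have "\<bar>Pval p \<psi> (map E h) - pr (gen (sat U \<psi>)) h\<bar> \<le> 0 + \<epsilon>" if \<epsilon>: "0 < \<epsilon>" for \<epsilon>
  proof -
    \<comment> \<open>each of the values of \<open>h\<close>, and \<open>h\<close> itself, costs an error of \<open>2 \<eta>\<close>\<close>
    define \<eta> where "\<eta> = \<epsilon> / (2 * (real (card ?V) + 1))"
    have \<eta>: "0 < \<eta>" using \<epsilon> by (simp add: \<eta>_def)
    define H where "H = insert h (K ` ?V)"
    have H: "finite H" "\<And>c. c \<in> H \<Longrightarrow> c \<in> tuples n R0" using V h K_R0 by (auto simp: H_def)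
    let ?P = "CPred \<psi> [0..<Suc n]"
    have "\<exists>x\<in>mcarr C. \<forall>(\<phi>, c)\<in>(\<lambda>c. (?P, map E c)) ` H. \<bar>ceval C \<phi> (x # c) - p (\<phi>, c)\<bar> < \<eta>"
    proof (rule type_approx[OF pT _ _ \<eta>])
      show "finite ((\<lambda>c. (?P, map E c)) ` H)" using H(1) by simp
      fix \<phi> d assume "(\<phi>, d) \<in> (\<lambda>c. (?P, map E c)) ` H"
      then obtain c where c: "\<phi> = ?P" "d = map E c" "c \<in> H" by auto
      then have "d \<in> tuples n (mcarr C)" using E_tuples[OF H(2)] by simp
      then show "cwf (LR L) \<phi> (Suc (length d)) \<and> set d \<subseteq> mcarr C"
        using cwf_pred[OF \<psi>] c(1) by (simp add: tuples_def del: cwf.simps upt_Suc)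
    qed
    then obtain x where x: "x \<in> mcarr C" "\<And>c. c \<in> H \<Longrightarrow> \<bar>ceval C ?P (x # map E c) - p (?P, map E c)\<bar> < \<eta>"
      by (auto simp del: ceval.simps upt_Suc)
    have x': "\<bar>mpred C \<psi> (x # map E c) - Pval p \<psi> (map E c)\<bar> < \<eta>" if c: "c \<in> H" for c
    proof -
      have "ceval C ?P (x # map E c) = mpred C \<psi> (x # map E c)"
        using tuplesD(1)[OF H(2)[OF c]] by (intro ceval_pred) simp
      then show ?thesis using x(2)[OF c] unfolding Pval_eq[OF E_tuples[OF H(2)[OF c]]] by (simp only:)
    qed
    have "\<exists>f\<in>tuples 1 (R (carr U)). \<forall>(\<psi>, c)\<in>Pair \<psi> ` H.
      \<bar>pr (sat U \<psi>) (f @ c) - mpred C \<psi> ([x] @ map E c)\<bar> < \<eta>"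
      using x(1) H \<psi> by (intro approximate_pr_tuple[OF elem_range_U _ \<eta>]) (auto simp: tuples_def R_U)
    then obtain fs where fs: "fs \<in> tuples (Suc 0) R0" "\<And>c. c \<in> H \<Longrightarrow> \<bar>pr (sat U \<psi>) (fs @ c) - mpred C \<psi> (x # map E c)\<bar> < \<eta>"
      by (auto simp: R_U)
    then obtain f where f: "f \<in> R0" "fs = [f]" by (metis tuples_SucE tuples_0 singletonD)
    have near: "\<bar>pr (sat U \<psi>) (f # c) - Pval p \<psi> (map E c)\<bar> < 2 * \<eta>" if "c \<in> H" for c
      using x'[OF that] fs(2)[OF that] f(2) by (simp add: abs_less_iff)
    let ?bad = "\<lambda>b. {\<omega>\<in>space \<Omega>. vals h \<omega> = b \<and> (sat U \<psi> (f \<omega> # b) \<longleftrightarrow> \<not> gen (sat U \<psi>) b)}"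
    have fh: "f # h \<in> tuples (Suc n) R0" using f(1) h by simp
    have bad_sets: "?bad b \<in> sets \<Omega>" for b
      using vals_sets[OF fh, of "\<lambda>z. tl z = b \<and> (sat U \<psi> (hd z # b) \<longleftrightarrow> \<not> gen (sat U \<psi>) b)"] by simp
    have bad: "prob (?bad b) \<le> 2 * \<eta>" if b: "b \<in> ?V" for b
    proof -
      have bt: "b \<in> tuples n (carr U)" and bH: "K b \<in> H" using b V by (auto simp: H_def)
      have s: "{\<omega>\<in>space \<Omega>. Q (sat U \<psi> (f \<omega> # b))} \<in> sets \<Omega>" for Q
        using vals_sets[of "[f]" 1 "\<lambda>z. Q (sat U \<psi> (hd z # b))"] f(1) by (simp add: tuples_def)
      have pf: "pr (sat U \<psi>) (f # K b) = prob {\<omega>\<in>space \<Omega>. sat U \<psi> (f \<omega> # b)}"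
        unfolding pr_def list.map vals_K ..
      show ?thesis
      proof (cases "gen (sat U \<psi>) b")
        case True
        have "prob (?bad b) \<le> prob (space \<Omega> - {\<omega>\<in>space \<Omega>. sat U \<psi> (f \<omega> # b)})"
          using True s[of "\<lambda>x. x"] by (intro finite_measure_mono) auto
        also have "\<dots> = 1 - prob {\<omega>\<in>space \<Omega>. sat U \<psi> (f \<omega> # b)}" using s[of "\<lambda>x. x"] by (rule prob_compl)
        finally show ?thesis using near[OF bH] pK[OF bt] True pf by simp
      next
        case False
        have "prob (?bad b) \<le> prob {\<omega>\<in>space \<Omega>. sat U \<psi> (f \<omega> # b)}"
          using False s[of "\<lambda>x. x"] by (intro finite_measure_mono) auto
        then show ?thesis using near[OF bH] pK[OF bt] False pf by simp
      qed
    qed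
    let ?A = "{\<omega>\<in>space \<Omega>. sat U \<psi> (f \<omega> # vals h \<omega>)}" and ?B = "{\<omega>\<in>space \<Omega>. gen (sat U \<psi>) (vals h \<omega>)}"
    have A: "?A \<in> sets \<Omega>" using vals_sets[OF fh, of "sat U \<psi>"] by simp
    have B: "?B \<in> sets \<Omega>" using vals_sets[OF h] .
    have "\<bar>pr (sat U \<psi>) (f # h) - pr (gen (sat U \<psi>)) h\<bar> \<le> prob ((?A - ?B) \<union> (?B - ?A))"
      using abs_prob_diff_le[OF A B] by (simp add: pr_def)
    also have "(?A - ?B) \<union> (?B - ?A) = (\<Union>b\<in>?V. ?bad b)" by (auto simp del: map_eq_conv)
    also have "prob (\<Union>b\<in>?V. ?bad b) \<le> (\<Sum>b\<in>?V. prob (?bad b))"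
      using V(1) bad_sets by (intro measure_UNION_le) auto
    also have "\<dots> \<le> (\<Sum>b\<in>?V. 2 * \<eta>)" using bad by (intro sum_mono) auto
    also have "\<dots> = card ?V * (2 * \<eta>)" by simp
    finally have "\<bar>pr (sat U \<psi>) (f # h) - pr (gen (sat U \<psi>)) h\<bar> \<le> card ?V * (2 * \<eta>)" .
    moreover have "\<bar>pr (sat U \<psi>) (f # h) - Pval p \<psi> (map E h)\<bar> < 2 * \<eta>"
      using near[of h] by (simp add: H_def)
    moreover have "card ?V * (2 * \<eta>) + 2 * \<eta> = \<epsilon>"
    proof -
      have "card ?V * (2 * \<eta>) + 2 * \<eta> = (2 * (real (card ?V) + 1)) * \<eta>" by (simp add: algebra_simps)
      also have "\<dots> = \<epsilon>" unfolding \<eta>_def by (simp add: field_simps)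
      finally show ?thesis .
    qed
    ultimately show ?thesis by linarith
  qed
  then have "\<bar>Pval p \<psi> (map E h) - pr (gen (sat U \<psi>)) h\<bar> \<le> 0" by (rule field_le_epsilon)
  then show ?thesis by simp
qed

text \<open>The type \<open>q\<close> of the constant \<open>a\<^sub>i\<^sup>\<Omega>\<close> is compared with \<open>p\<close>. Both have the
  same probabilities over simple elements with values in \<open>M \<union> {a\<^sub>j. j < i}\<close>, by the
  forced values of random extensions; by density and uniform continuity also over the randomization
  of \<open>M\<close> and the earlier constants; and by quantifier elimination all their values agree there.\<close>

lemma random_extension_generically_stable:
  assumes inv: "invariant L U M \<mu>" and p: "random_extension L U C \<iota> \<mu> p"
    and gs: "cgenerically_stable (LR L) C (\<iota> ` mcarr (RR M)) p"
  shows "generically_stable L U M \<mu>"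
  unfolding generically_stable_def
proof (intro conjI type inv notI, elim exE conjE)
  fix n \<phi> and a :: "nat \<Rightarrow> 'u" and b :: "nat \<Rightarrow> 'u list"
  assume \<phi>: "wf_fm L (Suc n) \<phi>" and a: "\<forall>i. a i \<in> carr U \<and> realizes_on L U (a i) \<mu> (M \<union> a ` {..<i})"
    and b: "\<forall>j. b j \<in> tuples n (carr U)"
    and pattern: "\<forall>i j. (i \<le> j \<longrightarrow> \<not> sat U \<phi> (a i # b j)) \<and> (j < i \<longrightarrow> sat U \<phi> (a i # b j))"
  let ?N = "\<iota> ` mcarr (RR M)"
  define a' where "a' i = embc \<iota> (a i)" for i
  define b' where "b' j = map (embc \<iota>) (b j)" for j
  have pT: "p \<in> rtypes" using p by (simp add: random_extension_def)
  have ca: "\<And>i. a i \<in> carr U" using a by blast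
  have aR0: "(\<lambda>_. a i) \<in> R0" for i using ca by (simp add: R0_iff image_subset_iff)
  have a': "a' i \<in> mcarr C" for i unfolding a'_def embc_def by (intro E_mcarr aR0)
  have NC: "?N \<subseteq> mcarr C" using elem_range_mcarr[OF elem_range_M] by auto
  have "ctp (LR L) C [a' i] (?N \<union> a' ` {..<i}) = restrict p (cparams (LR L) 1 (?N \<union> a' ` {..<i}))" for i
  proof -
    let ?A = "?N \<union> a' ` {..<i}" and ?H = "R M \<union> (\<lambda>j _. a j) ` {..<i}"
    define q where "q = ctp (LR L) C [a' i] (mcarr C)"
    have qT: "q \<in> rtypes" unfolding q_def by (rule ctp_type[OF a'])
    have HR0: "?H \<subseteq> R0" using R_R0[OF M] aR0 by auto
    have simple: "Pval p \<psi> (map E h) = Pval q \<psi> (map E h)"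
      if \<psi>: "wf_fm L (Suc m) \<psi>" and h: "h \<in> tuples m ?H" for \<psi> m h
    proof -
      have h0: "h \<in> tuples m R0" using h HR0 tuples_mono by blast
      have hC: "map E h \<in> tuples m (mcarr C)" using E_tuples[OF h0] .
      have "Pval q \<psi> (map E h) = ceval C (CPred \<psi> [0..<Suc m]) (a' i # map E h)"
        unfolding Pval_eq[OF hC] q_def using hC cwf_pred[OF \<psi>]
        by (intro ctp_value) (simp_all add: tuples_def del: cwf.simps upt_Suc)
      also have "\<dots> = mpred C \<psi> (a' i # map E h)"
        using tuplesD(1)[OF hC] by (intro ceval_pred) simp
      also have "\<dots> = mpred C \<psi> (map E ((\<lambda>_. a i) # h))" by (simp add: a'_def embc_def)
      also have "\<dots> = pr (sat U \<psi>) ((\<lambda>_. a i) # h)"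
        using aR0 h0 by (intro mpred_E[OF \<psi>]) simp
      also have "\<dots> = pr (gen (sat U \<psi>)) h"
      proof (rule pr_cong)
        fix \<omega> assume \<omega>: "\<omega> \<in> space \<Omega>"
        have "vals h \<omega> \<in> tuples m (M \<union> a ` {..<i})"
          using h \<omega> by (auto simp: tuples_def R_iff subset_iff image_iff)
        then have "sat U \<psi> (a i # vals h \<omega>) \<longleftrightarrow> gen (sat U \<psi>) (vals h \<omega>)"
          using a ca M by (intro realizes_on_definable[OF _ _ definable_sat[OF \<psi>], where A="M \<union> a ` {..<i}"]) auto
        then show "sat U \<psi> (vals ((\<lambda>_. a i) # h) \<omega>) = gen (sat U \<psi>) (vals h \<omega>)" by simp
      qed
      also have "\<dots> = Pval p \<psi> (map E h)" using random_extension_R0[OF p \<psi> h0] by simp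
      finally show ?thesis by simp
    qed
    have approx: "\<exists>h\<in>tuples m ?H. \<forall>k<m. mdist C (c ! k) (map E h ! k) < \<delta>"
      if "c \<in> tuples m ?A" "0 < \<delta>" for m c \<delta>
      using that(1)
    proof (induction m arbitrary: c)
      case (Suc m)
      obtain y c' where c: "c = y # c'" "y \<in> ?A" "c' \<in> tuples m ?A" using Suc.prems by (rule tuples_SucE)
      obtain h where h: "h\<in>tuples m ?H" "\<forall>k<m. mdist C (c' ! k) (map E h ! k) < \<delta>" using Suc.IH[OF c(3)] by auto
      have "\<exists>f\<in>?H. mdist C y (E f) < \<delta>"
      proof (cases "y \<in> ?N")
        case True
        then show ?thesis using dense[OF elem_range_M _ \<open>0 < \<delta>\<close>] by auto
      next
        case False
        then obtain j where j: "j < i" "y = a' j" using c(2) by auto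
        then have "mdist C y (E (\<lambda>_. a j)) = 0" using dist_self[OF a'] by (simp add: a'_def embc_def)
        then show ?thesis using j \<open>0 < \<delta>\<close> by (intro bexI[of _ "\<lambda>_. a j"]) auto
      qed
      then obtain f where f: "f \<in> ?H" "mdist C y (E f) < \<delta>" by auto
      show ?case
        by (rule bexI[of _ "f # h"]) (use f h c(1) in \<open>auto simp: nth_Cons split: nat.split\<close>)
    qed simp
    have AC: "?A \<subseteq> mcarr C" using NC a' by auto
    have Pv: "Pval p \<psi> c = Pval q \<psi> c" if \<psi>: "wf_fm L (Suc m) \<psi>" and c: "c \<in> tuples m ?A" for \<psi> m c
    proof -
      have cC: "c \<in> tuples m (mcarr C)" using c AC tuples_mono by blast
      have "\<bar>Pval p \<psi> c - Pval q \<psi> c\<bar> \<le> 0 + \<epsilon>" if \<epsilon>: "0 < \<epsilon>" for \<epsilon>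
      proof -
        have \<epsilon>2: "0 < \<epsilon> / 2" using \<epsilon> by simp
        obtain \<delta>1 where \<delta>1: "0 < \<delta>1" "\<And>c c'. c\<in>tuples m (mcarr C) \<Longrightarrow> c'\<in>tuples m (mcarr C) \<Longrightarrow>
          \<forall>i<m. mdist C (c ! i) (c' ! i) < \<delta>1 \<Longrightarrow> \<bar>Pval p \<psi> c - Pval p \<psi> c'\<bar> \<le> \<epsilon> / 2"
          using Pval_uniform[OF pT \<psi> \<epsilon>2] by auto
        obtain \<delta>2 where \<delta>2: "0 < \<delta>2" "\<And>c c'. c\<in>tuples m (mcarr C) \<Longrightarrow> c'\<in>tuples m (mcarr C) \<Longrightarrow>
          \<forall>i<m. mdist C (c ! i) (c' ! i) < \<delta>2 \<Longrightarrow> \<bar>Pval q \<psi> c - Pval q \<psi> c'\<bar> \<le> \<epsilon> / 2"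
          using Pval_uniform[OF qT \<psi> \<epsilon>2] by auto
        have "0 < min \<delta>1 \<delta>2" using \<delta>1(1) \<delta>2(1) by simp
        from approx[OF c this] obtain h where h: "h\<in>tuples m ?H" "\<forall>k<m. mdist C (c ! k) (map E h ! k) < min \<delta>1 \<delta>2" by auto
        have hC: "map E h \<in> tuples m (mcarr C)" using h(1) HR0 tuples_mono E_tuples by blast
        have "\<bar>Pval p \<psi> c - Pval p \<psi> (map E h)\<bar> \<le> \<epsilon> / 2" using h(2) by (intro \<delta>1(2)[OF cC hC]) simp
        moreover have "\<bar>Pval q \<psi> c - Pval q \<psi> (map E h)\<bar> \<le> \<epsilon> / 2" using h(2) by (intro \<delta>2(2)[OF cC hC]) simp
        ultimately show ?thesis using simple[OF \<psi> h(1)] by linarith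
      qed
      then have "\<bar>Pval p \<psi> c - Pval q \<psi> c\<bar> \<le> 0" by (rule field_le_epsilon)
      then show ?thesis by simp
    qed
    show ?thesis
    proof (rule extensionalityI[of _ "cparams (LR L) 1 ?A"])
      fix \<theta> assume \<theta>: "\<theta> \<in> cparams (LR L) 1 ?A"
      obtain \<psi> c where \<theta>': "\<theta> = (\<psi>, c)" by (cases \<theta>)
      then have \<psi>: "cwf (LR L) \<psi> (Suc (length c))" "set c \<subseteq> ?A" using \<theta> by (auto simp: cparams_def)
      have cA: "c \<in> tuples (length c) ?A" using \<psi>(2) by (intro tuplesI refl)
      then have cC: "c \<in> tuples (length c) (mcarr C)" using AC tuples_mono by blast
      have "p (\<psi>, c) = q (\<psi>, c)" using type_determined[OF pT qT \<psi>(1) cC cC] Pv[OF _ cA] by blast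
      also have "\<dots> = ceval C \<psi> (a' i # c)"
        unfolding q_def using subset_trans[OF \<psi>(2) AC] by (rule ctp_value[OF \<psi>(1)])
      also have "\<dots> = ctp (LR L) C [a' i] ?A (\<psi>, c)" using ctp_value[OF \<psi>] by simp
      finally show "ctp (LR L) C [a' i] ?A \<theta> = restrict p (cparams (LR L) 1 ?A) \<theta>"
        using \<theta> \<theta>' by simp
    qed (simp_all add: ctp_def)
  qed
  moreover have "cwf (LR L) (CPred \<phi> [0..<Suc n]) (Suc n)" by (rule cwf_pred[OF \<phi>])
  moreover have "b' j \<in> tuples n (mcarr C)" for j unfolding b'_def using b embc_tuples by blast
  moreover have "ceval C (CPred \<phi> [0..<Suc n]) (a' i # b' j) = of_bool (j < i)" for i j
  proof -
    have "ceval C (CPred \<phi> [0..<Suc n]) (a' i # b' j) = mpred C \<phi> (a' i # b' j)"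
      using b by (intro ceval_pred) (simp add: b'_def tuples_def)
    also have "\<dots> = mpred C \<phi> (map (embc \<iota>) (a i # b j))" by (simp add: a'_def b'_def)
    also have "\<dots> = of_bool (sat U \<phi> (a i # b j))" using b ca by (intro mpred_embc[OF \<phi>]) simp
    finally show ?thesis using pattern by (cases "j < i") (auto simp: not_less)
  qed
  ultimately have "cwf (LR L) (CPred \<phi> [0..<Suc n]) (Suc n) \<and>
          (\<forall>i. a' i \<in> mcarr C \<and>
             ctp (LR L) C [a' i] (?N \<union> a' ` {..<i}) = restrict p (cparams (LR L) 1 (?N \<union> a' ` {..<i}))) \<and>
          (\<forall>j. b' j \<in> tuples n (mcarr C)) \<and> (0::real) < 1 \<and>
          (\<forall>i j. (i \<le> j \<longrightarrow> ceval C (CPred \<phi> [0..<Suc n]) (a' i # b' j) \<le> 0) \<and>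
                 (j < i \<longrightarrow> 1 \<le> ceval C (CPred \<phi> [0..<Suc n]) (a' i # b' j)))"
    using a' by (auto simp del: cwf.simps ceval.simps upt_Suc)
  then show False using gs unfolding cgenerically_stable_def by blast
qed

end

section \<open>Canonical extensions are random extensions\<close>

lemma openin_generated_nbhd:
  assumes "openin (topology_generated_by S) V" "t \<in> V"
  shows "\<exists>G. finite G \<and> G \<subseteq> S \<and> t \<in> \<Inter>G \<and> (\<forall>x\<in>\<Inter>G. x \<in> V)"
proof -
  have "generate_topology_on S V" using assms(1) by (simp add: openin_topology_generated_by)
  then show ?thesis
    using assms(2)
  proof (induction V)
    case (Int a b)
    then obtain G H where "finite G" "G \<subseteq> S" "t \<in> \<Inter>G" "\<forall>x\<in>\<Inter>G. x \<in> a"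
      "finite H" "H \<subseteq> S" "t \<in> \<Inter>H" "\<forall>x\<in>\<Inter>H. x \<in> b" by auto
    then show ?case by (intro exI[of _ "G \<union> H"]) auto
  next
    case (UN K)
    then obtain k where "k \<in> K" "t \<in> k" by auto
    with UN.IH show ?case by (meson UnionI)
  next
    case (Basis s)
    then show ?case by (intro exI[of _ "{s}"]) auto
  qed simp
qed

lemma tp_types:
  assumes b: "b \<in> tuples n (carr U)" shows "tp L U b A \<in> types L U n A"
proof -
  have l: "length b = n" using b by (simp add: tuplesD)
  show ?thesis
    unfolding types_def
  proof (intro CollectI conjI ballI allI impI)
    show "tp L U b A \<subseteq> params L n A" using l by (auto simp: tp_def)
    show "case \<theta> of (\<phi>, c) \<Rightarrow> (\<phi>, c) \<in> tp L U b A \<or> (Neg \<phi>, c) \<in> tp L U b A" if "\<theta> \<in> params L n A" for \<theta>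
      using that l by (auto simp: tp_def params_def)
    fix F assume "finite F \<and> F \<subseteq> tp L U b A"
    then show "\<exists>b\<in>tuples n (carr U). \<forall>(\<phi>, c)\<in>F. sat U \<phi> (b @ c)"
      using b by (intro bexI[of _ b]) (auto simp: tp_def)
  qed
qed

text \<open>A \<open>{0,1}\<close>-valued continuous function is constant near each point, and basic neighbourhoods in
  the type space are given by finitely many formulas.\<close>

lemma locally_determined:
  assumes def: "definable_over L U M \<mu>" and \<psi>: "wf_fm L (Suc n) \<psi>" and b: "b \<in> tuples n (carr U)"
  shows "\<exists>\<Theta>. finite \<Theta> \<and> \<Theta> \<subseteq> tp L U b M \<and> (\<forall>a\<in>tuples n (carr U). \<Theta> \<subseteq> tp L U a M \<longrightarrow>
    \<bar>\<mu> (defset U \<psi> a) - \<mu> (defset U \<psi> b)\<bar> < 1)"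
proof -
  obtain F where F: "continuous_map (type_space L U n M) (top_of_set {0..1}) F"
    "\<And>b. b \<in> tuples n (carr U) \<Longrightarrow> F (tp L U b M) = \<mu> (defset U \<psi> b)"
    using def \<psi> unfolding definable_over_def by blast
  let ?T = "type_space L U n M" and ?t = "tp L U b M"
  have "continuous_map ?T euclideanreal F" using F(1) continuous_map_into_fulltopology by blast
  moreover have "openin euclideanreal (ball (F ?t) 1)" by simp
  ultimately have V: "openin ?T {q\<in>topspace ?T. F q \<in> ball (F ?t) 1}"
    by (rule openin_continuous_map_preimage)
  have t: "?t \<in> topspace ?T"
  proof -
    have "(Neg (Exi (Neg (Eq (Var 0) (Var 0)))), []) \<in> params L n M" by (simp add: params_def)
    moreover from this have "(Neg (Exi (Neg (Eq (Var 0) (Var 0)))), []) \<in> ?t"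
      using tuplesD(1)[OF b] by (simp add: tp_def)
    ultimately show ?thesis
      using tp_types[OF b] unfolding type_space_def topology_generated_by_topspace by blast
  qed
  have "?t \<in> {q\<in>topspace ?T. F q \<in> ball (F ?t) 1}" using t by simp
  from openin_generated_nbhd[OF V[unfolded type_space_def] this[unfolded type_space_def]]
  obtain G where G: "finite G" "G \<subseteq> (\<lambda>\<theta>. {p\<in>types L U n M. \<theta> \<in> p}) ` params L n M" "?t \<in> \<Inter>G"
    and G': "\<forall>q\<in>\<Inter>G. q \<in> {q\<in>topspace ?T. F q \<in> ball (F ?t) 1}"
    unfolding type_space_def[symmetric] by (elim exE conjE)
  have G4: "\<bar>F ?t - F q\<bar> < 1" if "q \<in> \<Inter>G" for q
    using bspec[OF G' that] by (simp add: dist_real_def)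
  obtain \<Theta> where \<Theta>: "\<Theta> \<subseteq> params L n M" "finite \<Theta>" "G = (\<lambda>\<theta>. {p\<in>types L U n M. \<theta> \<in> p}) ` \<Theta>"
    using finite_subset_image[OF G(1,2)] by auto
  show ?thesis
  proof (intro exI[of _ \<Theta>] conjI ballI impI \<Theta>(2))
    show "\<Theta> \<subseteq> ?t" using G(3) \<Theta>(3) by auto
    fix a assume a: "a \<in> tuples n (carr U)" "\<Theta> \<subseteq> tp L U a M"
    then have "tp L U a M \<in> \<Inter>G" using tp_types[OF a(1)] \<Theta>(3) by auto
    from G4[OF this] show "\<bar>\<mu> (defset U \<psi> a) - \<mu> (defset U \<psi> b)\<bar> < 1"
      using F(2)[OF a(1)] F(2)[OF b] by (simp add: abs_minus_commute)
  qed
qed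

context rand_in
begin

lemma ctp_ctypes:
  assumes "e \<in> tuples n (mcarr C)" shows "ctp (LR L) C e A \<in> ctypes (LR L) C n A"
  unfolding ctypes_def
proof (intro CollectI conjI allI impI)
  have l: "length e = n" using assms by (simp add: tuplesD)
  show "ctp (LR L) C e A \<in> extensional (cparams (LR L) n A)" using l by (simp add: ctp_def)
  fix F and \<epsilon> :: real assume "finite F \<and> F \<subseteq> cparams (LR L) n A \<and> 0 < \<epsilon>"
  then show "\<exists>b\<in>tuples n (mcarr C). \<forall>(\<phi>, c)\<in>F. \<bar>ceval C \<phi> (b @ c) - ctp (LR L) C e A (\<phi>, c)\<bar> < \<epsilon>"
    using assms l by (intro bexI[of _ e]) (auto simp: ctp_def subset_iff)
qed

lemma limitin_ctp:
  assumes g: "g \<in> tuples n (mcarr C)" and f: "\<forall>\<^sub>F h in \<F>. f h \<in> tuples n (mcarr C)"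
  shows "limitin (ctype_space (LR L) C n A) (\<lambda>h. ctp (LR L) C (f h) A) (ctp (LR L) C g A) \<F> \<longleftrightarrow>
    (\<forall>(\<phi>, c)\<in>cparams (LR L) n A. ((\<lambda>h. ceval C \<phi> (f h @ c)) \<longlongrightarrow> ceval C \<phi> (g @ c)) \<F>)"
proof -
  have ev: "\<forall>\<^sub>F h in \<F>. ctp (LR L) C (f h) A \<in> ctypes (LR L) C n A"
    using f by eventually_elim (rule ctp_ctypes)
  have ext: "\<forall>\<^sub>F h in \<F>. ctp (LR L) C (f h) A \<in> extensional (cparams (LR L) n A)"
    using ev by eventually_elim (simp add: ctypes_def)
  have val: "ctp (LR L) C e A (\<phi>, c) = ceval C \<phi> (e @ c)"
    if "(\<phi>, c) \<in> cparams (LR L) n A" "e \<in> tuples n (mcarr C)" for \<phi> c e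
    using that by (simp add: ctp_def tuplesD)
  have "limitin (ctype_space (LR L) C n A) (\<lambda>h. ctp (LR L) C (f h) A) (ctp (LR L) C g A) \<F> \<longleftrightarrow>
    (\<forall>\<theta>\<in>cparams (LR L) n A. ((\<lambda>h. ctp (LR L) C (f h) A \<theta>) \<longlongrightarrow> ctp (LR L) C g A \<theta>) \<F>)"
    unfolding ctype_space_def limitin_subtopology limitin_componentwise
    using ev ext ctp_ctypes[OF g] by (auto simp: ctypes_def PiE_def)
  also have "\<dots> \<longleftrightarrow> (\<forall>(\<phi>, c)\<in>cparams (LR L) n A. ((\<lambda>h. ceval C \<phi> (f h @ c)) \<longlongrightarrow> ceval C \<phi> (g @ c)) \<F>)"
  proof (intro ball_cong refl, clarify)
    fix \<phi> c assume \<phi>: "(\<phi>, c) \<in> cparams (LR L) n A"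
    have "\<forall>\<^sub>F h in \<F>. ctp (LR L) C (f h) A (\<phi>, c) = ceval C \<phi> (f h @ c)"
      using f by eventually_elim (rule val[OF \<phi>])
    then show "((\<lambda>h. ctp (LR L) C (f h) A (\<phi>, c)) \<longlongrightarrow> ctp (LR L) C g A (\<phi>, c)) \<F> \<longleftrightarrow>
        ((\<lambda>h. ceval C \<phi> (f h @ c)) \<longlongrightarrow> ceval C \<phi> (g @ c)) \<F>"
      unfolding val[OF \<phi> g] by (rule tendsto_cong)
  qed
  finally show ?thesis .
qed

text \<open>The filter replaces a net of simple tuples converging in type to \<open>g\<close>; it exists because
  finitely many probabilities can be approximated simultaneously.\<close>

lemma approximating_filter:
  assumes X: "elem_range X" and g: "g \<in> tuples n (mcarr C)"
  shows "\<exists>\<F>. \<F> \<noteq> bot \<and> (\<forall>\<^sub>F h in \<F>. h \<in> tuples n (R X)) \<and>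
    (\<forall>\<psi> c \<epsilon>. set c \<subseteq> R X \<longrightarrow> wf_fm L (n + length c) \<psi> \<longrightarrow> 0 < (\<epsilon>::real) \<longrightarrow>
      (\<forall>\<^sub>F h in \<F>. \<bar>pr (sat U \<psi>) (h @ c) - mpred C \<psi> (g @ map E c)\<bar> < \<epsilon>))"
proof -
  define ok where "ok Q \<longleftrightarrow> finite Q \<and> (\<forall>(\<psi>, c, \<epsilon>)\<in>Q. set c \<subseteq> R X \<and> wf_fm L (n + length c) \<psi> \<and> 0 < (\<epsilon>::real))" for Q
  define W where "W Q = {h\<in>tuples n (R X). \<forall>(\<psi>, c, \<epsilon>)\<in>Q. \<bar>pr (sat U \<psi>) (h @ c) - mpred C \<psi> (g @ map E c)\<bar> < \<epsilon>}" for Q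
  have W: "W Q \<noteq> {}" if Q: "ok Q" for Q
  proof -
    define \<epsilon> where "\<epsilon> = Min (insert 1 ((\<lambda>(\<psi>, c, \<epsilon>). \<epsilon>) ` Q))"
    have fin: "finite Q" using Q by (simp add: ok_def)
    have \<epsilon>: "0 < \<epsilon>" using Q fin by (auto simp: \<epsilon>_def ok_def)
    have le: "\<epsilon> \<le> \<epsilon>'" if "(\<psi>, c, \<epsilon>') \<in> Q" for \<psi> c \<epsilon>'
      unfolding \<epsilon>_def using fin that by (intro Min_le) force+
    have "\<exists>h\<in>tuples n (R X). \<forall>(\<psi>, c)\<in>(\<lambda>(\<psi>, c, \<epsilon>). (\<psi>, c)) ` Q. \<bar>pr (sat U \<psi>) (h @ c) - mpred C \<psi> (g @ map E c)\<bar> < \<epsilon>"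
      using Q by (intro approximate_pr_tuple[OF X g \<epsilon>]) (auto simp: ok_def)
    then obtain h where h: "h\<in>tuples n (R X)"
      "\<And>\<psi> c \<epsilon>'. (\<psi>, c, \<epsilon>') \<in> Q \<Longrightarrow> \<bar>pr (sat U \<psi>) (h @ c) - mpred C \<psi> (g @ map E c)\<bar> < \<epsilon>" by fastforce
    have "h \<in> W Q" unfolding W_def using h(1) less_le_trans[OF h(2) le] by auto
    then show ?thesis by auto
  qed
  define \<F> where "\<F> = (INF Q\<in>Collect ok. principal (W Q))"
  have "\<F> \<noteq> bot"
    unfolding \<F>_def
  proof (rule INF_filter_not_bot)
    fix Y assume Y: "Y \<subseteq> Collect ok" "finite Y"
    then have "finite (\<Union>Y)" unfolding ok_def by blast
    moreover have "\<forall>q\<in>\<Union>Y. case q of (\<psi>, c, \<epsilon>) \<Rightarrow> set c \<subseteq> R X \<and> wf_fm L (n + length c) \<psi> \<and> 0 < (\<epsilon>::real)"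
      using Y(1) unfolding ok_def by blast
    ultimately have "ok (\<Union>Y)" by (simp add: ok_def)
    then obtain h where "h \<in> W (\<Union>Y)" using W by blast
    then have "h \<in> (\<Inter>Q\<in>Y. W Q)" by (auto simp: W_def)
    then show "(INF Q\<in>Y. principal (W Q)) \<noteq> bot"
      using Y(2) by (auto simp: INF_principal_finite principal_eq_bot_iff)
  qed
  moreover have ev: "\<forall>\<^sub>F h in \<F>. h \<in> W Q" if "ok Q" for Q
    unfolding \<F>_def using that by (intro eventually_INF1[of Q]) (auto simp: eventually_principal)
  have "\<forall>\<^sub>F h in \<F>. h \<in> tuples n (R X)"
    using ev[of "{}"] by (auto simp: ok_def W_def)
  moreover have "\<forall>\<^sub>F h in \<F>. \<bar>pr (sat U \<psi>) (h @ c) - mpred C \<psi> (g @ map E c)\<bar> < \<epsilon>"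
    if "set c \<subseteq> R X" "wf_fm L (n + length c) \<psi>" "0 < \<epsilon>" for \<psi> c \<epsilon>
  proof -
    have "ok {(\<psi>, c, \<epsilon>)}" using that by (simp add: ok_def)
    from ev[OF this] show ?thesis by eventually_elim (simp add: W_def)
  qed
  ultimately show ?thesis by (intro exI[of _ \<F>] conjI allI impI)
qed

text \<open>By quantifier elimination, convergence of the probabilities of classical formulas over simple
  elements is convergence of types.\<close>

lemma limitin_ctp_from_pr:
  assumes X: "elem_range X" and g: "g \<in> tuples n (mcarr C)" and \<F>: "\<forall>\<^sub>F h in \<F>. h \<in> tuples n (R X)"
    "\<And>\<psi> c \<epsilon>. set c \<subseteq> R X \<Longrightarrow> wf_fm L (n + length c) \<psi> \<Longrightarrow> 0 < \<epsilon> \<Longrightarrow>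
      \<forall>\<^sub>F h in \<F>. \<bar>pr (sat U \<psi>) (h @ c) - mpred C \<psi> (g @ map E c)\<bar> < \<epsilon>"
  shows "limitin (ctype_space (LR L) C n (E ` R X)) (\<lambda>h. ctp (LR L) C (map E h) (E ` R X))
    (ctp (LR L) C g (E ` R X)) \<F>"
proof -
  have ev: "\<forall>\<^sub>F h in \<F>. map E h \<in> tuples n (mcarr C)"
    using \<F>(1) by eventually_elim (intro E_tuples elem_range_tuples[OF X])
  show ?thesis
    unfolding limitin_ctp[OF g ev]
  proof (intro ballI, clarify)
    fix \<phi> d assume "(\<phi>, d) \<in> cparams (LR L) n (E ` R X)"
    then have \<phi>: "cwf (LR L) \<phi> (n + length d)" and "set d \<subseteq> E ` R X" by (auto simp: cparams_def)
    then have "d \<in> map E ` lists (R X)" by (auto simp: lists_image[symmetric])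
    then obtain c where c: "d = map E c" "set c \<subseteq> R X" by auto
    have ct: "c \<in> tuples (length c) R0" using c(2) by (intro elem_range_tuples[OF X] tuplesI) auto
    show "((\<lambda>h. ceval C \<phi> (map E h @ d)) \<longlongrightarrow> ceval C \<phi> (g @ d)) \<F>"
    proof (rule tendstoI)
      fix \<epsilon> :: real assume "0 < \<epsilon>"
      then have "0 < \<epsilon> / 2" by simp
      from quantifier_elimination[OF \<phi> this]
      obtain \<Psi> \<delta> where \<Psi>: "finite \<Psi>" "\<And>\<psi>. \<psi> \<in> \<Psi> \<Longrightarrow> wf_fm L (n + length c) \<psi>" "0 < (\<delta>::real)"
        "\<And>e e'. e\<in>tuples (n + length c) (mcarr C) \<Longrightarrow> e'\<in>tuples (n + length c) (mcarr C) \<Longrightarrow>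
          \<forall>\<psi>\<in>\<Psi>. \<bar>mpred C \<psi> e - mpred C \<psi> e'\<bar> < \<delta> \<Longrightarrow> \<bar>ceval C \<phi> e - ceval C \<phi> e'\<bar> \<le> \<epsilon> / 2" using c(1) by auto
      have "\<forall>\<^sub>F h in \<F>. \<forall>\<psi>\<in>\<Psi>. \<bar>pr (sat U \<psi>) (h @ c) - mpred C \<psi> (g @ map E c)\<bar> < \<delta>"
        using \<Psi>(1) \<F>(2)[OF c(2) \<Psi>(2) \<Psi>(3)] by (simp add: eventually_ball_finite_distrib)
      with \<F>(1) show "\<forall>\<^sub>F h in \<F>. dist (ceval C \<phi> (map E h @ d)) (ceval C \<phi> (g @ d)) < \<epsilon>"
      proof eventually_elim
        case (elim h)
        have hc: "h @ c \<in> tuples (n + length c) R0" using tuples_append[OF elem_range_tuples[OF X elim(1)] ct] .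
        have "\<forall>\<psi>\<in>\<Psi>. \<bar>mpred C \<psi> (map E (h @ c)) - mpred C \<psi> (g @ map E c)\<bar> < \<delta>"
          using elim(2) mpred_E[OF \<Psi>(2) hc] by simp
        then have "\<bar>ceval C \<phi> (map E (h @ c)) - ceval C \<phi> (g @ map E c)\<bar> \<le> \<epsilon> / 2"
          by (intro \<Psi>(4) E_tuples[OF hc] tuples_append[OF g E_tuples[OF ct]])
        then show ?case using c(1) \<open>0 < \<epsilon>\<close> by (simp add: dist_real_def)
      qed
    qed
  qed
qed

end

context rand_setting
begin

text \<open>Along the approximating filter of \<open>b\<^sup>\<Omega>\<close>, the values of a simple tuple \<open>h\<close> satisfy
  the finitely many formulas \<open>\<Theta>\<close> in the type of \<open>b\<close> with probability close to 1. These formulas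
  make \<open>\<mu>\<close> treat the value of \<open>h\<close> as it treats \<open>b\<close>, so the prescribed value of the
  canonical extension at \<open>h\<close> is close to \<open>\<mu>(\<psi>(x;b))\<close>.\<close>

lemma canonical_extension_random:
  assumes def: "definable_over L U M \<mu>" and can: "canonical_extension L U M C \<Omega> \<iota> \<mu> p"
  shows "random_extension L U C \<iota> \<mu> p"
  unfolding random_extension_def
proof (intro conjI allI impI ballI)
  show "p \<in> rtypes" using can by (simp add: canonical_extension_def)
  fix n \<psi> b assume \<psi>: "wf_fm L (Suc n) \<psi>" and b: "b \<in> tuples n (carr U)"
  let ?g = "map (embc \<iota>) b"
  have g: "?g \<in> tuples n (mcarr C)" using embc_tuples[OF b] .
  have can0: "Pval p \<psi> (map E h) = pr (gen (sat U \<psi>)) h" if h: "h \<in> tuples n (R M)" for h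
    using can \<psi> h rmu0_pr[OF \<psi> elem_range_tuples[OF elem_range_M h]] by (auto simp: canonical_extension_def Let_def)
  have canl: "((\<lambda>h. Pval p \<psi> (map E h)) \<longlongrightarrow> Pval p \<psi> ?g) \<F>"
    if "\<F> \<noteq> bot" "\<forall>\<^sub>F h in \<F>. h \<in> tuples n (R M)"
      "limitin (ctype_space (LR L) C n (E ` R M)) (\<lambda>h. ctp (LR L) C (map E h) (E ` R M)) (ctp (LR L) C ?g (E ` R M)) \<F>" for \<F>
    using can \<psi> g that unfolding canonical_extension_def Let_def by blast
  obtain \<Theta> where \<Theta>: "finite \<Theta>" "\<Theta> \<subseteq> tp L U b M"
    "\<And>a. a\<in>tuples n (carr U) \<Longrightarrow> \<Theta> \<subseteq> tp L U a M \<Longrightarrow> \<bar>\<mu> (defset U \<psi> a) - \<mu> (defset U \<psi> b)\<bar> < 1"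
    using locally_determined[OF def \<psi> b] by auto
  have \<Theta>': "set c \<subseteq> M" "wf_fm L (n + length c) \<theta>" "sat U \<theta> (b @ c)" if "(\<theta>, c) \<in> \<Theta>" for \<theta> c
    using \<Theta>(2) that tuplesD(1)[OF b] by (auto simp: tp_def params_def)
  have same: "gen (sat U \<psi>) a \<longleftrightarrow> gen (sat U \<psi>) b"
    if a: "a \<in> tuples n (carr U)" and "\<And>\<theta> c. (\<theta>, c) \<in> \<Theta> \<Longrightarrow> sat U \<theta> (a @ c)" for a
  proof -
    have "\<Theta> \<subseteq> tp L U a M"
    proof (rule subsetI, clarify)
      fix \<theta> c assume i: "(\<theta>, c) \<in> \<Theta>"
      show "(\<theta>, c) \<in> tp L U a M"
        using that(2)[OF i] \<Theta>'[OF i] tuplesD(1)[OF a] by (simp add: tp_def params_def)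
    qed
    from \<Theta>(3)[OF a this] show ?thesis unfolding mu_gen[OF \<psi> a] mu_gen[OF \<psi> b] by (auto simp: of_bool_def split: if_splits)
  qed
  obtain \<F> where \<F>12: "\<F> \<noteq> bot" "\<forall>\<^sub>F h in \<F>. h \<in> tuples n (R M)"
    and \<F>3: "\<forall>\<psi> c \<epsilon>. set c \<subseteq> R M \<longrightarrow> wf_fm L (n + length c) \<psi> \<longrightarrow> 0 < (\<epsilon>::real) \<longrightarrow>
      (\<forall>\<^sub>F h in \<F>. \<bar>pr (sat U \<psi>) (h @ c) - mpred C \<psi> (?g @ map E c)\<bar> < \<epsilon>)"
    using approximating_filter[OF elem_range_M g] by (elim exE conjE)
  note \<F> = \<F>12 \<F>3[rule_format]
  have lim: "((\<lambda>h. Pval p \<psi> (map E h)) \<longlongrightarrow> Pval p \<psi> ?g) \<F>"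
    by (rule canl[OF \<F>(1,2) limitin_ctp_from_pr[OF elem_range_M g \<F>(2,3)]])
  have "\<bar>Pval p \<psi> ?g - of_bool (gen (sat U \<psi>) b)\<bar> \<le> 0 + \<epsilon>" if \<epsilon>: "0 < \<epsilon>" for \<epsilon>
  proof -
    define \<eta> where "\<eta> = \<epsilon> / 2 / (real (card \<Theta>) + 1)"
    have \<eta>: "0 < \<eta>" using \<epsilon> by (simp add: \<eta>_def)
    have "\<forall>\<^sub>F h in \<F>. \<bar>pr (sat U \<theta>) (h @ K c) - mpred C \<theta> (?g @ map E (K c))\<bar> < \<eta>" if "(\<theta>, c) \<in> \<Theta>" for \<theta> c
      using \<Theta>'[OF that] \<eta> K_R[of c M] by (intro \<F>(3)) (auto simp: tuples_def)
    then have "\<forall>\<^sub>F h in \<F>. \<forall>(\<theta>, c)\<in>\<Theta>. \<bar>pr (sat U \<theta>) (h @ K c) - mpred C \<theta> (?g @ map E (K c))\<bar> < \<eta>"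
      using \<Theta>(1) by (subst eventually_ball_finite_distrib) auto
    moreover have "\<forall>\<^sub>F h in \<F>. dist (Pval p \<psi> (map E h)) (Pval p \<psi> ?g) < \<epsilon> / 2"
      using lim \<epsilon> by (intro tendstoD) auto
    ultimately have "\<forall>\<^sub>F h in \<F>. h \<in> tuples n (R M) \<and> (\<forall>(\<theta>, c)\<in>\<Theta>. \<bar>pr (sat U \<theta>) (h @ K c) - mpred C \<theta> (?g @ map E (K c))\<bar> < \<eta>) \<and>
        dist (Pval p \<psi> (map E h)) (Pval p \<psi> ?g) < \<epsilon> / 2"
      using \<F>(2) by eventually_elim auto
    then obtain h where h: "h \<in> tuples n (R M)" "dist (Pval p \<psi> (map E h)) (Pval p \<psi> ?g) < \<epsilon> / 2"
      "\<And>\<theta> c. (\<theta>, c) \<in> \<Theta> \<Longrightarrow> \<bar>pr (sat U \<theta>) (h @ K c) - mpred C \<theta> (?g @ map E (K c))\<bar> < \<eta>"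
      using eventually_happens'[OF \<F>(1)] by fastforce
    have h0: "h \<in> tuples n R0" using elem_range_tuples[OF elem_range_M h(1)] .
    let ?bad = "\<lambda>(\<theta>, c). {\<omega>\<in>space \<Omega>. \<not> sat U \<theta> (vals h \<omega> @ c)}"
    let ?B = "\<Union>i\<in>\<Theta>. ?bad i"
    have bad_sets: "?bad i \<in> sets \<Omega>" for i
      using vals_sets[OF h0, of "\<lambda>z. \<not> sat U (fst i) (z @ snd i)"] by (simp add: case_prod_beta)
    have bad: "prob (?bad (\<theta>, c)) \<le> \<eta>" if i: "(\<theta>, c) \<in> \<Theta>" for \<theta> c
    proof -
      have bc: "b @ c \<in> tuples (n + length c) (carr U)" using b \<Theta>'(1)[OF i] M by (auto simp: tuples_def)
      have s: "{\<omega>\<in>space \<Omega>. sat U \<theta> (vals h \<omega> @ c)} \<in> sets \<Omega>" using vals_sets[OF h0, of "\<lambda>z. sat U \<theta> (z @ c)"] .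
      have "mpred C \<theta> (?g @ map E (K c)) = mpred C \<theta> (map (embc \<iota>) (b @ c))"
        by (simp only: map_append map_embc)
      also have "\<dots> = 1" using mpred_embc[OF \<Theta>'(2)[OF i] bc] \<Theta>'(3)[OF i] by simp
      finally have 1: "1 - pr (sat U \<theta>) (h @ K c) < \<eta>" using h(3)[OF i] by (simp add: abs_less_iff)
      have "?bad (\<theta>, c) = space \<Omega> - {\<omega>\<in>space \<Omega>. sat U \<theta> (vals h \<omega> @ c)}" by auto
      then have "prob (?bad (\<theta>, c)) = 1 - prob {\<omega>\<in>space \<Omega>. sat U \<theta> (vals h \<omega> @ c)}"
        using prob_compl[OF s] by simp
      also have "prob {\<omega>\<in>space \<Omega>. sat U \<theta> (vals h \<omega> @ c)} = pr (sat U \<theta>) (h @ K c)"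
        unfolding pr_def vals_append vals_K ..
      finally show ?thesis using 1 by simp
    qed
    have B: "?B \<in> sets \<Omega>" using \<Theta>(1) bad_sets by (intro sets.finite_UN) auto
    have "prob ?B \<le> (\<Sum>i\<in>\<Theta>. prob (?bad i))" using \<Theta>(1) bad_sets by (intro measure_UNION_le) auto
    also have "\<dots> \<le> (\<Sum>i\<in>\<Theta>. \<eta>)" using bad by (intro sum_mono) auto
    also have "\<dots> = card \<Theta> * \<eta>" by simp
    also have "\<dots> \<le> \<epsilon> / 2"
    proof -
      have "(real (card \<Theta>) + 1) * \<eta> = \<epsilon> / 2" unfolding \<eta>_def by (simp add: field_simps)
      then show ?thesis using \<eta> by (simp add: algebra_simps)
    qed
    finally have PB: "prob ?B \<le> \<epsilon> / 2" .
    let ?G = "{\<omega>\<in>space \<Omega>. gen (sat U \<psi>) (vals h \<omega>)}"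
    have G: "?G \<in> sets \<Omega>" using vals_sets[OF h0] .
    have off: "gen (sat U \<psi>) (vals h \<omega>) \<longleftrightarrow> gen (sat U \<psi>) b" if "\<omega> \<in> space \<Omega>" "\<omega> \<notin> ?B" for \<omega>
      using that by (intro same vals_tuples[OF h0]) auto
    have "\<bar>pr (gen (sat U \<psi>)) h - of_bool (gen (sat U \<psi>) b)\<bar> \<le> \<epsilon> / 2"
    proof (cases "gen (sat U \<psi>) b")
      case True
      have "1 - prob ?G = prob (space \<Omega> - ?G)" using prob_compl[OF G] by simp
      also have "\<dots> \<le> prob ?B" using B off True by (intro finite_measure_mono) auto
      finally show ?thesis using True PB by (simp add: pr_def)
    next
      case False
      have "prob ?G \<le> prob ?B" using B off False by (intro finite_measure_mono) auto
      then show ?thesis using False PB by (simp add: pr_def)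
    qed
    then show ?thesis using h(2) unfolding can0[OF h(1)] dist_real_def by linarith
  qed
  then have "\<bar>Pval p \<psi> ?g - of_bool (gen (sat U \<psi>) b)\<bar> \<le> 0" by (rule field_le_epsilon)
  then show "Pval p \<psi> ?g = \<mu> (defset U \<psi> b)" unfolding mu_gen[OF \<psi> b] by simp
qed

end

section \<open>Existence of the canonical extension\<close>

text \<open>Double counting: off \<open>B\<close> at most \<open>N\<close> of the events occur at the same time, and on \<open>B\<close>
  at most all of them.\<close>

lemma (in prob_space) sum_prob_le_of_count:
  assumes A: "finite A" "\<And>i. i \<in> A \<Longrightarrow> E i \<in> events" and B: "B \<in> events"
    and count: "\<And>\<omega>. \<omega> \<in> space M \<Longrightarrow> \<omega> \<notin> B \<Longrightarrow> card {i\<in>A. \<omega> \<in> E i} \<le> N"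
  shows "(\<Sum>i\<in>A. prob (E i)) \<le> real N + card A * prob B"
proof -
  have int: "integrable M (indicator S :: 'a \<Rightarrow> real)" if "S \<in> events" for S
    using that by (intro integrable_real_indicator) (auto simp: emeasure_eq_measure)
  have "(\<Sum>i\<in>A. prob (E i)) = (\<Sum>i\<in>A. \<integral>\<omega>. indicator (E i) \<omega> \<partial>M)"
    using A by (intro sum.cong refl) (simp add: sets.Int_space_eq2)
  also have "\<dots> = (\<integral>\<omega>. (\<Sum>i\<in>A. indicator (E i) \<omega>) \<partial>M)"
    using A int by (intro Bochner_Integration.integral_sum[symmetric]) auto
  also have "\<dots> \<le> (\<integral>\<omega>. real N + real (card A) * indicator B \<omega> \<partial>M)"
  proof (rule integral_mono)
    show "integrable M (\<lambda>\<omega>. \<Sum>i\<in>A. indicator (E i) \<omega> :: real)"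
      using A int by (intro Bochner_Integration.integrable_sum) auto
    show "integrable M (\<lambda>\<omega>. real N + real (card A) * indicator B \<omega>)"
      using int[OF B] by (intro Bochner_Integration.integrable_add integrable_mult_right) auto
    fix \<omega> assume \<omega>: "\<omega> \<in> space M"
    have "(\<Sum>i\<in>A. indicator (E i) \<omega> :: real) = (\<Sum>i\<in>{i\<in>A. \<omega> \<in> E i}. 1)"
      using A(1) by (intro sum.mono_neutral_cong_right) auto
    also have "\<dots> = card {i\<in>A. \<omega> \<in> E i}" by simp
    also have "\<dots> \<le> real N + real (card A) * indicator B \<omega>"
    proof (cases "\<omega> \<in> B")
      case True
      have "card {i\<in>A. \<omega> \<in> E i} \<le> card A" using A(1) by (intro card_mono) auto
      then show ?thesis using True by simp
    next
      case False
      then show ?thesis using count[OF \<omega>] by simp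
    qed
    finally show "(\<Sum>i\<in>A. indicator (E i) \<omega> :: real) \<le> real N + real (card A) * indicator B \<omega>" .
  qed
  also have "\<dots> = real N + card A * prob B"
    using B int[OF B] by (simp add: prob_space sets.Int_space_eq2)
  finally show ?thesis .
qed

locale stable_setting = rand_setting L U \<kappa> M \<mu> \<Omega> C \<iota>
  for L :: "('f, 'r) lang" and U :: "('u, 'f, 'r) struct" and \<kappa> :: "'k rel" and M :: "'u set"
    and \<mu> :: "'u set \<Rightarrow> real" and \<Omega> :: "'w measure" and C :: "('c, ('f, 'r) fm) mstruct"
    and \<iota> :: "(nat \<Rightarrow> 'w \<Rightarrow> 'u) \<Rightarrow> 'c" +
  assumes gs: "generically_stable L U M \<mu>"
begin

text \<open>The defining scheme of \<open>\<mu>\<close>: for \<open>\<phi>(x;y)\<close> with \<open>n\<close> variables \<open>y\<close>, a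
  formula with parameters from \<open>M\<close> that defines the set of those \<open>y\<close> for which
  \<open>\<phi>(x;y)\<close> belongs to \<open>\<mu>\<close>.\<close>

definition scheme :: "('f, 'r) fm \<Rightarrow> nat \<Rightarrow> ('f, 'r) fm \<times> 'u list" where
  "scheme \<phi> n = (SOME (\<psi>, c). set c \<subseteq> M \<and> wf_fm L (n + length c) \<psi> \<and>
    (\<forall>e\<in>tuples n (carr U). gen (sat U \<phi>) e \<longleftrightarrow> sat U \<psi> (e @ c)))"

abbreviation sfm where "sfm \<phi> n \<equiv> fst (scheme \<phi> n)"
abbreviation spar where "spar \<phi> n \<equiv> snd (scheme \<phi> n)"

lemma scheme:
  assumes "wf_fm L (Suc n) \<phi>"
  shows "set (spar \<phi> n) \<subseteq> M" "wf_fm L (n + length (spar \<phi> n)) (sfm \<phi> n)"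
    "e \<in> tuples n (carr U) \<Longrightarrow> gen (sat U \<phi>) e \<longleftrightarrow> sat U (sfm \<phi> n) (e @ spar \<phi> n)"
proof -
  have "\<exists>\<theta>. case \<theta> of (\<psi>, c) \<Rightarrow> set c \<subseteq> M \<and> wf_fm L (n + length c) \<psi> \<and>
    (\<forall>e\<in>tuples n (carr U). gen (sat U \<phi>) e \<longleftrightarrow> sat U \<psi> (e @ c))"
    using gen_definable[OF gs assms] unfolding definable_def by auto
  from someI_ex[OF this]
  have "case scheme \<phi> n of (\<psi>, c) \<Rightarrow> set c \<subseteq> M \<and> wf_fm L (n + length c) \<psi> \<and>
    (\<forall>e\<in>tuples n (carr U). gen (sat U \<phi>) e \<longleftrightarrow> sat U \<psi> (e @ c))"
    unfolding scheme_def .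
  then show "set (spar \<phi> n) \<subseteq> M" "wf_fm L (n + length (spar \<phi> n)) (sfm \<phi> n)"
    "e \<in> tuples n (carr U) \<Longrightarrow> gen (sat U \<phi>) e \<longleftrightarrow> sat U (sfm \<phi> n) (e @ spar \<phi> n)"
    by (auto simp: case_prod_beta)
qed

text \<open>The probability that the canonical extension has to give to \<open>\<phi>(x;g)\<close>: that of the definition
  of \<open>\<phi>\<close> at \<open>g\<close>.\<close>

definition val :: "('f, 'r) fm \<Rightarrow> 'c list \<Rightarrow> real" where
  "val \<phi> g = mpred C (sfm \<phi> (length g)) (g @ map (embc \<iota>) (spar \<phi> (length g)))"

lemma val_eq: "g \<in> tuples n A \<Longrightarrow> val \<phi> g = mpred C (sfm \<phi> n) (g @ map E (K (spar \<phi> n)))"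
  by (simp add: val_def map_embc tuplesD)

lemma K_par: "wf_fm L (Suc n) \<phi> \<Longrightarrow> K (spar \<phi> n) \<in> tuples (length (spar \<phi> n)) (R M)"
  by (intro K_R scheme)

lemma pr_scheme:
  assumes "wf_fm L (Suc n) \<phi>" "h \<in> tuples n R0"
  shows "pr (sat U (sfm \<phi> n)) (h @ K (spar \<phi> n)) = pr (gen (sat U \<phi>)) h"
  unfolding pr_def vals_append vals_K
  using scheme(3)[OF assms(1) vals_tuples[OF assms(2)]] by (intro arg_cong[where f=prob]) auto

lemma val_E:
  assumes "wf_fm L (Suc n) \<phi>" "h \<in> tuples n R0"
  shows "val \<phi> (map E h) = pr (gen (sat U \<phi>)) h"
proof -
  have hk: "h @ K (spar \<phi> n) \<in> tuples (n + length (spar \<phi> n)) R0"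
    using tuples_append[OF assms(2) elem_range_tuples[OF elem_range_M K_par[OF assms(1)]]] .
  have "val \<phi> (map E h) = mpred C (sfm \<phi> n) (map E (h @ K (spar \<phi> n)))"
    using val_eq[OF E_tuples[OF assms(2)]] by simp
  also have "\<dots> = pr (sat U (sfm \<phi> n)) (h @ K (spar \<phi> n))" using scheme(2)[OF assms(1)] hk by (rule mpred_E)
  also have "\<dots> = pr (gen (sat U \<phi>)) h" by (rule pr_scheme[OF assms])
  finally show ?thesis .
qed

text \<open>One realization of \<open>\<mu>\<close> over the finitely many values of \<open>h\<close>, taken as a constant random
  element, has the prescribed probabilities exactly.\<close>

lemma realize_values_simple:
  assumes h: "h \<in> tuples m R0"
  shows "\<exists>f\<in>R0. \<forall>n \<phi> js. wf_fm L (Suc n) \<phi> \<longrightarrow> set js \<subseteq> {..<m} \<longrightarrow> length js = n \<longrightarrow>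
    pr (sat U \<phi>) (f # map ((!) h) js) = pr (gen (sat U \<phi>)) (map ((!) h) js)"
proof -
  define A where "A = (\<Union>\<omega>\<in>space \<Omega>. set (vals h \<omega>))"
  have "A = \<Union> (set ` (vals h ` space \<Omega>))" unfolding A_def by (simp only: image_image)
  moreover have "finite (\<Union> (set ` (vals h ` space \<Omega>)))" using finite_imageI[OF finite_vals[OF h], of set] by (rule finite_Union) auto
  ultimately have "finite A" by (simp only:)
  moreover have AU: "A \<subseteq> carr U" using vals_tuples[OF h] by (auto simp: A_def tuples_def)
  ultimately obtain a where a: "a \<in> carr U" "realizes_on L U a \<mu> A"
    using ex_realization[OF AU small_countable[OF uncountable]] countable_finite by blast
  show ?thesis
  proof (intro bexI[of _ "\<lambda>_. a"] allI impI)
    show "(\<lambda>_. a) \<in> R0" using a(1) by (simp add: R0_iff image_subset_iff)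
    fix n \<phi> js assume \<phi>: "wf_fm L (Suc n) \<phi>" and js: "set js \<subseteq> {..<m}" "length js = n"
    show "pr (sat U \<phi>) ((\<lambda>_. a) # map ((!) h) js) = pr (gen (sat U \<phi>)) (map ((!) h) js)"
    proof (rule pr_cong)
      fix \<omega> assume \<omega>: "\<omega> \<in> space \<Omega>"
      have "vals (map ((!) h) js) \<omega> \<in> tuples n A"
      proof -
        have "(h ! i) \<omega> \<in> A" if "i \<in> set js" for i
        proof -
          have "h ! i \<in> set h" using that js(1) tuplesD(1)[OF h] by auto
          then show ?thesis using \<omega> by (auto simp: A_def)
        qed
        then show ?thesis using js(2) by (auto simp: tuples_def)
      qed
      then have "sat U \<phi> (a # vals (map ((!) h) js) \<omega>) \<longleftrightarrow> gen (sat U \<phi>) (vals (map ((!) h) js) \<omega>)"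
        using a AU by (intro realizes_on_definable[OF _ _ definable_sat[OF \<phi>], where A=A]) auto
      then show "sat U \<phi> (vals ((\<lambda>_. a) # map ((!) h) js) \<omega>) = gen (sat U \<phi>) (vals (map ((!) h) js) \<omega>)"
        by simp
    qed
  qed
qed

text \<open>The infimum over \<open>x\<close> of the deviation from the prescribed values is a continuous formula in
  the parameters \<open>zs\<close>. The parameters are approximated by a simple tuple that gives almost the
  same value to this infimum (by quantifier elimination) and to the prescribed probabilities; for the
  simple tuple the infimum is small.\<close>

lemma realize_values:
  assumes Q: "finite Q" "\<And>\<phi> g. (\<phi>, g) \<in> Q \<Longrightarrow> wf_fm L (Suc (length g)) \<phi> \<and> set g \<subseteq> mcarr C"
    and \<epsilon>: "0 < (\<epsilon>::real)"
  shows "\<exists>x\<in>mcarr C. \<forall>(\<phi>, g)\<in>Q. \<bar>mpred C \<phi> (x # g) - val \<phi> g\<bar> < \<epsilon>"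
proof -
  have "finite (\<Union>(\<phi>, g)\<in>Q. set g)" using Q(1) by auto
  then obtain zs where zs: "set zs = (\<Union>(\<phi>, g)\<in>Q. set g)" using finite_list by metis
  define m where "m = length zs"
  have zsC: "zs \<in> tuples m (mcarr C)" using zs Q(2) by (intro tuplesI) (fastforce simp: m_def)+
  obtain pos where pos': "\<And>g. set g \<subseteq> set zs \<Longrightarrow> set (pos g) \<subseteq> {..<m} \<and>
    map ((!) zs) (pos g) = g \<and> length (pos g) = length g"
    using ex_positions[of zs] unfolding m_def by blast
  have pos: "set (pos g) \<subseteq> {..<m}" "map ((!) zs) (pos g) = g" and lpos: "length (pos g) = length g"
    if "(\<phi>, g) \<in> Q" for \<phi> g
    using pos'[of g] that unfolding zs by blast+
  obtain qs where qs: "set qs = Q" using finite_list[OF Q(1)] by auto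
  define \<Phi> where "\<Phi> = map (\<lambda>(\<phi>, g). (CPred \<phi> (0 # map Suc (pos g)), val \<phi> g)) qs"
  define N where "N = length \<Phi>"
  have at_eval: "ceval C (CPred \<phi> (0 # map Suc (pos g))) (x # d) = mpred C \<phi> (x # map ((!) d) (pos g))" for \<phi> g x d
    by (simp add: comp_def)
  have dev_wf: "cwf (LR L) (deviation \<Phi>) (Suc m)"
  proof (rule deviation_wf)
    fix \<theta> r assume "(\<theta>, r) \<in> set \<Phi>"
    then obtain \<phi> g where i: "(\<phi>, g) \<in> Q" "\<theta> = CPred \<phi> (0 # map Suc (pos g))" by (auto simp: \<Phi>_def qs)
    show "cwf (LR L) \<theta> (Suc m)" using Q(2)[OF i(1)] pos(1)[OF i(1)] lpos[OF i(1)] i(2) by (auto simp: LR_def)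
  qed
  then have chi_wf: "cwf (LR L) (CInf (deviation \<Phi>)) m" by simp
  \<comment> \<open>below 1 the truncation in the deviation has no effect; the \<open>N\<close> conditions and the transfer of the infimum each cost \<open>\<eta>\<close>\<close>
  define \<eta> where "\<eta> = min \<epsilon> 1 / (real N + 2)"
  have \<eta>: "0 < \<eta>" using \<epsilon> by (simp add: \<eta>_def)
  have N\<eta>: "N * \<eta> + \<eta> < min \<epsilon> 1"
  proof -
    have "N * \<eta> + \<eta> < (real N + 2) * \<eta>" using \<eta> by (simp add: algebra_simps)
    also have "\<dots> = min \<epsilon> 1" by (simp add: \<eta>_def)
    finally show ?thesis .
  qed
  obtain \<Psi> \<delta> where \<Psi>: "finite \<Psi>" "\<forall>\<psi>\<in>\<Psi>. wf_fm L m \<psi>" "0 < (\<delta>::real)"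
    "\<And>e e'. e\<in>tuples m (mcarr C) \<Longrightarrow> e'\<in>tuples m (mcarr C) \<Longrightarrow> \<forall>\<psi>\<in>\<Psi>. \<bar>mpred C \<psi> e - mpred C \<psi> e'\<bar> < \<delta> \<Longrightarrow>
      \<bar>ceval C (CInf (deviation \<Phi>)) e - ceval C (CInf (deviation \<Phi>)) e'\<bar> \<le> \<eta>"
    using quantifier_elimination[OF chi_wf \<eta>] by auto
  have \<delta>\<eta>: "0 < min \<delta> \<eta>" using \<eta> \<Psi>(3) by simp
  define P where "P = (\<lambda>\<psi>. (\<psi>, [0..<m], [])) ` \<Psi> \<union>
    (\<lambda>(\<phi>, g). (sfm \<phi> (length g), pos g, K (spar \<phi> (length g)))) ` Q"
  have "finite P" using \<Psi>(1) Q(1) by (simp add: P_def)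
  moreover have "set js \<subseteq> {..<m} \<and> set c \<subseteq> R M \<and> wf_fm L (length js + length c) \<psi>" if "(\<psi>, js, c) \<in> P" for \<psi> js c
    using that unfolding P_def
  proof
    assume "(\<psi>, js, c) \<in> (\<lambda>\<psi>. (\<psi>, [0..<m], [])) ` \<Psi>"
    then show ?thesis using \<Psi>(2) by auto
  next
    assume "(\<psi>, js, c) \<in> (\<lambda>(\<phi>, g). (sfm \<phi> (length g), pos g, K (spar \<phi> (length g)))) ` Q"
    then obtain \<phi> g where i: "(\<phi>, g) \<in> Q" "\<psi> = sfm \<phi> (length g)" "js = pos g" "c = K (spar \<phi> (length g))" by auto
    have \<phi>: "wf_fm L (Suc (length g)) \<phi>" using Q(2)[OF i(1)] by blast
    show ?thesis using pos(1)[OF i(1)] scheme(2)[OF \<phi>] K_par[OF \<phi>] lpos[OF i(1)] i(2-4) by (simp add: tuples_def)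
  qed
  ultimately obtain h where h: "h\<in>tuples m (R M)"
    "\<And>\<psi> js c. (\<psi>, js, c)\<in>P \<Longrightarrow> \<bar>pr (sat U \<psi>) (map ((!) h) js @ c) - mpred C \<psi> (map ((!) zs) js @ map E c)\<bar> < min \<delta> \<eta>"
    using approximate_pr[OF elem_range_M zsC \<delta>\<eta>, of P] by fast
  have h0: "h \<in> tuples m R0" using elem_range_tuples[OF elem_range_M h(1)] .
  have hC: "map E h \<in> tuples m (mcarr C)" using E_tuples[OF h0] .
  have "\<bar>mpred C \<psi> (map E h) - mpred C \<psi> zs\<bar> < \<delta>" if \<psi>: "\<psi> \<in> \<Psi>" for \<psi>
  proof -
    have "(\<psi>, [0..<m], []) \<in> P" using \<psi> by (simp add: P_def)
    from h(2)[OF this] show ?thesis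
      using mpred_E[OF _ h0, of \<psi>] \<Psi>(2) \<psi> unfolding map_nth_id[OF zsC] map_nth_id[OF h0] by simp
  qed
  then have chi: "\<bar>ceval C (CInf (deviation \<Phi>)) (map E h) - ceval C (CInf (deviation \<Phi>)) zs\<bar> \<le> \<eta>"
    using \<Psi>(4)[OF hC zsC] by blast
  obtain f where f: "f \<in> R0" "\<And>n \<phi> js. wf_fm L (Suc n) \<phi> \<Longrightarrow> set js \<subseteq> {..<m} \<Longrightarrow> length js = n \<Longrightarrow>
    pr (sat U \<phi>) (f # map ((!) h) js) = pr (gen (sat U \<phi>)) (map ((!) h) js)"
    using realize_values_simple[OF h0] by blast
  have near: "\<bar>ceval C \<theta> (E f # map E h) - r\<bar> \<le> \<eta>" if "(\<theta>, r) \<in> set \<Phi>" for \<theta> r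
  proof -
    obtain \<phi> g where i: "(\<phi>, g) \<in> Q" "\<theta> = CPred \<phi> (0 # map Suc (pos g))" "r = val \<phi> g"
      using \<open>(\<theta>, r) \<in> set \<Phi>\<close> by (auto simp: \<Phi>_def qs)
    have \<phi>: "wf_fm L (Suc (length g)) \<phi>" using Q(2)[OF i(1)] by blast
    let ?g = "map ((!) h) (pos g)"
    have g0: "?g \<in> tuples (length g) R0" using select_tuples[OF h0 pos(1)[OF i(1)]] lpos[OF i(1)] by simp
    have fg: "f # ?g \<in> tuples (Suc (length g)) R0" using f(1) g0 by simp
    have "map ((!) (map E h)) (pos g) = map E ?g" using pos(1)[OF i(1)] tuplesD(1)[OF h0] by auto
    then have "ceval C \<theta> (E f # map E h) = mpred C \<phi> (map E (f # ?g))"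
      unfolding i(2) at_eval by (simp only: list.map)
    also have "\<dots> = pr (sat U \<phi>) (f # ?g)" by (rule mpred_E[OF \<phi> fg])
    also have "\<dots> = pr (gen (sat U \<phi>)) ?g" using f(2)[OF \<phi> pos(1)[OF i(1)] lpos[OF i(1)]] .
    also have "\<dots> = pr (sat U (sfm \<phi> (length g))) (?g @ K (spar \<phi> (length g)))" using pr_scheme[OF \<phi> g0] by simp
    finally have 1: "ceval C \<theta> (E f # map E h) = pr (sat U (sfm \<phi> (length g))) (?g @ K (spar \<phi> (length g)))" .
    have "(sfm \<phi> (length g), pos g, K (spar \<phi> (length g))) \<in> P" using i(1) by (force simp: P_def)
    from h(2)[OF this] show ?thesis
      unfolding 1 i(3) val_def map_embc pos(2)[OF i(1)] by simp
  qed
  have "ceval C (deviation \<Phi>) (E f # map E h) \<le> (\<Sum>i<length \<Phi>. \<bar>ceval C (fst (\<Phi> ! i)) (E f # map E h) - snd (\<Phi> ! i)\<bar>)"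
    by (simp add: deviation_eval)
  also have "\<dots> \<le> (\<Sum>i<length \<Phi>. \<eta>)"
    using near by (intro sum_mono) (auto simp del: ceval.simps)
  finally have dev: "ceval C (deviation \<Phi>) (E f # map E h) \<le> N * \<eta>" by (simp add: N_def)
  have dev01: "ceval C (deviation \<Phi>) (x # d) \<in> {0..1}" if "x \<in> mcarr C" "d \<in> tuples m (mcarr C)" for x d
    using ceval01[OF dev_wf] that by simp
  have bdd: "bdd_below ((\<lambda>x. ceval C (deviation \<Phi>) (x # d)) ` mcarr C)" if "d \<in> tuples m (mcarr C)" for d
    using dev01[OF _ that] by (intro bdd_belowI[of _ 0]) auto
  have "ceval C (CInf (deviation \<Phi>)) (map E h) \<le> N * \<eta>"
    using cINF_lower[OF bdd[OF hC] E_mcarr[OF f(1)]] dev by simp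
  then have "ceval C (CInf (deviation \<Phi>)) zs < min \<epsilon> 1" using chi N\<eta> by linarith
  then obtain x where x: "x \<in> mcarr C" "ceval C (deviation \<Phi>) (x # zs) < min \<epsilon> 1"
    using cINF_less_iff[OF ne bdd[OF zsC], of "min \<epsilon> 1"] unfolding ceval.simps by blast
  show ?thesis
  proof (intro bexI[OF _ x(1)] ballI, clarify)
    fix \<phi> g assume i: "(\<phi>, g) \<in> Q"
    then have "(CPred \<phi> (0 # map Suc (pos g)), val \<phi> g) \<in> set \<Phi>" by (force simp: \<Phi>_def qs)
    from deviation_less[OF x(2) _ this] show "\<bar>mpred C \<phi> (x # g) - val \<phi> g\<bar> < \<epsilon>"
      unfolding at_eval pos(2)[OF i] by simp
  qed
qed

text \<open>By compactness. The conditions only ask for errors below \<open>1 / (k + 1)\<close>, because finitely many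
  prescribed probabilities are realized approximately; all \<open>k\<close> together give the exact value at a
  cluster point.\<close>

lemma ex_type: "\<exists>p\<in>rtypes. \<forall>n \<phi> g. wf_fm L (Suc n) \<phi> \<longrightarrow> g \<in> tuples n (mcarr C) \<longrightarrow> Pval p \<phi> g = val \<phi> g"
proof -
  define v where "v x \<theta> = (if \<theta> \<in> cparams (LR L) 1 (mcarr C) \<and> x \<in> mcarr C then ceval C (fst \<theta>) (x # snd \<theta>) else 0)" for x \<theta>
  define J where "J = {(\<phi>, g, k::nat). wf_fm L (Suc (length g)) \<phi> \<and> set g \<subseteq> mcarr C}"
  define P where "P j x \<longleftrightarrow> (case j of (\<phi>, g, k) \<Rightarrow> \<bar>mpred C \<phi> (x # g) - val \<phi> g\<bar> < 1 / real (Suc k))" for j x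
  have v01: "v x \<theta> \<in> {0..1}" for x \<theta>
  proof (cases "\<theta> \<in> cparams (LR L) 1 (mcarr C) \<and> x \<in> mcarr C")
    case True
    then have "cwf (LR L) (fst \<theta>) (Suc (length (snd \<theta>)))" "x # snd \<theta> \<in> tuples (Suc (length (snd \<theta>))) (mcarr C)"
      by (auto simp: cparams_def tuples_def)
    from ceval01[OF this] show ?thesis using True by (simp add: v_def)
  next
    case False
    then have "v x \<theta> = 0" unfolding v_def by (rule if_not_P)
    then show ?thesis by simp
  qed
  have fip: "\<exists>x\<in>mcarr C. \<forall>j\<in>J0. P j x" if J0: "finite J0" "J0 \<subseteq> J" for J0
  proof -
    define \<epsilon> where "\<epsilon> = Min (insert 1 ((\<lambda>(\<phi>, g, k). 1 / real (Suc k)) ` J0))"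
    have \<epsilon>: "0 < \<epsilon>" using J0(1) by (auto simp: \<epsilon>_def)
    have le: "\<epsilon> \<le> 1 / real (Suc k)" if "(\<phi>, g, k) \<in> J0" for \<phi> g k
      unfolding \<epsilon>_def using J0(1) that by (intro Min_le) force+
    have "\<exists>x\<in>mcarr C. \<forall>(\<phi>, g)\<in>(\<lambda>(\<phi>, g, k). (\<phi>, g)) ` J0. \<bar>mpred C \<phi> (x # g) - val \<phi> g\<bar> < \<epsilon>"
      using J0 by (intro realize_values[OF _ _ \<epsilon>]) (auto simp: J_def)
    then obtain x where x: "x \<in> mcarr C" "\<And>\<phi> g k. (\<phi>, g, k) \<in> J0 \<Longrightarrow> \<bar>mpred C \<phi> (x # g) - val \<phi> g\<bar> < \<epsilon>"
      by fastforce
    show ?thesis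
      using x(1) less_le_trans[OF x(2) le] by (intro bexI[of _ x]) (auto simp: P_def)
  qed
  obtain p where p: "\<And>I J0 e. finite I \<Longrightarrow> finite J0 \<Longrightarrow> J0 \<subseteq> J \<Longrightarrow> e > 0 \<Longrightarrow>
      \<exists>x\<in>mcarr C. (\<forall>j\<in>J0. P j x) \<and> (\<forall>i\<in>I. \<bar>v x i - p i\<bar> < e)"
    using cluster_point_of_consistent_conditions[of v J "mcarr C" P, OF v01 fip] by metis
  define q where "q = restrict p (cparams (LR L) 1 (mcarr C))"
  have "q \<in> rtypes"
    unfolding ctypes_def
  proof (intro CollectI conjI allI impI)
    show "q \<in> extensional (cparams (LR L) 1 (mcarr C))" by (simp add: q_def)
    fix F and \<epsilon> :: real assume F: "finite F \<and> F \<subseteq> cparams (LR L) 1 (mcarr C) \<and> 0 < \<epsilon>"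
    then obtain x where x: "x\<in>mcarr C" "\<forall>i\<in>F. \<bar>v x i - p i\<bar> < \<epsilon>" using p[of F "{}" \<epsilon>] by auto
    show "\<exists>b\<in>tuples 1 (mcarr C). \<forall>(\<phi>, c)\<in>F. \<bar>ceval C \<phi> (b @ c) - q (\<phi>, c)\<bar> < \<epsilon>"
    proof (intro bexI[of _ "[x]"] ballI, clarify)
      fix \<phi> c assume i: "(\<phi>, c) \<in> F"
      then have "(\<phi>, c) \<in> cparams (LR L) 1 (mcarr C)" using F by blast
      then have "v x (\<phi>, c) = ceval C \<phi> ([x] @ c)" "q (\<phi>, c) = p (\<phi>, c)" using x(1) by (auto simp: v_def q_def)
      then show "\<bar>ceval C \<phi> ([x] @ c) - q (\<phi>, c)\<bar> < \<epsilon>" using bspec[OF x(2) i] by simp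
    qed (use x(1) in \<open>simp add: tuples_def\<close>)
  qed
  moreover have "Pval q \<phi> g = val \<phi> g" if \<phi>: "wf_fm L (Suc n) \<phi>" and g: "g \<in> tuples n (mcarr C)" for n \<phi> g
  proof -
    let ?\<theta> = "(CPred \<phi> [0..<Suc n], g)"
    have \<theta>: "?\<theta> \<in> cparams (LR L) 1 (mcarr C)"
      using cwf_pred[OF \<phi>] g by (simp add: cparams_def tuples_def del: cwf.simps upt_Suc)
    have "\<bar>val \<phi> g - Pval q \<phi> g\<bar> \<le> 0 + \<epsilon>" if \<epsilon>: "0 < \<epsilon>" for \<epsilon>
    proof -
      obtain k where k: "1 / real (Suc k) < \<epsilon> / 2"
        using reals_Archimedean[of "\<epsilon> / 2"] \<epsilon> by (auto simp: inverse_eq_divide)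
      have "{(\<phi>, g, k)} \<subseteq> J" using \<phi> g by (auto simp: J_def tuples_def)
      then obtain x where x: "x\<in>mcarr C" "P (\<phi>, g, k) x" "\<bar>v x ?\<theta> - p ?\<theta>\<bar> < \<epsilon> / 2"
        using p[of "{?\<theta>}" "{(\<phi>, g, k)}" "\<epsilon> / 2"] \<epsilon> by auto
      have "v x ?\<theta> = ceval C (CPred \<phi> [0..<Suc n]) (x # g)" using \<theta> x(1) by (simp add: v_def del: ceval.simps upt_Suc)
      also have "\<dots> = mpred C \<phi> (x # g)" using tuplesD(1)[OF g] by (intro ceval_pred) simp
      finally have 1: "\<bar>mpred C \<phi> (x # g) - p ?\<theta>\<bar> < \<epsilon> / 2" using x(3) by simp
      have "Pval q \<phi> g = p ?\<theta>" unfolding Pval_eq[OF g] q_def using \<theta> by (rule restrict_apply')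
      moreover have "\<bar>mpred C \<phi> (x # g) - val \<phi> g\<bar> < 1 / real (Suc k)" using x(2) by (simp add: P_def)
      ultimately show ?thesis using 1 k by linarith
    qed
    then have "\<bar>val \<phi> g - Pval q \<phi> g\<bar> \<le> 0" by (rule field_le_epsilon)
    then show ?thesis by simp
  qed
  ultimately show ?thesis by blast
qed

end

section \<open>Generic stability of the canonical extension\<close>

context stable_setting
begin

text \<open>As the definition of \<open>\<phi>\<close> has its parameters in \<open>M\<close>, the prescribed probability at \<open>g\<close>
  is one of the values that make up the type of \<open>g\<close> over the simple elements of \<open>M\<^sup>\<Omega>\<close>, so it is
  preserved by limits of types.\<close>

lemma canonical:
  assumes p: "p \<in> rtypes" "\<And>n \<phi> g. wf_fm L (Suc n) \<phi> \<Longrightarrow> g \<in> tuples n (mcarr C) \<Longrightarrow> Pval p \<phi> g = val \<phi> g"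
  shows "canonical_extension L U M C \<Omega> \<iota> \<mu> p"
  unfolding canonical_extension_def Let_def
proof (intro conjI allI impI ballI p(1))
  fix n \<phi> assume \<phi>: "wf_fm L (Suc n) \<phi>"
  have simple: "Pval p \<phi> (map E g) = pr (gen (sat U \<phi>)) g" if "g \<in> tuples n (R M)" for g
    using p(2)[OF \<phi> E_tuples] val_E[OF \<phi>] elem_range_tuples[OF elem_range_M that] by simp
  show "Pval p \<phi> (map E g) = rmu0 U \<Omega> \<mu> \<phi> g" if "g \<in> tuples n (R M)" for g
    using simple[OF that] rmu0_pr[OF \<phi> elem_range_tuples[OF elem_range_M that]] by simp
  fix g \<F>
  assume g: "g \<in> tuples n (mcarr C)"
    and "\<F> \<noteq> bot \<and> (\<forall>\<^sub>F h in \<F>. h \<in> tuples n (R M)) \<and>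
        limitin (ctype_space (LR L) C n (E ` R M)) (\<lambda>h. ctp (LR L) C (map E h) (E ` R M)) (ctp (LR L) C g (E ` R M)) \<F>"
  then have \<F>: "\<forall>\<^sub>F h in \<F>. h \<in> tuples n (R M)"
    and lim: "limitin (ctype_space (LR L) C n (E ` R M)) (\<lambda>h. ctp (LR L) C (map E h) (E ` R M)) (ctp (LR L) C g (E ` R M)) \<F>"
    by auto
  have ev: "\<forall>\<^sub>F h in \<F>. map E h \<in> tuples n (mcarr C)"
    using \<F> by eventually_elim (intro E_tuples elem_range_tuples[OF elem_range_M])
  let ?c = "K (spar \<phi> n)"
  let ?l = "n + length (spar \<phi> n)"
  have c: "map E ?c \<in> tuples (length (spar \<phi> n)) (E ` R M)"
    using K_par[OF \<phi>] by (auto simp: tuples_def)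
  have cC: "map E ?c \<in> tuples (length (spar \<phi> n)) (mcarr C)"
    using E_tuples[OF elem_range_tuples[OF elem_range_M K_par[OF \<phi>]]] .
  have "(CPred (sfm \<phi> n) [0..<?l], map E ?c) \<in> cparams (LR L) n (E ` R M)"
    using cwf_pred[OF scheme(2)[OF \<phi>]] c by (simp add: cparams_def tuples_def del: cwf.simps)
  with lim[unfolded limitin_ctp[OF g ev]]
  have "((\<lambda>h. ceval C (CPred (sfm \<phi> n) [0..<?l]) (map E h @ map E ?c)) \<longlongrightarrow>
      ceval C (CPred (sfm \<phi> n) [0..<?l]) (g @ map E ?c)) \<F>" by blast
  moreover have val: "ceval C (CPred (sfm \<phi> n) [0..<?l]) (e @ map E ?c) = Pval p \<phi> e" if e: "e \<in> tuples n (mcarr C)" for e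
  proof -
    have "ceval C (CPred (sfm \<phi> n) [0..<?l]) (e @ map E ?c) = mpred C (sfm \<phi> n) (e @ map E ?c)"
      using tuplesD(1)[OF e] by (intro ceval_pred) simp
    then show ?thesis using val_eq[OF e] p(2)[OF \<phi> e] by simp
  qed
  ultimately have "((\<lambda>h. ceval C (CPred (sfm \<phi> n) [0..<?l]) (map E h @ map E ?c)) \<longlongrightarrow> Pval p \<phi> g) \<F>"
    by (simp only: val[OF g])
  then show "((\<lambda>h. Pval p \<phi> (map E h)) \<longlongrightarrow> Pval p \<phi> g) \<F>"
  proof (rule Lim_transform_eventually)
    show "\<forall>\<^sub>F h in \<F>. ceval C (CPred (sfm \<phi> n) [0..<?l]) (map E h @ map E ?c) = Pval p \<phi> (map E h)"
      using ev by eventually_elim (rule val)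
  qed
qed

text \<open>What is needed of a Morley sequence of the canonical extension: its probabilities over
  constants from \<open>M\<close> and earlier members.\<close>

definition cmorley :: "nat \<Rightarrow> (nat \<Rightarrow> 'c) \<Rightarrow> bool" where
  "cmorley m a \<longleftrightarrow> (\<forall>i<m. a i \<in> mcarr C \<and> (\<forall>n \<psi> c. wf_fm L (Suc n) \<psi> \<longrightarrow>
    c \<in> tuples n (embc \<iota> ` M \<union> a ` {..<i}) \<longrightarrow> mpred C \<psi> (a i # c) = val \<psi> c))"

lemma cmorley_subsequence:
  assumes "\<And>m. cmorley m a" "strict_mono_on {..<m} h"
  shows "cmorley m (a \<circ> h)"
  unfolding cmorley_def
proof (intro allI impI conjI)
  fix i assume i: "i < m"
  have "cmorley (Suc (h i)) a" by fact
  then have *: "a (h i) \<in> mcarr C" "\<And>n \<psi> c. wf_fm L (Suc n) \<psi> \<Longrightarrow>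
    c \<in> tuples n (embc \<iota> ` M \<union> a ` {..<h i}) \<Longrightarrow> mpred C \<psi> (a (h i) # c) = val \<psi> c"
    unfolding cmorley_def by blast+
  then show "(a \<circ> h) i \<in> mcarr C" by simp
  fix n \<psi> c assume \<psi>: "wf_fm L (Suc n) \<psi>" and c: "c \<in> tuples n (embc \<iota> ` M \<union> (a \<circ> h) ` {..<i})"
  have "(a \<circ> h) ` {..<i} \<subseteq> a ` {..<h i}"
    using assms(2) i by (auto simp: strict_mono_on_def)
  then have "c \<in> tuples n (embc \<iota> ` M \<union> a ` {..<h i})" by (intro subsetD[OF tuples_mono c] Un_mono order_refl)
  from *(2)[OF \<psi> this] show "mpred C \<psi> ((a \<circ> h) i # c) = val \<psi> c" by simp
qed

text \<open>Formulas over \<open>M\<close> hold of a random Morley sequence almost surely or almost never, according to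
  whether they hold of a classical one: replacing a formula by its definition removes the last member of
  either sequence.\<close>

lemma cmorley_value:
  assumes \<alpha>: "morley m \<alpha>"
  shows "cmorley m a \<Longrightarrow> wf_fm L (m + length c) \<theta> \<Longrightarrow> set c \<subseteq> M \<Longrightarrow>
    mpred C \<theta> (rev (map a [0..<m]) @ map (embc \<iota>) c) = of_bool (sat U \<theta> (rev (map \<alpha> [0..<m]) @ c))"
  using \<alpha>
proof (induction m arbitrary: \<theta> c)
  case 0
  then have "c \<in> tuples (length c) (carr U)" using M by (intro tuplesI) auto
  then show ?case using 0 by (simp add: mpred_embc)
next
  case (Suc m)
  let ?a = "rev (map a [0..<m])" and ?\<alpha> = "rev (map \<alpha> [0..<m])"
  let ?l = "m + length c"
  have m: "cmorley m a" "morley m \<alpha>" using Suc.prems by (auto simp: cmorley_def morley_def)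
  have \<theta>: "wf_fm L (Suc ?l) \<theta>" using Suc.prems by simp
  have am: "a m \<in> mcarr C" "\<And>n \<psi> d. wf_fm L (Suc n) \<psi> \<Longrightarrow>
    d \<in> tuples n (embc \<iota> ` M \<union> a ` {..<m}) \<Longrightarrow> mpred C \<psi> (a m # d) = val \<psi> d"
    using Suc.prems(1) unfolding cmorley_def by (auto dest: spec[of _ m])
  have t: "?a @ map (embc \<iota>) c \<in> tuples ?l (embc \<iota> ` M \<union> a ` {..<m})"
    using Suc.prems(3) by (auto simp: tuples_def)
  have "mpred C \<theta> (rev (map a [0..<Suc m]) @ map (embc \<iota>) c) = mpred C \<theta> (a m # ?a @ map (embc \<iota>) c)" by simp
  also have "\<dots> = val \<theta> (?a @ map (embc \<iota>) c)" by (rule am(2)[OF \<theta> t])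
  also have "\<dots> = mpred C (sfm \<theta> ?l) (?a @ map (embc \<iota>) (c @ spar \<theta> ?l))"
    using val_eq[OF t] by (simp add: map_embc)
  also have "\<dots> = of_bool (sat U (sfm \<theta> ?l) (?\<alpha> @ (c @ spar \<theta> ?l)))"
    using scheme(1,2)[OF \<theta>] Suc.prems(3) m by (intro Suc.IH) (simp_all add: add.assoc)
  also have "sat U (sfm \<theta> ?l) (?\<alpha> @ (c @ spar \<theta> ?l)) \<longleftrightarrow> gen (sat U \<theta>) (?\<alpha> @ c)"
    using scheme(3)[OF \<theta>, of "?\<alpha> @ c"] tuples_append[OF morley_carr[OF m(2)], of c "length c"] Suc.prems(3) M
    by (auto simp: tuples_def)
  also have "gen (sat U \<theta>) (?\<alpha> @ c) \<longleftrightarrow> sat U \<theta> (\<alpha> m # ?\<alpha> @ c)"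
  proof (rule realizes_on_definable[OF _ _ definable_sat[OF \<theta>], symmetric])
    show "\<alpha> m \<in> carr U" "realizes_on L U (\<alpha> m) \<mu> (M \<union> \<alpha> ` {..<m})" "M \<union> \<alpha> ` {..<m} \<subseteq> carr U"
      using Suc.prems(4) M by (auto simp: morley_def)
    show "?\<alpha> @ c \<in> tuples ?l (M \<union> \<alpha> ` {..<m})" using Suc.prems(3) by (auto simp: tuples_def)
  qed
  finally show ?case by simp
qed

text \<open>That no \<open>y\<close> makes all members disagree with \<open>\<mu>\<close> is expressible over \<open>M\<close> because
  \<open>\<mu>\<close> is definable, and true of classical Morley sequences, hence almost surely true of
  random ones.\<close>

lemma disagreement_formula:
  assumes \<psi>: "wf_fm L (Suc n) \<psi>"
  shows "\<exists>N \<theta> c. set c \<subseteq> M \<and> wf_fm L (N + length c) \<theta> \<and>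
    (\<forall>e\<in>tuples N (carr U). sat U \<theta> (e @ c) \<longleftrightarrow>
      \<not> (\<exists>y\<in>tuples n (carr U). \<forall>i<N. sat U \<psi> (e ! i # y) \<noteq> gen (sat U \<psi>) y)) \<and>
    (\<forall>a. cmorley N a \<longrightarrow> mpred C \<theta> (rev (map a [0..<N]) @ map (embc \<iota>) c) = 1)"
proof -
  obtain N where N: "\<And>a b. morley N a \<Longrightarrow> b \<in> tuples n (carr U) \<Longrightarrow>
    \<exists>i<N. sat U \<psi> (a i # b) \<longleftrightarrow> gen (sat U \<psi>) b" using generic_truth_value_attained[OF gs \<psi>] by blast
  define D where "D e \<longleftrightarrow> \<not> (\<exists>y\<in>tuples n (carr U). \<forall>i<N. sat U \<psi> (e ! i # y) \<noteq> gen (sat U \<psi>) y)" for e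
  \<comment> \<open>in \<open>D'\<close> the tuple \<open>y\<close> comes first, so that it can be quantified away\<close>
  define D' where "D' z \<longleftrightarrow> (\<forall>i\<in>{..<N}. \<not> (sat U \<psi> (map ((!) z) ((n + i) # [0..<n])) \<longleftrightarrow>
      gen (sat U \<psi>) (map ((!) z) [0..<n])))" for z
  have "definable L U M (n + N) D'"
    unfolding D'_def using definable_sat[OF \<psi>] gen_definable[OF gs \<psi>]
    by (intro definable_ball definable_neg definable_iff definable_ren) auto
  from definable_neg[OF definable_ex[OF this]] have "definable L U M N (\<lambda>e. \<not> (\<exists>y\<in>tuples n (carr U). D' (y @ e)))" .
  moreover have "D' (y @ e) \<longleftrightarrow> (\<forall>i<N. sat U \<psi> (e ! i # y) \<noteq> gen (sat U \<psi>) y)" if y: "y \<in> tuples n (carr U)" for y e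
  proof -
    have "map ((!) (y @ e)) [0..<n] = y"
      using tuplesD(1)[OF y] by (auto intro!: nth_equalityI simp: nth_append)
    moreover have "map ((!) (y @ e)) ((n + i) # [0..<n]) = e ! i # y" for i
      using map_nth_tail tuplesD(1)[OF y] .
    ultimately show ?thesis unfolding D'_def by (simp only: Ball_def lessThan_iff)
  qed
  ultimately have "definable L U M N D" unfolding D_def by simp
  then obtain \<theta> c where \<theta>: "set c \<subseteq> M" "wf_fm L (N + length c) \<theta>"
    "\<And>e. e \<in> tuples N (carr U) \<Longrightarrow> D e \<longleftrightarrow> sat U \<theta> (e @ c)" unfolding definable_def by blast
  obtain \<alpha> where \<alpha>: "\<And>m. morley m \<alpha>" using ex_morley by blast
  have "D (rev (map \<alpha> [0..<N]))"
    unfolding D_def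
  proof (rule notI, elim bexE)
    fix y assume y: "y \<in> tuples n (carr U)" and bad: "\<forall>i<N. sat U \<psi> (rev (map \<alpha> [0..<N]) ! i # y) \<noteq> gen (sat U \<psi>) y"
    obtain i where i: "i < N" "sat U \<psi> (\<alpha> i # y) \<longleftrightarrow> gen (sat U \<psi>) y" using N[OF \<alpha> y] by blast
    have "N - Suc i < N" using i(1) by simp
    with bad have "sat U \<psi> (rev (map \<alpha> [0..<N]) ! (N - Suc i) # y) \<noteq> gen (sat U \<psi>) y" by blast
    then show False using i nth_rev_map_upt[OF i(1), of \<alpha>] by simp
  qed
  then have sat: "sat U \<theta> (rev (map \<alpha> [0..<N]) @ c)" using \<theta>(3)[OF morley_carr[OF \<alpha>]] by simp
  show ?thesis
  proof (intro exI[of _ N] exI[of _ \<theta>] exI[of _ c] conjI ballI allI impI)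
    show "sat U \<theta> (e @ c) \<longleftrightarrow> \<not> (\<exists>y\<in>tuples n (carr U). \<forall>i<N. sat U \<psi> (e ! i # y) \<noteq> gen (sat U \<psi>) y)"
      if "e \<in> tuples N (carr U)" for e using \<theta>(3)[OF that] by (simp add: D_def)
    show "mpred C \<theta> (rev (map a [0..<N]) @ map (embc \<iota>) c) = 1" if "cmorley N a" for a
      using cmorley_value[OF \<alpha> that \<theta>(2,1)] sat by simp
  qed (use \<theta> in auto)
qed

text \<open>A simple approximation \<open>h\<close> of \<open>m\<close> members and of \<open>y\<close> has, outside a set of small
  probability, no \<open>N\<close> members that disagree with the definition at the same time, because the
  formula of the preceding lemma has probability close to 1 at each choice of \<open>N\<close> indices. Double
  counting bounds the sum of the probabilities of disagreement.\<close>

lemma disagreement_sum: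
  assumes \<psi>: "wf_fm L (Suc n) \<psi>"
  shows "\<exists>N::nat. \<forall>a y m. (\<forall>m. cmorley m a) \<longrightarrow> y \<in> tuples n (mcarr C) \<longrightarrow>
    (\<Sum>i<m. \<bar>mpred C \<psi> (a i # y) - val \<psi> y\<bar>) \<le> real N"
proof -
  obtain N \<theta> c where \<theta>: "set c \<subseteq> M" "wf_fm L (N + length c) \<theta>"
    "\<And>e. e \<in> tuples N (carr U) \<Longrightarrow> sat U \<theta> (e @ c) \<longleftrightarrow>
      \<not> (\<exists>y\<in>tuples n (carr U). \<forall>i<N. sat U \<psi> (e ! i # y) \<noteq> gen (sat U \<psi>) y)"
    "\<And>a. cmorley N a \<Longrightarrow> mpred C \<theta> (rev (map a [0..<N]) @ map (embc \<iota>) c) = 1"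
    using disagreement_formula[OF \<psi>] by auto
  show ?thesis
  proof (intro exI[of _ N] allI impI)
    fix a y m assume a': "\<forall>m. cmorley m a" and y: "y \<in> tuples n (mcarr C)"
    have a: "cmorley m a" for m using a' by blast
    have aC: "a i \<in> mcarr C" for i using a[of "Suc i"] by (simp add: cmorley_def)
    define e where "e = map a [0..<m] @ y"
    have e: "e \<in> tuples (m + n) (mcarr C)" unfolding e_def using aC y by (intro tuples_append) (auto simp: tuples_def)
    define yp where "yp = [m..<m + n]"
    define \<I> where "\<I> = {I. I \<subseteq> {..<m} \<and> card I = N}"
    have fin\<I>: "finite \<I>" unfolding \<I>_def by (rule finite_subset[of _ "Pow {..<m}"]) auto
    define idx where "idx I = rev (sorted_list_of_set I)" for I :: "nat set"
    have idx: "set (idx I) = I" "length (idx I) = N" if "I \<in> \<I>" for I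
      using that finite_subset[of I "{..<m}"] by (auto simp: idx_def \<I>_def)
    have e_y: "map ((!) e) yp = y"
      using tuplesD(1)[OF y] by (auto simp: e_def yp_def nth_append intro!: nth_equalityI)
    have e_i: "e ! i = a i" if "i < m" for i using that by (simp add: e_def nth_append)
    have e_I: "mpred C \<theta> (map ((!) e) (idx I) @ map E (K c)) = 1" if I: "I \<in> \<I>" for I
    proof -
      define l where "l = sorted_list_of_set I"
      have finI: "finite I" and lI: "length l = N" and Im: "I \<subseteq> {..<m}"
        using I finite_subset[of I "{..<m}"] by (auto simp: l_def \<I>_def)
      have "strict_mono_on {..<N} ((!) l)"
        using finI lI unfolding l_def
        by (intro strict_mono_onI) (auto intro: sorted_wrt_nth_less[OF strict_sorted_list_of_set])
      from \<theta>(4)[OF cmorley_subsequence[OF a this]]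
      have "mpred C \<theta> (rev (map (a \<circ> (!) l) [0..<N]) @ map (embc \<iota>) c) = 1" .
      moreover have "map (a \<circ> (!) l) [0..<N] = map a l" using lI by (auto intro!: nth_equalityI)
      moreover have "map ((!) e) (idx I) = rev (map a l)"
        using finI Im e_i unfolding idx_def l_def by (auto simp: rev_map)
      ultimately show ?thesis by (simp only: map_embc)
    qed
    have "(\<Sum>i<m. \<bar>mpred C \<psi> (a i # y) - val \<psi> y\<bar>) \<le> real N + \<epsilon>'" if \<epsilon>': "0 < \<epsilon>'" for \<epsilon>' :: real
    proof -
      \<comment> \<open>each of the \<open>m\<close> terms is affected by the approximation of two probabilities and by the exceptional set, a union over \<open>\<I>\<close>\<close>
      define \<epsilon> where "\<epsilon> = \<epsilon>' / (real m * (real (card \<I>) + 2) + 1)"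
      have \<epsilon>: "0 < \<epsilon>" using \<epsilon>' by (simp add: \<epsilon>_def add_nonneg_pos)
      have \<epsilon>le: "real m * (real (card \<I>) * \<epsilon>) + real m * (2 * \<epsilon>) \<le> \<epsilon>'"
      proof -
        have "(real m * (real (card \<I>) + 2) + 1) * \<epsilon> = \<epsilon>'"
          unfolding \<epsilon>_def using add_nonneg_pos[of "real m * (real (card \<I>) + 2)" 1] by simp
        then show ?thesis using \<epsilon> by (simp add: algebra_simps)
      qed
      define Q where "Q = (\<lambda>i. (\<psi>, i # yp, [])) ` {..<m} \<union> {(sfm \<psi> n, yp, K (spar \<psi> n))} \<union>
        (\<lambda>I. (\<theta>, idx I, K c)) ` \<I>"
      have "finite Q" using fin\<I> by (simp add: Q_def)
      moreover have "set js \<subseteq> {..<m + n} \<and> set d \<subseteq> R M \<and> wf_fm L (length js + length d) \<theta>'" if "(\<theta>', js, d) \<in> Q" for \<theta>' js d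
      proof -
        have par: "set (K (spar \<psi> n)) \<subseteq> R M" "set (K c) \<subseteq> R M"
          using tuplesD(2)[OF K_par[OF \<psi>]] tuplesD(2)[OF K_R[OF \<theta>(1)]] .
        from that consider i where "i < m" "\<theta>' = \<psi>" "js = i # yp" "d = []"
          | "\<theta>' = sfm \<psi> n" "js = yp" "d = K (spar \<psi> n)"
          | I where "I \<in> \<I>" "\<theta>' = \<theta>" "js = idx I" "d = K c"
          unfolding Q_def by blast
        then show ?thesis
        proof cases
          case 3
          then have "set (idx I) \<subseteq> {..<m + n}" using idx(1)[of I] by (auto simp: \<I>_def)
          then show ?thesis using 3 par \<theta>(2) idx(2)[of I] by simp
        qed (use par \<psi> scheme(2)[OF \<psi>] in \<open>auto simp: yp_def\<close>)
      qed
      ultimately obtain h where h: "h\<in>tuples (m + n) (R M)"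
        "\<And>\<theta>' js d. (\<theta>', js, d) \<in> Q \<Longrightarrow> \<bar>pr (sat U \<theta>') (map ((!) h) js @ d) - mpred C \<theta>' (map ((!) e) js @ map E d)\<bar> < \<epsilon>"
        using approximate_pr[OF elem_range_M e \<epsilon>, of Q] by fast
      have h0: "h \<in> tuples (m + n) R0" using elem_range_tuples[OF elem_range_M h(1)] .
      define w where "w = map ((!) h) yp"
      have "set yp \<subseteq> {..<m + n}" "length yp = n" by (auto simp: yp_def)
      then have w: "w \<in> tuples n R0" using select_tuples[OF h0, of yp] by (simp add: w_def)
      have hi: "h ! i \<in> R0" if "i < m" for i using nth_tuples[OF h0] that by simp
      have hiw: "h ! i # w \<in> tuples (Suc n) R0" if "i < m" for i using hi[OF that] w by simp
      have near_i: "\<bar>pr (sat U \<psi>) (h ! i # w) - mpred C \<psi> (a i # y)\<bar> < \<epsilon>" if i: "i < m" for i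
        using h(2)[of \<psi> "i # yp" "[]"] i e_y e_i[OF i] by (simp add: Q_def w_def)
      have near_val: "\<bar>pr (gen (sat U \<psi>)) w - val \<psi> y\<bar> < \<epsilon>"
      proof -
        have "(sfm \<psi> n, yp, K (spar \<psi> n)) \<in> Q" by (simp add: Q_def)
        from h(2)[OF this] show ?thesis
          unfolding w_def[symmetric] e_y pr_scheme[OF \<psi> w] val_eq[OF y, symmetric] .
      qed
      define Ev where "Ev i = {\<omega>\<in>space \<Omega>. sat U \<psi> (vals (h ! i # w) \<omega>) \<noteq> gen (sat U \<psi>) (vals w \<omega>)}" for i
      have Ev: "Ev i \<in> sets \<Omega>" if "i < m" for i
        using vals_sets[OF hiw[OF that], of "\<lambda>z. sat U \<psi> z \<noteq> gen (sat U \<psi>) (tl z)"] by (simp add: Ev_def)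
      have diff: "\<bar>pr (sat U \<psi>) (h ! i # w) - pr (gen (sat U \<psi>)) w\<bar> \<le> prob (Ev i)" if i: "i < m" for i
      proof -
        let ?A = "{\<omega>\<in>space \<Omega>. sat U \<psi> (vals (h ! i # w) \<omega>)}" and ?B = "{\<omega>\<in>space \<Omega>. gen (sat U \<psi>) (vals w \<omega>)}"
        have "\<bar>prob ?A - prob ?B\<bar> \<le> prob ((?A - ?B) \<union> (?B - ?A))"
          using vals_sets[OF hiw[OF i]] vals_sets[OF w] by (rule abs_prob_diff_le)
        also have "(?A - ?B) \<union> (?B - ?A) = Ev i" by (auto simp: Ev_def)
        finally show ?thesis by (simp add: pr_def)
      qed
      define Bd where "Bd I = {\<omega>\<in>space \<Omega>. \<not> sat U \<theta> (vals (map ((!) h) (idx I)) \<omega> @ c)}" for I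
      have hI: "map ((!) h) (idx I) \<in> tuples N R0" if I: "I \<in> \<I>" for I
      proof -
        have "set (idx I) \<subseteq> {..<m + n}" using idx(1)[OF I] I by (auto simp: \<I>_def)
        then show ?thesis using select_tuples[OF h0] idx(2)[OF I] by metis
      qed
      have Bd: "Bd I \<in> sets \<Omega>" "prob (Bd I) \<le> \<epsilon>" if I: "I \<in> \<I>" for I
      proof -
        have s: "{\<omega>\<in>space \<Omega>. sat U \<theta> (vals (map ((!) h) (idx I)) \<omega> @ c)} \<in> sets \<Omega>"
          using vals_sets[OF hI[OF I], of "\<lambda>z. sat U \<theta> (z @ c)"] .
        have eq: "Bd I = space \<Omega> - {\<omega>\<in>space \<Omega>. sat U \<theta> (vals (map ((!) h) (idx I)) \<omega> @ c)}" unfolding Bd_def by blast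
        show "Bd I \<in> sets \<Omega>" unfolding eq using s by (rule sets.compl_sets)
        have "prob (Bd I) = 1 - pr (sat U \<theta>) (map ((!) h) (idx I) @ K c)"
          unfolding eq pr_def vals_append vals_K by (rule prob_compl[OF s])
        moreover have "(\<theta>, idx I, K c) \<in> Q" using I by (simp add: Q_def)
        ultimately show "prob (Bd I) \<le> \<epsilon>" using h(2)[of \<theta> "idx I" "K c"] e_I[OF I] by (simp add: abs_less_iff)
      qed
      let ?B = "\<Union>I\<in>\<I>. Bd I"
      have B: "?B \<in> sets \<Omega>" using fin\<I> Bd(1) by (intro sets.finite_UN) auto
      have "prob ?B \<le> (\<Sum>I\<in>\<I>. prob (Bd I))" using fin\<I> Bd(1) by (intro measure_UNION_le) auto
      also have "\<dots> \<le> (\<Sum>I\<in>\<I>. \<epsilon>)" using Bd(2) by (intro sum_mono) auto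
      finally have PB: "prob ?B \<le> card \<I> * \<epsilon>" by simp
      have count: "card {i\<in>{..<m}. \<omega> \<in> Ev i} \<le> N" if \<omega>: "\<omega> \<in> space \<Omega>" "\<omega> \<notin> ?B" for \<omega>
      proof (rule ccontr)
        assume "\<not> ?thesis"
        then obtain I where I: "I \<subseteq> {i\<in>{..<m}. \<omega> \<in> Ev i}" "card I = N"
          using obtain_subset_with_card_n[of N "{i\<in>{..<m}. \<omega> \<in> Ev i}"] by auto
        then have I\<I>: "I \<in> \<I>" by (auto simp: \<I>_def)
        let ?v = "vals (map ((!) h) (idx I)) \<omega>"
        have "sat U \<theta> (?v @ c)" using \<omega> I\<I> by (auto simp: Bd_def)
        then have "\<not> (\<exists>y\<in>tuples n (carr U). \<forall>i<N. sat U \<psi> (?v ! i # y) \<noteq> gen (sat U \<psi>) y)"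
          using \<theta>(3)[OF vals_tuples[OF hI[OF I\<I>] \<omega>(1)]] by blast
        moreover have "sat U \<psi> (?v ! i # vals w \<omega>) \<noteq> gen (sat U \<psi>) (vals w \<omega>)" if i: "i < N" for i
        proof -
          have "idx I ! i \<in> I" using idx[OF I\<I>] i nth_mem by metis
          then have "\<omega> \<in> Ev (idx I ! i)" using I(1) by auto
          moreover have "?v ! i = (h ! (idx I ! i)) \<omega>" using i idx(2)[OF I\<I>] by simp
          ultimately show ?thesis by (simp add: Ev_def)
        qed
        ultimately show False using vals_tuples[OF w \<omega>(1)] by blast
      qed
      have "(\<Sum>i<m. \<bar>mpred C \<psi> (a i # y) - val \<psi> y\<bar>) \<le> (\<Sum>i<m. prob (Ev i) + 2 * \<epsilon>)"
      proof (rule sum_mono)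
        fix i assume "i \<in> {..<m}"
        then have i: "i < m" by simp
        show "\<bar>mpred C \<psi> (a i # y) - val \<psi> y\<bar> \<le> prob (Ev i) + 2 * \<epsilon>"
          using near_i[OF i] near_val diff[OF i] by linarith
      qed
      also have "\<dots> = (\<Sum>i<m. prob (Ev i)) + real m * (2 * \<epsilon>)" by (simp add: sum.distrib)
      also have "(\<Sum>i<m. prob (Ev i)) \<le> real N + card {..<m} * prob ?B"
        using Ev B count by (intro sum_prob_le_of_count) auto
      also have "real (card {..<m}) * prob ?B \<le> real m * (card \<I> * \<epsilon>)"
        using PB by (simp add: mult_left_mono)
      finally show ?thesis using \<epsilon>le by linarith
    qed
    then show "(\<Sum>i<m. \<bar>mpred C \<psi> (a i # y) - val \<psi> y\<bar>) \<le> real N"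
      by (rule field_le_epsilon)
  qed
qed

text \<open>Invariance holds since the prescribed probabilities are those of formulas over \<open>M\<close>. In an order
  pattern, let \<open>l\<close> be so large that any \<open>l\<close> members include one whose probabilities over \<open>b\<^sub>l\<close>, for
  the finitely many formulas that control \<open>\<phi>\<close>, are close to the prescribed ones. There is
  such a member before \<open>l\<close> and one after \<open>l\<close>; the value of \<open>\<phi>\<close> is almost the same at both.\<close>

lemma stable_type:
  assumes p: "p \<in> rtypes" "\<And>n \<phi> g. wf_fm L (Suc n) \<phi> \<Longrightarrow> g \<in> tuples n (mcarr C) \<Longrightarrow> Pval p \<phi> g = val \<phi> g"
  shows "cgenerically_stable (LR L) C (\<iota> ` mcarr (RR M)) p"
  unfolding cgenerically_stable_def
proof (intro conjI p(1) notI)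
  let ?N = "\<iota> ` mcarr (RR M)"
  have embcN: "embc \<iota> ` M \<subseteq> ?N"
    using const_RR[OF const_R] by (auto simp: embc_def emb0_def)
  show "cinvariant (LR L) C ?N p"
    unfolding cinvariant_def
  proof (intro allI impI ballI)
    fix n \<phi> b b' assume \<phi>: "cwf (LR L) \<phi> (Suc n)" and b: "b \<in> tuples n (mcarr C)" "b' \<in> tuples n (mcarr C)"
      and eq: "ctp (LR L) C b ?N = ctp (LR L) C b' ?N"
    have "Pval p \<psi> b = Pval p \<psi> b'" if \<psi>: "wf_fm L (Suc n) \<psi>" for \<psi>
    proof -
      let ?c = "map (embc \<iota>) (spar \<psi> n)" and ?l = "n + length (spar \<psi> n)"
      let ?P = "CPred (sfm \<psi> n) [0..<?l]"
      have th: "(?P, ?c) \<in> cparams (LR L) n ?N"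
        using cwf_pred[OF scheme(2)[OF \<psi>]] scheme(1)[OF \<psi>] embcN by (auto simp: cparams_def simp del: cwf.simps)
      have "Pval p \<psi> d = ctp (LR L) C d ?N (?P, ?c)" if d: "d \<in> tuples n (mcarr C)" for d
      proof -
        have "ctp (LR L) C d ?N (?P, ?c) = ceval C ?P (d @ ?c)" using th tuplesD(1)[OF d] by (simp add: ctp_def del: ceval.simps)
        also have "\<dots> = mpred C (sfm \<psi> n) (d @ ?c)" using tuplesD(1)[OF d] by (intro ceval_pred) simp
        also have "\<dots> = Pval p \<psi> d" using val_eq[OF d] p(2)[OF \<psi> d] by (simp add: map_embc)
        finally show ?thesis by simp
      qed
      then show ?thesis using eq b by simp
    qed
    then show "p (\<phi>, b) = p (\<phi>, b')" by (intro type_determined[OF p(1) p(1) \<phi> b])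
  qed
  assume "\<exists>n \<phi> (a :: nat \<Rightarrow> 'c) (b :: nat \<Rightarrow> 'c list) r s.
          cwf (LR L) \<phi> (Suc n) \<and>
          (\<forall>i. a i \<in> mcarr C \<and>
             ctp (LR L) C [a i] (?N \<union> a ` {..<i}) = restrict p (cparams (LR L) 1 (?N \<union> a ` {..<i}))) \<and>
          (\<forall>j. b j \<in> tuples n (mcarr C)) \<and> r < s \<and>
          (\<forall>i j. (i \<le> j \<longrightarrow> ceval C \<phi> (a i # b j) \<le> r) \<and>
                 (j < i \<longrightarrow> s \<le> ceval C \<phi> (a i # b j)))"
  then obtain n \<phi> and a :: "nat \<Rightarrow> 'c" and b r s where raw: "cwf (LR L) \<phi> (Suc n) \<and>
          (\<forall>i. a i \<in> mcarr C \<and>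
             ctp (LR L) C [a i] (?N \<union> a ` {..<i}) = restrict p (cparams (LR L) 1 (?N \<union> a ` {..<i}))) \<and>
          (\<forall>j. b j \<in> tuples n (mcarr C)) \<and> r < s \<and>
          (\<forall>i j. (i \<le> j \<longrightarrow> ceval C \<phi> (a i # b j) \<le> r) \<and>
                 (j < i \<longrightarrow> s \<le> ceval C \<phi> (a i # b j)))"
    by (elim exE) (rule that)
  then have
    \<phi>: "cwf (LR L) \<phi> (Suc n)" and aC: "\<And>i. a i \<in> mcarr C" and
    a: "\<And>i. ctp (LR L) C [a i] (?N \<union> a ` {..<i}) = restrict p (cparams (LR L) 1 (?N \<union> a ` {..<i}))" and
    b: "\<And>j. b j \<in> tuples n (mcarr C)" and rs: "r < s" and
    pattern: "\<And>i j. i \<le> j \<Longrightarrow> ceval C \<phi> (a i # b j) \<le> r" "\<And>i j. j < i \<Longrightarrow> s \<le> ceval C \<phi> (a i # b j)"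
    by simp_all
  have cm: "cmorley m a" for m
    unfolding cmorley_def
  proof (intro allI impI conjI aC)
    fix i n \<psi> c assume \<psi>: "wf_fm L (Suc n) \<psi>" and "c \<in> tuples n (embc \<iota> ` M \<union> a ` {..<i})"
    then have c: "c \<in> tuples n (?N \<union> a ` {..<i})" using embcN tuples_mono[of "embc \<iota> ` M \<union> a ` {..<i}" "?N \<union> a ` {..<i}"] by blast
    have cC: "c \<in> tuples n (mcarr C)" using c aC elem_range_mcarr[OF elem_range_M] by (auto simp: tuples_def)
    let ?P = "CPred \<psi> [0..<Suc n]"
    have th: "(?P, c) \<in> cparams (LR L) 1 (?N \<union> a ` {..<i})"
      using cwf_pred[OF \<psi>] c by (simp add: cparams_def tuples_def del: cwf.simps upt_Suc)
    have "mpred C \<psi> (a i # c) = ceval C ?P (a i # c)" using tuplesD(1)[OF c] by (intro ceval_pred[symmetric]) simp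
    also have "\<dots> = ctp (LR L) C [a i] (?N \<union> a ` {..<i}) (?P, c)" using th by (simp add: ctp_def del: ceval.simps upt_Suc)
    also have "\<dots> = p (?P, c)" unfolding a using th by (rule restrict_apply')
    also have "\<dots> = val \<psi> c" using p(2)[OF \<psi> cC] unfolding Pval_eq[OF cC] .
    finally show "mpred C \<psi> (a i # c) = val \<psi> c" .
  qed
  have "0 < (s - r) / 2" using rs by simp
  from quantifier_elimination[OF \<phi> this]
  obtain \<Psi> \<delta> where \<Psi>: "finite \<Psi>" "\<And>\<psi>. \<psi> \<in> \<Psi> \<Longrightarrow> wf_fm L (Suc n) \<psi>" "0 < (\<delta>::real)"
    "\<And>e e'. e\<in>tuples (Suc n) (mcarr C) \<Longrightarrow> e'\<in>tuples (Suc n) (mcarr C) \<Longrightarrow> \<forall>\<psi>\<in>\<Psi>. \<bar>mpred C \<psi> e - mpred C \<psi> e'\<bar> < \<delta> \<Longrightarrow>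
      \<bar>ceval C \<phi> e - ceval C \<phi> e'\<bar> \<le> (s - r) / 2" by auto
  have "\<forall>\<psi>\<in>\<Psi>. \<exists>N::nat. \<forall>y\<in>tuples n (mcarr C). \<forall>m. (\<Sum>i<m. \<bar>mpred C \<psi> (a i # y) - val \<psi> y\<bar>) \<le> real N"
  proof
    fix \<psi> assume "\<psi> \<in> \<Psi>"
    note disagreement_sum[OF \<Psi>(2)[OF this]]
    then show "\<exists>N::nat. \<forall>y\<in>tuples n (mcarr C). \<forall>m. (\<Sum>i<m. \<bar>mpred C \<psi> (a i # y) - val \<psi> y\<bar>) \<le> real N"
      using cm by blast
  qed
  from bchoice[OF this] obtain N :: "('f, 'r) fm \<Rightarrow> nat" where
    N: "\<And>\<psi> y m. \<psi> \<in> \<Psi> \<Longrightarrow> y \<in> tuples n (mcarr C) \<Longrightarrow> (\<Sum>i<m. \<bar>mpred C \<psi> (a i # y) - val \<psi> y\<bar>) \<le> real (N \<psi>)"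
    by blast
  define S where "S = (\<Sum>\<psi>\<in>\<Psi>. real (N \<psi>))"
  obtain l :: nat where l: "2 * S / \<delta> < real l" using reals_Archimedean2 by blast
  have good: "\<exists>i\<in>I. \<forall>\<psi>\<in>\<Psi>. \<bar>mpred C \<psi> (a i # b l) - val \<psi> (b l)\<bar> < \<delta> / 2"
    if I: "finite I" "l \<le> card I" for I
  proof (rule ccontr)
    assume no: "\<not> ?thesis"
    obtain m where m: "I \<subseteq> {..<m}" using I(1) finite_nat_iff_bounded by blast
    let ?d = "\<lambda>i \<psi>. \<bar>mpred C \<psi> (a i # b l) - val \<psi> (b l)\<bar>"
    have "\<delta> / 2 \<le> (\<Sum>\<psi>\<in>\<Psi>. ?d i \<psi>)" if "i \<in> I" for i
    proof -
      obtain \<psi> where "\<psi> \<in> \<Psi>" "\<delta> / 2 \<le> ?d i \<psi>" using no \<open>i \<in> I\<close> by (auto simp: not_less)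
      moreover have "?d i \<psi> \<le> (\<Sum>\<psi>\<in>\<Psi>. ?d i \<psi>)" using \<Psi>(1) \<open>\<psi> \<in> \<Psi>\<close> by (intro member_le_sum) auto
      ultimately show ?thesis by linarith
    qed
    then have "(\<Sum>i\<in>I. \<delta> / 2) \<le> (\<Sum>i\<in>I. \<Sum>\<psi>\<in>\<Psi>. ?d i \<psi>)" by (rule sum_mono)
    also have "\<dots> \<le> (\<Sum>i<m. \<Sum>\<psi>\<in>\<Psi>. ?d i \<psi>)" using m by (intro sum_mono2) (auto intro: sum_nonneg)
    also have "\<dots> = (\<Sum>\<psi>\<in>\<Psi>. \<Sum>i<m. ?d i \<psi>)" by (rule sum.swap)
    also have "\<dots> \<le> S" unfolding S_def using N[OF _ b] by (intro sum_mono)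
    finally have "real (card I) * (\<delta> / 2) \<le> S" by simp
    moreover have "real l * (\<delta> / 2) \<le> real (card I) * (\<delta> / 2)" using I(2) \<Psi>(3) by (intro mult_right_mono) auto
    moreover have "S < real l * (\<delta> / 2)" using l \<Psi>(3) by (simp add: field_simps)
    ultimately show False by linarith
  qed
  obtain i where i: "i < l" "\<And>\<psi>. \<psi> \<in> \<Psi> \<Longrightarrow> \<bar>mpred C \<psi> (a i # b l) - val \<psi> (b l)\<bar> < \<delta> / 2"
    using good[of "{..<l}"] by auto
  obtain j where j: "l < j" "\<And>\<psi>. \<psi> \<in> \<Psi> \<Longrightarrow> \<bar>mpred C \<psi> (a j # b l) - val \<psi> (b l)\<bar> < \<delta> / 2"
    using good[of "{l<..<l + l + 1}"] by auto
  have "\<bar>mpred C \<psi> (a i # b l) - mpred C \<psi> (a j # b l)\<bar> < \<delta>" if "\<psi> \<in> \<Psi>" for \<psi>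
    using i(2)[OF that] j(2)[OF that] by linarith
  then have "\<bar>ceval C \<phi> (a i # b l) - ceval C \<phi> (a j # b l)\<bar> \<le> (s - r) / 2"
    using aC b by (intro \<Psi>(4)) auto
  moreover have "ceval C \<phi> (a i # b l) \<le> r" "s \<le> ceval C \<phi> (a j # b l)"
    using pattern i(1) j(1) by auto
  ultimately have "s - r \<le> (s - r) / 2" by (simp only: abs_le_iff) linarith
  then show False using rs by simp
qed

end

context ktype
begin

text \<open>The indicator of a formula is continuous on the type space, as the formula and its negation
  define complementary open sets.\<close>

lemma definable_if_generically_stable:
  assumes gs: "generically_stable L U M \<mu>"
  shows "definable_over L U M \<mu>"
  unfolding definable_over_def
proof (intro conjI allI impI)
  show "invariant L U M \<mu>" using gs by (simp add: generically_stable_def)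
  fix n \<phi> assume \<phi>: "wf_fm L (Suc n) \<phi>"
  obtain \<psi> c where \<psi>: "set c \<subseteq> M" "wf_fm L (n + length c) \<psi>"
    "\<And>e. e\<in>tuples n (carr U) \<Longrightarrow> gen (sat U \<phi>) e \<longleftrightarrow> sat U \<psi> (e @ c)"
    using gen_definable[OF gs \<phi>] unfolding definable_def by blast
  let ?T = "type_space L U n M"
  define F where "F q = (of_bool ((\<psi>, c) \<in> q) :: real)" for q
  have pc: "(\<psi>, c) \<in> params L n M" "(Neg \<psi>, c) \<in> params L n M" using \<psi> by (auto simp: params_def)
  have sub: "topspace ?T \<subseteq> types L U n M"
    unfolding type_space_def topology_generated_by_topspace by auto
  have op: "openin ?T {q\<in>types L U n M. \<theta> \<in> q}" if "\<theta> \<in> params L n M" for \<theta>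
    unfolding type_space_def using that by (intro topology_generated_by_Basis) auto
  have op1: "openin ?T {q\<in>topspace ?T. (\<psi>, c) \<in> q}"
  proof -
    have "{q\<in>topspace ?T. (\<psi>, c) \<in> q} = topspace ?T \<inter> {q\<in>types L U n M. (\<psi>, c) \<in> q}" using sub by auto
    then show ?thesis using op[OF pc(1)] by auto
  qed
  have "(\<psi>, c) \<notin> q \<longleftrightarrow> (Neg \<psi>, c) \<in> q" if q: "q \<in> types L U n M" for q
  proof -
    have "(\<psi>, c) \<in> q \<or> (Neg \<psi>, c) \<in> q" using q pc unfolding types_def by auto
    moreover have "\<not> ((\<psi>, c) \<in> q \<and> (Neg \<psi>, c) \<in> q)"
    proof
      assume a: "(\<psi>, c) \<in> q \<and> (Neg \<psi>, c) \<in> q"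
      have "finite {(\<psi>, c), (Neg \<psi>, c)} \<and> {(\<psi>, c), (Neg \<psi>, c)} \<subseteq> q" using a by auto
      then obtain b where "\<forall>(\<phi>, c')\<in>{(\<psi>, c), (Neg \<psi>, c)}. sat U \<phi> (b @ c')"
        using q unfolding types_def by blast
      then show False by auto
    qed
    ultimately show ?thesis by blast
  qed
  then have "{q\<in>topspace ?T. (\<psi>, c) \<notin> q} = topspace ?T \<inter> {q\<in>types L U n M. (Neg \<psi>, c) \<in> q}" using sub by auto
  then have op2: "openin ?T {q\<in>topspace ?T. (\<psi>, c) \<notin> q}" using op[OF pc(2)] by auto
  have "continuous_map ?T (top_of_set {0..1}) F"
    unfolding continuous_map_def
  proof (intro conjI allI impI)
    show "F \<in> topspace ?T \<rightarrow> topspace (top_of_set {0..1})" by (auto simp: F_def)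
    fix V :: "real set" assume "openin (top_of_set {0..1}) V"
    have "{q\<in>topspace ?T. F q \<in> V} = (if 1 \<in> V then {q\<in>topspace ?T. (\<psi>, c) \<in> q} else {}) \<union>
        (if 0 \<in> V then {q\<in>topspace ?T. (\<psi>, c) \<notin> q} else {})" by (auto simp: F_def)
    then show "openin ?T {q\<in>topspace ?T. F q \<in> V}" using op1 op2 by (simp add: openin_Un)
  qed
  moreover have "F (tp L U b M) = \<mu> (defset U \<phi> b)" if b: "b \<in> tuples n (carr U)" for b
  proof -
    have "(\<psi>, c) \<in> tp L U b M \<longleftrightarrow> gen (sat U \<phi>) b"
      using \<psi>(3)[OF b] pc(1) tuplesD(1)[OF b] by (simp add: tp_def)
    moreover have "\<mu> (defset U \<phi> b) = of_bool (gen (sat U \<phi>) b)"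
      using mu_01[OF defsets_definable[OF definable_sat[OF \<phi>] b]] by (auto simp: gen_def defset_def)
    ultimately show ?thesis by (simp add: F_def)
  qed
  ultimately show "\<exists>F. continuous_map ?T (top_of_set {0..1}) F \<and> (\<forall>b\<in>tuples n (carr U). F (tp L U b M) = \<mu> (defset U \<phi> b))"
    by blast
qed

end

section \<open>The equivalence\<close>

theorem proposition3p5:
  fixes L :: "('f, 'r) lang" and T :: "('f, 'r) fm set"
    and U :: "('u, 'f, 'r) struct" and \<kappa> :: "'k rel" and M :: "'u set"
    and C :: "('c, ('f, 'r) fm) mstruct" and \<kappa>' :: "'l rel"
    and \<mu> :: "'u set \<Rightarrow> real"
  assumes "countable_lang L" and "complete_theory L T"
    and "monster \<kappa> L T U"
    and "elem_sub L M U" and "small \<kappa> M"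
    and "monster_TR TYPE('u) TYPE('w) \<kappa>' L T C"
    and "\<exists>(\<Omega> :: 'w measure) \<iota>. atomless_prob_space \<Omega> \<and> rand_embedding \<kappa>' L U M C \<Omega> \<iota>"
    and "global_type L U \<mu>"
  shows "(rgs TYPE('w) \<kappa>' L U C M \<mu> \<longleftrightarrow> irgs TYPE('w) \<kappa>' L U C M \<mu>) \<and>
         (irgs TYPE('w) \<kappa>' L U C M \<mu> \<longleftrightarrow> generically_stable L U M \<mu>)"
proof -
  interpret ktype L U \<kappa> M \<mu>
    using assms(3-5,8) by unfold_locales (auto simp: monster_def elem_sub_def)
  have setting: "rand_setting L U \<kappa> M \<mu> \<Omega> C \<iota>"
    if \<Omega>: "atomless_prob_space \<Omega>" and \<iota>: "rand_embedding \<kappa>' L U M C \<Omega> \<iota>"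
    for \<Omega> :: "'w measure" and \<iota>
  proof -
    interpret prob_space \<Omega> using \<Omega> by (simp add: atomless_prob_space_def)
    interpret rand_in \<Omega> L U C \<iota>
    proof unfold_locales
      show "\<exists>B\<in>sets \<Omega>. B \<subseteq> A \<and> 0 < prob B \<and> prob B < prob A" if "A \<in> sets \<Omega>" "0 < prob A" for A
        using \<Omega> that by (auto simp: atomless_prob_space_def)
      show "carr U \<noteq> {}" using assms(3) by (auto simp: monster_def models_def is_struct_def)
      show "metric_structure (LR L) C" using assms(6) by (simp add: monster_TR_def cmonster_def)
      show "celem_embedding (LR L) (randomization U \<Omega>) C \<iota>" using \<iota> by (simp add: rand_embedding_def)
    qed
    have 1: "celem_embedding (LR L) (RR M) (randomization U \<Omega>) id"
      "celem_embedding (LR L) (randomization U \<Omega>) C \<iota>" using \<iota> by (auto simp: rand_embedding_def)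
    have "celem_embedding (LR L) (RR M) C \<iota>"
      unfolding celem_embedding_def
    proof (intro conjI allI impI ballI)
      have sub: "mcarr (RR M) \<subseteq> mcarr (randomization U \<Omega>)" using 1(1) by (auto simp: celem_embedding_def)
      then show "\<iota> ` mcarr (RR M) \<subseteq> mcarr C" using 1(2) by (auto simp: celem_embedding_def)
      fix n \<phi> e assume \<phi>: "cwf (LR L) \<phi> n" and e: "e \<in> tuples n (mcarr (RR M))"
      have "e \<in> tuples n (mcarr (randomization U \<Omega>))" using e sub tuples_mono by blast
      then have "ceval C \<phi> (map \<iota> e) = ceval (randomization U \<Omega>) \<phi> e"
        using 1(2) \<phi> unfolding celem_embedding_def by blast
      also have "\<dots> = ceval (RR M) \<phi> e" using 1(1) \<phi> e unfolding celem_embedding_def by simp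
      finally show "ceval C \<phi> (map \<iota> e) = ceval (RR M) \<phi> e" .
    qed
    then have "elem_range M" using assms(4) by (auto simp: elem_range_def elem_sub_def is_struct_def)
    then show ?thesis by unfold_locales
  qed
  have "rgs TYPE('w) \<kappa>' L U C M \<mu>" if "irgs TYPE('w) \<kappa>' L U C M \<mu>"
    using that rand_setting.canonical_extension_random[OF setting] unfolding rgs_def irgs_def by blast
  moreover have "generically_stable L U M \<mu>" if "rgs TYPE('w) \<kappa>' L U C M \<mu>"
  proof -
    obtain \<Omega> :: "'w measure" and \<iota> p where o: "atomless_prob_space \<Omega>" "rand_embedding \<kappa>' L U M C \<Omega> \<iota>"
      "random_extension L U C \<iota> \<mu> p" "cgenerically_stable (LR L) C (\<iota> ` mcarr (randomization (sub U M) \<Omega>)) p"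
      and "definable_over L U M \<mu>" using \<open>rgs TYPE('w) \<kappa>' L U C M \<mu>\<close> unfolding rgs_def by blast
    then have "invariant L U M \<mu>" by (simp add: definable_over_def)
    then show ?thesis
      using rand_setting.random_extension_generically_stable[OF setting[OF o(1,2)] _ o(3,4)] by blast
  qed
  moreover have "irgs TYPE('w) \<kappa>' L U C M \<mu>" if gs: "generically_stable L U M \<mu>"
  proof -
    obtain \<Omega> :: "'w measure" and \<iota> where o: "atomless_prob_space \<Omega>" "rand_embedding \<kappa>' L U M C \<Omega> \<iota>"
      using assms(7) by blast
    interpret rand_setting L U \<kappa> M \<mu> \<Omega> C \<iota> using setting[OF o] .
    interpret stable_setting L U \<kappa> M \<mu> \<Omega> C \<iota> using gs by unfold_locales
    obtain p where p: "p \<in> rtypes" "\<And>n \<phi> g. wf_fm L (Suc n) \<phi> \<Longrightarrow> g \<in> tuples n (mcarr C) \<Longrightarrow> Pval p \<phi> g = val \<phi> g"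
      using ex_type by blast
    have "canonical_extension L U M C \<Omega> \<iota> \<mu> p" by (rule canonical[OF p(1)]) (rule p(2))
    moreover have "cgenerically_stable (LR L) C (\<iota> ` mcarr (RR M)) p" by (rule stable_type[OF p(1)]) (rule p(2))
    ultimately show ?thesis
      unfolding irgs_def using definable_if_generically_stable[OF gs] o by blast
  qed
  ultimately show ?thesis by blast
qed

end
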